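(* Let $\Bbbk$ be a commutative ring, let $A$ be an associative unital $\Bbbk$-algebra which is projective as a $\Bbbk$-module, let $\delta:A\to A$ be a $\Bbbk$-linear derivation, let $A^e=A\otimes A^{\mathrm{op}}$ and let $\delta^e=\delta\otimes\mathrm{id}_A+\mathrm{id}_A\otimes\delta:A^e\to A^e$, which is a derivation of $A^e$. Then $\delta:A\to A$ is a $\delta^e$-operator on the left $A^e$-module $A$, and the induced map $\nabla_\delta:H\!H^\bullet(A)\to H\!H^\bullet(A)$ coincides with the map $[\delta,-]:H\!H^\bullet(A)\to H\!H^\bullet(A)$ given by the Gerstenhaber bracket with (the class of) $\delta$. In particular, $[\delta,-]$ can be computed from any projective resolution $\epsilon:P_\bullet\to A$ of $A$ as an $A$-bimodule and any $\delta^e$-lifting $\delta_\bullet:P_\bullet\to P_\bullet$ of $\delta$: under the canonical isomorphism $H(\hom_{A^e}(P_\bullet,A))\cong H\!H^\bullet(A)$, the map $[\delta,-]$ is induced by the morphism of complexes $\delta_\bullet^\sharp$ with $\delta_i^\sharp(\phi)(p)=\delta(\phi(p))-\phi(\delta_i(p))$ for all $i\ge0$, $\phi\in\hom_{A^e}(P_i,A)$ and $p\in P_i$.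
   Context: Unadorned $\otimes$ and $\hom$ are over $\Bbbk$, and linear means $\Bbbk$-linear. $A$-bimodules are identified with left $A^e$-modules, and since $A$ is $\Bbbk$-projective, $H\!H^\bullet(A)$ is identified canonically with $\operatorname{Ext}^\bullet_{A^e}(A,A)$. For an algebra $B$ with a derivation $d$, a $d$-operator on a left $B$-module $M$ is a linear map $f:M\to M$ with $f(bm)=d(b)m+bf(m)$ for all $b\in B$, $m\in M$. If $\epsilon:P_\bullet\to M$ is a projective resolution, a $d$-lifting of $f$ to $P_\bullet$ is a sequence $(f_i)_{i\ge0}$ of $d$-operators $f_i:P_i\to P_i$ commuting with the differentials of $P_\bullet$ and such that $\epsilon f_0=f\epsilon$. Such liftings exist, and the map induced on cohomology by $f_i^\sharp:\hom_B(P_i,M)\to\hom_B(P_i,M)$, $f_i^\sharp(\phi)(p)=f(\phi(p))-\phi(f_i(p))$, gives a map $\nabla_f:\operatorname{Ext}_B^\bullet(M,M)\to\operatorname{Ext}_B^\bullet(M,M)$ which is independent of the choices of $P_\bullet$ and of the lifting. The map $\nabla_\delta$ of the claim is this map for $B=A^e$, $d=\delta^e$, $M=A$ and $f=\delta$. The Gerstenhaber bracket is defined on the standard Hochschild complex $C^\bullet(A)$, $C^i(A)=\hom(A^{\otimes i},A)$, whose cohomology is $H\!H^\bullet(A)$. For a derivation $\delta\in C^1(A)$ and $\phi\in C^n(A)$ it is $$[\delta,\phi](a_1\otimes\cdots\otimes a_n)=\delta(\phi(a_1\otimes\cdots\otimes a_n))-\sum_{j=1}^n\phi(a_1\otimes\cdots\otimes\delta(a_j)\otimes\cdots\otimes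 a_n).$$ *)

theory Defs
  imports "HOL-Algebra.Module" "HOL-Algebra.AbelCoset"
begin

section \<open>Modules and algebras\<close>

text \<open>The library's locale \<open>module\<close> requires a commutative ring of scalars.\<close>

locale left_module = R?: ring R + M?: abelian_group M
  for R (structure) and M (structure) +
  assumes lsmult_closed:
      "\<lbrakk>a \<in> carrier R; x \<in> carrier M\<rbrakk> \<Longrightarrow> a \<odot>\<^bsub>M\<^esub> x \<in> carrier M"
    and lsmult_l_distr:
      "\<lbrakk>a \<in> carrier R; b \<in> carrier R; x \<in> carrier M\<rbrakk> \<Longrightarrow>
        (a \<oplus> b) \<odot>\<^bsub>M\<^esub> x = a \<odot>\<^bsub>M\<^esub> x \<oplus>\<^bsub>M\<^esub> b \<odot>\<^bsub>M\<^esub> x"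
    and lsmult_r_distr:
      "\<lbrakk>a \<in> carrier R; x \<in> carrier M; y \<in> carrier M\<rbrakk> \<Longrightarrow>
        a \<odot>\<^bsub>M\<^esub> (x \<oplus>\<^bsub>M\<^esub> y) = a \<odot>\<^bsub>M\<^esub> x \<oplus>\<^bsub>M\<^esub> a \<odot>\<^bsub>M\<^esub> y"
    and lsmult_assoc:
      "\<lbrakk>a \<in> carrier R; b \<in> carrier R; x \<in> carrier M\<rbrakk> \<Longrightarrow>
        (a \<otimes> b) \<odot>\<^bsub>M\<^esub> x = a \<odot>\<^bsub>M\<^esub> (b \<odot>\<^bsub>M\<^esub> x)"
    and lsmult_one:
      "x \<in> carrier M \<Longrightarrow> \<one> \<odot>\<^bsub>M\<^esub> x = x"

text \<open>Associative unital algebras; the library's locale \<open>algebra\<close> is commutative.\<close>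

locale assoc_algebra = module k A + A?: ring A
  for k (structure) and A (structure) +
  assumes smult_mult_left:
      "\<lbrakk>r \<in> carrier k; x \<in> carrier A; y \<in> carrier A\<rbrakk> \<Longrightarrow>
        (r \<odot>\<^bsub>A\<^esub> x) \<otimes>\<^bsub>A\<^esub> y = r \<odot>\<^bsub>A\<^esub> (x \<otimes>\<^bsub>A\<^esub> y)"
    and smult_mult_right:
      "\<lbrakk>r \<in> carrier k; x \<in> carrier A; y \<in> carrier A\<rbrakk> \<Longrightarrow>
        x \<otimes>\<^bsub>A\<^esub> (r \<odot>\<^bsub>A\<^esub> y) = r \<odot>\<^bsub>A\<^esub> (x \<otimes>\<^bsub>A\<^esub> y)"

definition linear_map ::
  "('r, 'x) ring_scheme \<Rightarrow> ('r, 'm) module \<Rightarrow> ('r, 'n) module \<Rightarrow> ('m \<Rightarrow> 'n) \<Rightarrow> bool" where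
  "linear_map R M N f \<longleftrightarrow>
     f \<in> carrier M \<rightarrow> carrier N \<and>
     (\<forall>x\<in>carrier M. \<forall>y\<in>carrier M. f (x \<oplus>\<^bsub>M\<^esub> y) = f x \<oplus>\<^bsub>N\<^esub> f y) \<and>
     (\<forall>r\<in>carrier R. \<forall>x\<in>carrier M. f (r \<odot>\<^bsub>M\<^esub> x) = r \<odot>\<^bsub>N\<^esub> f x)"

definition linear_iso ::
  "('r, 'x) ring_scheme \<Rightarrow> ('r, 'm) module \<Rightarrow> ('r, 'n) module \<Rightarrow> ('m \<Rightarrow> 'n) \<Rightarrow> bool" where
  "linear_iso R M N f \<longleftrightarrow> linear_map R M N f \<and> bij_betw f (carrier M) (carrier N)"

text \<open>The fields \<open>mult\<close> and \<open>one\<close> of a record that is only used as a module are irrelevant.\<close>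

definition free_module :: "('r, 'x) ring_scheme \<Rightarrow> 'i set \<Rightarrow> ('r, 'i \<Rightarrow> 'r) module" where
  "free_module R I =
    \<lparr>carrier = {f. (\<forall>i. f i \<in> carrier R) \<and> (\<forall>i. i \<notin> I \<longrightarrow> f i = \<zero>\<^bsub>R\<^esub>) \<and> finite {i. f i \<noteq> \<zero>\<^bsub>R\<^esub>}},
     mult = undefined, one = undefined,
     zero = (\<lambda>i. \<zero>\<^bsub>R\<^esub>),
     add = (\<lambda>f g i. f i \<oplus>\<^bsub>R\<^esub> g i),
     smult = (\<lambda>r f i. r \<otimes>\<^bsub>R\<^esub> f i)\<rparr>"

definition basis_elem :: "('r, 'x) ring_scheme \<Rightarrow> 'i \<Rightarrow> 'i \<Rightarrow> 'r" where
  "basis_elem R i = (\<lambda>j. if j = i then \<one>\<^bsub>R\<^esub> else \<zero>\<^bsub>R\<^esub>)"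

text \<open>Projective: a direct summand of a free module. Restricting the basis \<open>I\<close> to subsets
  of the type of elements of \<open>M\<close> loses nothing, since a direct summand of any free module is also
  a direct summand of the free module on its own underlying set.\<close>

definition projective_module :: "('r, 'x) ring_scheme \<Rightarrow> ('r, 'm) module \<Rightarrow> bool" where
  "projective_module R M \<longleftrightarrow>
     left_module R M \<and>
     (\<exists>(I :: 'm set) \<iota> \<pi>.
        linear_map R M (free_module R I) \<iota> \<and>
        linear_map R (free_module R I) M \<pi> \<and>
        (\<forall>x\<in>carrier M. \<pi> (\<iota> x) = x))"

definition span_submodule :: "('r, 'x) ring_scheme \<Rightarrow> ('r, 'm) module \<Rightarrow> 'm set \<Rightarrow> 'm set" where
  "span_submodule R M S = \<Inter>{N. submodule N R M \<and> S \<subseteq> N}"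

definition quotient_module :: "('r, 'm) module \<Rightarrow> 'm set \<Rightarrow> ('r, 'm set) module" where
  "quotient_module M N =
    \<lparr>carrier = a_rcosets\<^bsub>M\<^esub> N,
     mult = undefined, one = undefined,
     zero = N,
     add = (\<lambda>X Y. X <+>\<^bsub>M\<^esub> Y),
     smult = (\<lambda>r X. \<Union>x\<in>X. N +>\<^bsub>M\<^esub> (r \<odot>\<^bsub>M\<^esub> x))\<rparr>"

definition opposite_algebra :: "('k, 'a) module \<Rightarrow> ('k, 'a) module" where
  "opposite_algebra A = A\<lparr>mult := (\<lambda>x y. y \<otimes>\<^bsub>A\<^esub> x)\<rparr>"

definition derivation :: "('k, 'x) ring_scheme \<Rightarrow> ('k, 'b) module \<Rightarrow> ('b \<Rightarrow> 'b) \<Rightarrow> bool" where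
  "derivation k B d \<longleftrightarrow>
     linear_map k B B d \<and>
     (\<forall>x\<in>carrier B. \<forall>y\<in>carrier B. d (x \<otimes>\<^bsub>B\<^esub> y) = d x \<otimes>\<^bsub>B\<^esub> y \<oplus>\<^bsub>B\<^esub> x \<otimes>\<^bsub>B\<^esub> d y)"

text \<open>A left module over a \<open>k\<close>-algebra \<open>B\<close>, viewed as a \<open>k\<close>-module.\<close>

definition restrict_scalars :: "('k, 'b) module \<Rightarrow> ('b, 'm) module \<Rightarrow> ('k, 'm) module" where
  "restrict_scalars B M =
    \<lparr>carrier = carrier M, mult = undefined, one = undefined,
     zero = \<zero>\<^bsub>M\<^esub>, add = add M,
     smult = (\<lambda>r x. (r \<odot>\<^bsub>B\<^esub> \<one>\<^bsub>B\<^esub>) \<odot>\<^bsub>M\<^esub> x)\<rparr>"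

section \<open>Tensor products over \<open>k\<close>\<close>

text \<open>The tensor product of a list \<open>Ms\<close> of \<open>k\<close>-modules is the quotient of the free module on the
  tuples (lists) in \<open>Ms\<close> by the multilinearity relations; the empty tensor product is \<open>k\<close>.\<close>

definition tuples :: "('k, 'a) module list \<Rightarrow> 'a list set" where
  "tuples Ms = listset (map carrier Ms)"

definition tensor_relations ::
  "('k, 'x) ring_scheme \<Rightarrow> ('k, 'a) module list \<Rightarrow> ('a list \<Rightarrow> 'k) set" where
  "tensor_relations k Ms =
    (let F = free_module k (tuples Ms); e = basis_elem k in
     {e (l[i := x \<oplus>\<^bsub>Ms ! i\<^esub> y]) \<ominus>\<^bsub>F\<^esub> (e (l[i := x]) \<oplus>\<^bsub>F\<^esub> e (l[i := y])) | l i x y.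
        l \<in> tuples Ms \<and> i < length Ms \<and> x \<in> carrier (Ms ! i) \<and> y \<in> carrier (Ms ! i)} \<union>
     {e (l[i := r \<odot>\<^bsub>Ms ! i\<^esub> x]) \<ominus>\<^bsub>F\<^esub> (r \<odot>\<^bsub>F\<^esub> e (l[i := x])) | l i r x.
        l \<in> tuples Ms \<and> i < length Ms \<and> r \<in> carrier k \<and> x \<in> carrier (Ms ! i)})"

definition tensor_null ::
  "('k, 'x) ring_scheme \<Rightarrow> ('k, 'a) module list \<Rightarrow> ('a list \<Rightarrow> 'k) set" where
  "tensor_null k Ms = span_submodule k (free_module k (tuples Ms)) (tensor_relations k Ms)"

definition tensor ::
  "('k, 'x) ring_scheme \<Rightarrow> ('k, 'a) module list \<Rightarrow> ('k, ('a list \<Rightarrow> 'k) set) module" where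
  "tensor k Ms = quotient_module (free_module k (tuples Ms)) (tensor_null k Ms)"

text \<open>\<open>pure_tensor k [M\<^sub>1, \<dots>, M\<^sub>n] [x\<^sub>1, \<dots>, x\<^sub>n]\<close> is \<open>x\<^sub>1 \<otimes> \<dots> \<otimes> x\<^sub>n\<close>.\<close>

definition pure_tensor ::
  "('k, 'x) ring_scheme \<Rightarrow> ('k, 'a) module list \<Rightarrow> 'a list \<Rightarrow> ('a list \<Rightarrow> 'k) set" where
  "pure_tensor k Ms l = tensor_null k Ms +>\<^bsub>free_module k (tuples Ms)\<^esub> basis_elem k l"

text \<open>For multilinear \<open>g\<close>, \<open>tensor_lift k N g\<close> is the linear map with
  \<open>x\<^sub>1 \<otimes> \<dots> \<otimes> x\<^sub>n \<mapsto> g [x\<^sub>1, \<dots>, x\<^sub>n]\<close>, evaluated on a coset via any of its representatives.\<close>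

definition tensor_lift ::
  "('k, 'x) ring_scheme \<Rightarrow> ('k, 'n) module \<Rightarrow> ('a list \<Rightarrow> 'n) \<Rightarrow> ('a list \<Rightarrow> 'k) set \<Rightarrow> 'n" where
  "tensor_lift k N g X =
     the_elem ((\<lambda>x. \<Oplus>\<^bsub>N\<^esub>l\<in>{l. x l \<noteq> \<zero>\<^bsub>k\<^esub>}. x l \<odot>\<^bsub>N\<^esub> g l) ` X)"

definition tensor_map ::
  "('k, 'x) ring_scheme \<Rightarrow> ('k, 'a) module list \<Rightarrow> ('a \<Rightarrow> 'a) list \<Rightarrow>
    ('a list \<Rightarrow> 'k) set \<Rightarrow> ('a list \<Rightarrow> 'k) set" where
  "tensor_map k Ms fs =
     tensor_lift k (tensor k Ms) (\<lambda>l. pure_tensor k Ms (map2 (\<lambda>f x. f x) fs l))"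

definition tensor_algebra ::
  "('k, 'x) ring_scheme \<Rightarrow> ('k, 'a) module list \<Rightarrow> ('k, ('a list \<Rightarrow> 'k) set) module" where
  "tensor_algebra k As = (tensor k As)
    \<lparr>mult := (\<lambda>X Y.
        tensor_lift k (tensor k As) (\<lambda>l.
          tensor_lift k (tensor k As) (\<lambda>m.
            pure_tensor k As (map (\<lambda>i. l ! i \<otimes>\<^bsub>As ! i\<^esub> m ! i) [0..<length As])) Y) X),
     one := pure_tensor k As (map one As)\<rparr>"

definition enveloping_algebra ::
  "('k, 'x) ring_scheme \<Rightarrow> ('k, 'a) module \<Rightarrow> ('k, ('a list \<Rightarrow> 'k) set) module" where
  "enveloping_algebra k A = tensor_algebra k [A, opposite_algebra A]"

definition enveloping_derivation ::
  "('k, 'x) ring_scheme \<Rightarrow> ('k, 'a) module \<Rightarrow> ('a \<Rightarrow> 'a) \<Rightarrow>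
    ('a list \<Rightarrow> 'k) set \<Rightarrow> ('a list \<Rightarrow> 'k) set" where
  "enveloping_derivation k A \<delta> u =
     tensor_map k [A, opposite_algebra A] [\<delta>, id] u
       \<oplus>\<^bsub>enveloping_algebra k A\<^esub> tensor_map k [A, opposite_algebra A] [id, \<delta>] u"

text \<open>\<open>A\<close> as a left module over its enveloping algebra: \<open>(a \<otimes> b) \<cdot> x = a x b\<close>.\<close>

definition enveloping_self_module ::
  "('k, 'x) ring_scheme \<Rightarrow> ('k, 'a) module \<Rightarrow> (('a list \<Rightarrow> 'k) set, 'a) module" where
  "enveloping_self_module k A =
    \<lparr>carrier = carrier A, mult = undefined, one = undefined,
     zero = \<zero>\<^bsub>A\<^esub>, add = add A,
     smult = (\<lambda>u x. tensor_lift k A (\<lambda>l. l ! 0 \<otimes>\<^bsub>A\<^esub> x \<otimes>\<^bsub>A\<^esub> l ! 1) u)\<rparr>"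

section \<open>Cochain complexes of \<open>k\<close>-modules\<close>

definition cocycles ::
  "(nat \<Rightarrow> ('k, 'c) module) \<Rightarrow> (nat \<Rightarrow> 'c \<Rightarrow> 'c) \<Rightarrow> nat \<Rightarrow> 'c set" where
  "cocycles C D n = {x \<in> carrier (C n). D n x = \<zero>\<^bsub>C (Suc n)\<^esub>}"

definition coboundaries ::
  "(nat \<Rightarrow> ('k, 'c) module) \<Rightarrow> (nat \<Rightarrow> 'c \<Rightarrow> 'c) \<Rightarrow> nat \<Rightarrow> 'c set" where
  "coboundaries C D n =
     (case n of 0 \<Rightarrow> {\<zero>\<^bsub>C 0\<^esub>} | Suc m \<Rightarrow> D m ` carrier (C m))"

definition cohomology ::
  "(nat \<Rightarrow> ('k, 'c) module) \<Rightarrow> (nat \<Rightarrow> 'c \<Rightarrow> 'c) \<Rightarrow> nat \<Rightarrow> ('k, 'c set) module" where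
  "cohomology C D n = quotient_module ((C n)\<lparr>carrier := cocycles C D n\<rparr>) (coboundaries C D n)"

definition cochain_map ::
  "('k, 'x) ring_scheme \<Rightarrow> (nat \<Rightarrow> ('k, 'c) module) \<Rightarrow> (nat \<Rightarrow> 'c \<Rightarrow> 'c) \<Rightarrow>
    (nat \<Rightarrow> ('k, 'e) module) \<Rightarrow> (nat \<Rightarrow> 'e \<Rightarrow> 'e) \<Rightarrow> (nat \<Rightarrow> 'c \<Rightarrow> 'e) \<Rightarrow> bool" where
  "cochain_map k C D C' D' F \<longleftrightarrow>
     (\<forall>n. linear_map k (C n) (C' n) (F n) \<and>
          (\<forall>x\<in>carrier (C n). F (Suc n) (D n x) = D' n (F n x)))"

text \<open>The map \<open>[x] \<mapsto> [F n x]\<close> from the cohomology of any complex to that of \<open>(C', D')\<close>.\<close>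

definition cohomology_map ::
  "(nat \<Rightarrow> ('k, 'e) module) \<Rightarrow> (nat \<Rightarrow> 'e \<Rightarrow> 'e) \<Rightarrow> (nat \<Rightarrow> 'c \<Rightarrow> 'e) \<Rightarrow>
    nat \<Rightarrow> 'c set \<Rightarrow> 'e set" where
  "cohomology_map C' D' F n X = the_elem ((\<lambda>x. coboundaries C' D' n +>\<^bsub>C' n\<^esub> F n x) ` X)"

text \<open>\<open>hom_module R M N s\<close> is the set of \<open>R\<close>-linear maps \<open>M \<rightarrow> N\<close>, with scalars acting pointwise
  through \<open>s\<close>. Its elements are extensional, so that equality is equality on \<open>carrier M\<close>.\<close>

definition hom_module ::
  "('r, 'x) ring_scheme \<Rightarrow> ('r, 'm) module \<Rightarrow> ('r, 'n) module \<Rightarrow> ('k \<Rightarrow> 'n \<Rightarrow> 'n) \<Rightarrow>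
    ('k, 'm \<Rightarrow> 'n) module" where
  "hom_module R M N s =
    \<lparr>carrier = {\<phi> \<in> extensional (carrier M). linear_map R M N \<phi>},
     mult = undefined, one = undefined,
     zero = (\<lambda>p\<in>carrier M. \<zero>\<^bsub>N\<^esub>),
     add = (\<lambda>\<phi> \<psi>. \<lambda>p\<in>carrier M. \<phi> p \<oplus>\<^bsub>N\<^esub> \<psi> p),
     smult = (\<lambda>r \<phi>. \<lambda>p\<in>carrier M. s r (\<phi> p))\<rparr>"

section \<open>Projective resolutions, Ext and \<open>d\<close>-operators\<close>

definition projective_resolution ::
  "('b, 'x) ring_scheme \<Rightarrow> ('b, 'm) module \<Rightarrow> (nat \<Rightarrow> ('b, 'p) module) \<Rightarrow>
    (nat \<Rightarrow> 'p \<Rightarrow> 'p) \<Rightarrow> ('p \<Rightarrow> 'm) \<Rightarrow> bool" where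
  "projective_resolution B M P dP \<epsilon> \<longleftrightarrow>
     left_module B M \<and>
     (\<forall>n. projective_module B (P n)) \<and>
     (\<forall>n. linear_map B (P (Suc n)) (P n) (dP n)) \<and>
     linear_map B (P 0) M \<epsilon> \<and>
     \<epsilon> ` carrier (P 0) = carrier M \<and>
     dP 0 ` carrier (P 1) = {p \<in> carrier (P 0). \<epsilon> p = \<zero>\<^bsub>M\<^esub>} \<and>
     (\<forall>n. dP (Suc n) ` carrier (P (Suc (Suc n))) =
            {p \<in> carrier (P (Suc n)). dP n p = \<zero>\<^bsub>P n\<^esub>})"

text \<open>Morphisms \<open>\<theta> : (P, dP, \<epsilon>) \<rightarrow> (Q, dQ, \<epsilon>')\<close> of resolutions of \<open>M\<close> over the identity of \<open>M\<close>.\<close>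

definition resolution_map ::
  "('b, 'x) ring_scheme \<Rightarrow>
    (nat \<Rightarrow> ('b, 'p) module) \<Rightarrow> (nat \<Rightarrow> 'p \<Rightarrow> 'p) \<Rightarrow> ('p \<Rightarrow> 'm) \<Rightarrow>
    (nat \<Rightarrow> ('b, 'q) module) \<Rightarrow> (nat \<Rightarrow> 'q \<Rightarrow> 'q) \<Rightarrow> ('q \<Rightarrow> 'm) \<Rightarrow>
    (nat \<Rightarrow> 'p \<Rightarrow> 'q) \<Rightarrow> bool" where
  "resolution_map B P dP \<epsilon> Q dQ \<epsilon>' \<theta> \<longleftrightarrow>
     (\<forall>n. linear_map B (P n) (Q n) (\<theta> n)) \<and>
     (\<forall>n. \<forall>p\<in>carrier (P (Suc n)). \<theta> n (dP n p) = dQ n (\<theta> (Suc n) p)) \<and>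
     (\<forall>p\<in>carrier (P 0). \<epsilon>' (\<theta> 0 p) = \<epsilon> p)"

definition hom_complex ::
  "('k, 'b) module \<Rightarrow> (nat \<Rightarrow> ('b, 'p) module) \<Rightarrow> ('b, 'm) module \<Rightarrow>
    nat \<Rightarrow> ('k, 'p \<Rightarrow> 'm) module" where
  "hom_complex B P M n = hom_module B (P n) M (smult (restrict_scalars B M))"

definition hom_diff ::
  "(nat \<Rightarrow> ('b, 'p) module) \<Rightarrow> (nat \<Rightarrow> 'p \<Rightarrow> 'p) \<Rightarrow> nat \<Rightarrow> ('p \<Rightarrow> 'm) \<Rightarrow> 'p \<Rightarrow> 'm" where
  "hom_diff P dP n \<phi> = (\<lambda>p\<in>carrier (P (Suc n)). \<phi> (dP n p))"

text \<open>If \<open>(P, dP)\<close> is a projective resolution of \<open>N\<close>, then \<open>Ext_via B P dP M n\<close> is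
  the \<open>n\<close>-th Ext module over \<open>B\<close> of \<open>N\<close> and \<open>M\<close>, computed with that resolution.\<close>

definition Ext_via ::
  "('k, 'b) module \<Rightarrow> (nat \<Rightarrow> ('b, 'p) module) \<Rightarrow> (nat \<Rightarrow> 'p \<Rightarrow> 'p) \<Rightarrow> ('b, 'm) module \<Rightarrow>
    nat \<Rightarrow> ('k, ('p \<Rightarrow> 'm) set) module" where
  "Ext_via B P dP M = cohomology (hom_complex B P M) (hom_diff P dP)"

definition d_operator ::
  "('k, 'x) ring_scheme \<Rightarrow> ('k, 'b) module \<Rightarrow> ('b \<Rightarrow> 'b) \<Rightarrow> ('b, 'm) module \<Rightarrow>
    ('m \<Rightarrow> 'm) \<Rightarrow> bool" where
  "d_operator k B d M f \<longleftrightarrow>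
     linear_map k (restrict_scalars B M) (restrict_scalars B M) f \<and>
     (\<forall>b\<in>carrier B. \<forall>m\<in>carrier M. f (b \<odot>\<^bsub>M\<^esub> m) = d b \<odot>\<^bsub>M\<^esub> m \<oplus>\<^bsub>M\<^esub> b \<odot>\<^bsub>M\<^esub> f m)"

definition d_lifting ::
  "('k, 'x) ring_scheme \<Rightarrow> ('k, 'b) module \<Rightarrow> ('b \<Rightarrow> 'b) \<Rightarrow>
    (nat \<Rightarrow> ('b, 'p) module) \<Rightarrow> (nat \<Rightarrow> 'p \<Rightarrow> 'p) \<Rightarrow> ('p \<Rightarrow> 'm) \<Rightarrow>
    ('m \<Rightarrow> 'm) \<Rightarrow> (nat \<Rightarrow> 'p \<Rightarrow> 'p) \<Rightarrow> bool" where
  "d_lifting k B d P dP \<epsilon> f fs \<longleftrightarrow>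
     (\<forall>n. d_operator k B d (P n) (fs n)) \<and>
     (\<forall>n. \<forall>p\<in>carrier (P (Suc n)). fs n (dP n p) = dP n (fs (Suc n) p)) \<and>
     (\<forall>p\<in>carrier (P 0). \<epsilon> (fs 0 p) = f (\<epsilon> p))"

definition sharp ::
  "(nat \<Rightarrow> ('b, 'p) module) \<Rightarrow> ('b, 'm) module \<Rightarrow> ('m \<Rightarrow> 'm) \<Rightarrow> (nat \<Rightarrow> 'p \<Rightarrow> 'p) \<Rightarrow>
    nat \<Rightarrow> ('p \<Rightarrow> 'm) \<Rightarrow> 'p \<Rightarrow> 'm" where
  "sharp P M f fs n \<phi> = (\<lambda>p\<in>carrier (P n). f (\<phi> p) \<ominus>\<^bsub>M\<^esub> \<phi> (fs n p))"

definition nabla ::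
  "('k, 'x) ring_scheme \<Rightarrow> ('k, 'b) module \<Rightarrow> ('b \<Rightarrow> 'b) \<Rightarrow> ('b, 'm) module \<Rightarrow>
    (nat \<Rightarrow> ('b, 'p) module) \<Rightarrow> (nat \<Rightarrow> 'p \<Rightarrow> 'p) \<Rightarrow> ('p \<Rightarrow> 'm) \<Rightarrow> ('m \<Rightarrow> 'm) \<Rightarrow>
    nat \<Rightarrow> ('p \<Rightarrow> 'm) set \<Rightarrow> ('p \<Rightarrow> 'm) set" where
  "nabla k B d M P dP \<epsilon> f =
     cohomology_map (hom_complex B P M) (hom_diff P dP)
       (sharp P M f (SOME fs. d_lifting k B d P dP \<epsilon> f fs))"

section \<open>The Hochschild complex and the bar resolution\<close>

abbreviation tensor_power ::
  "('k, 'x) ring_scheme \<Rightarrow> ('k, 'a) module \<Rightarrow> nat \<Rightarrow> ('k, ('a list \<Rightarrow> 'k) set) module" where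
  "tensor_power k A n \<equiv> tensor k (replicate n A)"

abbreviation power_elem ::
  "('k, 'x) ring_scheme \<Rightarrow> ('k, 'a) module \<Rightarrow> nat \<Rightarrow> 'a list \<Rightarrow> ('a list \<Rightarrow> 'k) set" where
  "power_elem k A n \<equiv> pure_tensor k (replicate n A)"

definition signed :: "('m, 'x) ring_scheme \<Rightarrow> nat \<Rightarrow> 'm \<Rightarrow> 'm" where
  "signed M i x = (if even i then x else \<ominus>\<^bsub>M\<^esub> x)"

text \<open>Multiply the entries in the (0-based) positions \<open>i\<close> and \<open>i + 1\<close> of a list.\<close>

definition contract :: "('a, 'x) ring_scheme \<Rightarrow> nat \<Rightarrow> 'a list \<Rightarrow> 'a list" where
  "contract A i l = take i l @ [l ! i \<otimes>\<^bsub>A\<^esub> l ! Suc i] @ drop (i + 2) l"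

definition hochschild_cochains ::
  "('k, 'x) ring_scheme \<Rightarrow> ('k, 'a) module \<Rightarrow> nat \<Rightarrow> ('k, ('a list \<Rightarrow> 'k) set \<Rightarrow> 'a) module" where
  "hochschild_cochains k A n = hom_module k (tensor_power k A n) A (smult A)"

definition hochschild_diff ::
  "('k, 'x) ring_scheme \<Rightarrow> ('k, 'a) module \<Rightarrow> nat \<Rightarrow>
    (('a list \<Rightarrow> 'k) set \<Rightarrow> 'a) \<Rightarrow> ('a list \<Rightarrow> 'k) set \<Rightarrow> 'a" where
  "hochschild_diff k A n \<phi> =
    restrict (tensor_lift k A (\<lambda>l.
        hd l \<otimes>\<^bsub>A\<^esub> \<phi> (power_elem k A n (tl l))
          \<oplus>\<^bsub>A\<^esub> (\<Oplus>\<^bsub>A\<^esub>i\<in>{..<n}. signed A (Suc i) (\<phi> (power_elem k A n (contract A i l))))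
          \<oplus>\<^bsub>A\<^esub> signed A (Suc n) (\<phi> (power_elem k A n (butlast l)) \<otimes>\<^bsub>A\<^esub> last l)))
      (carrier (tensor_power k A (Suc n)))"

definition HH ::
  "('k, 'x) ring_scheme \<Rightarrow> ('k, 'a) module \<Rightarrow> nat \<Rightarrow>
    ('k, (('a list \<Rightarrow> 'k) set \<Rightarrow> 'a) set) module" where
  "HH k A = cohomology (hochschild_cochains k A) (hochschild_diff k A)"

text \<open>The Gerstenhaber bracket with a derivation, on cochains and on cohomology.\<close>

definition gerstenhaber_cochain ::
  "('k, 'x) ring_scheme \<Rightarrow> ('k, 'a) module \<Rightarrow> ('a \<Rightarrow> 'a) \<Rightarrow> nat \<Rightarrow>
    (('a list \<Rightarrow> 'k) set \<Rightarrow> 'a) \<Rightarrow> ('a list \<Rightarrow> 'k) set \<Rightarrow> 'a" where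
  "gerstenhaber_cochain k A \<delta> n \<phi> =
    restrict (tensor_lift k A (\<lambda>l.
        \<delta> (\<phi> (power_elem k A n l))
          \<ominus>\<^bsub>A\<^esub> (\<Oplus>\<^bsub>A\<^esub>j\<in>{..<n}. \<phi> (power_elem k A n (l[j := \<delta> (l ! j)])))))
      (carrier (tensor_power k A n))"

definition gerstenhaber_bracket ::
  "('k, 'x) ring_scheme \<Rightarrow> ('k, 'a) module \<Rightarrow> ('a \<Rightarrow> 'a) \<Rightarrow> nat \<Rightarrow>
    (('a list \<Rightarrow> 'k) set \<Rightarrow> 'a) set \<Rightarrow> (('a list \<Rightarrow> 'k) set \<Rightarrow> 'a) set" where
  "gerstenhaber_bracket k A \<delta> =
     cohomology_map (hochschild_cochains k A) (hochschild_diff k A) (gerstenhaber_cochain k A \<delta>)"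

text \<open>In degree \<open>n\<close> the bar resolution is the \<open>(n + 2)\<close>-nd tensor power of \<open>A\<close>, with the enveloping
  algebra acting on the outer factors.\<close>

definition bar_module ::
  "('k, 'x) ring_scheme \<Rightarrow> ('k, 'a) module \<Rightarrow> nat \<Rightarrow>
    (('a list \<Rightarrow> 'k) set, ('a list \<Rightarrow> 'k) set) module" where
  "bar_module k A n =
    (let T = tensor_power k A (n + 2) in
    \<lparr>carrier = carrier T, mult = undefined, one = undefined, zero = \<zero>\<^bsub>T\<^esub>, add = add T,
     smult = (\<lambda>u X.
       tensor_lift k T (\<lambda>m.
         tensor_lift k T (\<lambda>l.
           power_elem k A (n + 2)
             (l[0 := m ! 0 \<otimes>\<^bsub>A\<^esub> l ! 0, n + 1 := l ! (n + 1) \<otimes>\<^bsub>A\<^esub> m ! 1])) X) u)\<rparr>)"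

definition bar_diff ::
  "('k, 'x) ring_scheme \<Rightarrow> ('k, 'a) module \<Rightarrow> nat \<Rightarrow> ('a list \<Rightarrow> 'k) set \<Rightarrow> ('a list \<Rightarrow> 'k) set" where
  "bar_diff k A n =
    (let T = tensor_power k A (n + 2) in
     tensor_lift k T (\<lambda>l.
       \<Oplus>\<^bsub>T\<^esub>i\<in>{..n + 1}. signed T i (power_elem k A (n + 2) (contract A i l))))"

definition bar_augmentation ::
  "('k, 'x) ring_scheme \<Rightarrow> ('k, 'a) module \<Rightarrow> ('a list \<Rightarrow> 'k) set \<Rightarrow> 'a" where
  "bar_augmentation k A = tensor_lift k A (\<lambda>l. l ! 0 \<otimes>\<^bsub>A\<^esub> l ! 1)"

text \<open>The bimodule map on the bar resolution that corresponds to a Hochschild cochain: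
  \<open>a\<^sub>0 \<otimes> \<dots> \<otimes> a\<^sub>n\<^sub>+\<^sub>1 \<mapsto> a\<^sub>0 \<phi>(a\<^sub>1 \<otimes> \<dots> \<otimes> a\<^sub>n) a\<^sub>n\<^sub>+\<^sub>1\<close>.\<close>

definition cochain_to_bar ::
  "('k, 'x) ring_scheme \<Rightarrow> ('k, 'a) module \<Rightarrow> nat \<Rightarrow>
    (('a list \<Rightarrow> 'k) set \<Rightarrow> 'a) \<Rightarrow> ('a list \<Rightarrow> 'k) set \<Rightarrow> 'a" where
  "cochain_to_bar k A n \<phi> =
    restrict (tensor_lift k A (\<lambda>l.
        hd l \<otimes>\<^bsub>A\<^esub> \<phi> (power_elem k A n (butlast (tl l))) \<otimes>\<^bsub>A\<^esub> last l))
      (carrier (bar_module k A n))"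

abbreviation to_bar ::
  "('k, 'x) ring_scheme \<Rightarrow> ('k, 'a) module \<Rightarrow>
    (nat \<Rightarrow> (('a list \<Rightarrow> 'k) set, 'p) module) \<Rightarrow> (nat \<Rightarrow> 'p \<Rightarrow> 'p) \<Rightarrow> ('p \<Rightarrow> 'a) \<Rightarrow>
    (nat \<Rightarrow> 'p \<Rightarrow> ('a list \<Rightarrow> 'k) set) \<Rightarrow> bool" where
  "to_bar k A P dP \<epsilon> \<theta> \<equiv>
     resolution_map (enveloping_algebra k A) P dP \<epsilon>
       (bar_module k A) (bar_diff k A) (bar_augmentation k A) \<theta>"

definition HH_to_Ext_along ::
  "('k, 'x) ring_scheme \<Rightarrow> ('k, 'a) module \<Rightarrow>
    (nat \<Rightarrow> (('a list \<Rightarrow> 'k) set, 'p) module) \<Rightarrow> (nat \<Rightarrow> 'p \<Rightarrow> 'p) \<Rightarrow>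
    (nat \<Rightarrow> 'p \<Rightarrow> ('a list \<Rightarrow> 'k) set) \<Rightarrow>
    nat \<Rightarrow> (('a list \<Rightarrow> 'k) set \<Rightarrow> 'a) set \<Rightarrow> ('p \<Rightarrow> 'a) set" where
  "HH_to_Ext_along k A P dP \<theta> =
     cohomology_map
       (hom_complex (enveloping_algebra k A) P (enveloping_self_module k A)) (hom_diff P dP)
       (\<lambda>n \<phi>. \<lambda>p\<in>carrier (P n). cochain_to_bar k A n \<phi> (\<theta> n p))"

text \<open>The canonical identification; the choice of \<open>\<theta>\<close> does not matter, because any two
  choices are chain homotopic.\<close>

definition HH_to_Ext ::
  "('k, 'x) ring_scheme \<Rightarrow> ('k, 'a) module \<Rightarrow>
    (nat \<Rightarrow> (('a list \<Rightarrow> 'k) set, 'p) module) \<Rightarrow> (nat \<Rightarrow> 'p \<Rightarrow> 'p) \<Rightarrow> ('p \<Rightarrow> 'a) \<Rightarrow>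
    nat \<Rightarrow> (('a list \<Rightarrow> 'k) set \<Rightarrow> 'a) set \<Rightarrow> ('p \<Rightarrow> 'a) set" where
  "HH_to_Ext k A P dP \<epsilon> = HH_to_Ext_along k A P dP (SOME \<theta>. to_bar k A P dP \<epsilon> \<theta>)"

text \<open>The map induced by \<open>\<delta>\<close> on Hochschild cohomology, transported from Ext.\<close>

definition nabla_HH ::
  "('k, 'x) ring_scheme \<Rightarrow> ('k, 'a) module \<Rightarrow> ('a \<Rightarrow> 'a) \<Rightarrow>
    (nat \<Rightarrow> (('a list \<Rightarrow> 'k) set, 'p) module) \<Rightarrow> (nat \<Rightarrow> 'p \<Rightarrow> 'p) \<Rightarrow> ('p \<Rightarrow> 'a) \<Rightarrow>
    nat \<Rightarrow> (('a list \<Rightarrow> 'k) set \<Rightarrow> 'a) set \<Rightarrow> (('a list \<Rightarrow> 'k) set \<Rightarrow> 'a) set" where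
  "nabla_HH k A \<delta> P dP \<epsilon> n x =
     inv_into (carrier (HH k A n)) (HH_to_Ext k A P dP \<epsilon> n)
       (nabla k (enveloping_algebra k A) (enveloping_derivation k A \<delta>)
          (enveloping_self_module k A) P dP \<epsilon> \<delta> n
          (HH_to_Ext k A P dP \<epsilon> n x))"

end

theory Submission
  imports Defs
begin

text \<open>
  The bar resolution carries a distinguished \<open>\<delta>\<^sup>e\<close>-lifting of \<open>\<delta>\<close>, namely
  \<open>\<Sum>\<^sub>j id \<otimes> \<dots> \<otimes> \<delta> \<otimes> \<dots> \<otimes> id\<close>, and under the identification of Hochschild cochains with bimodule
  maps out of the bar resolution its \<open>sharp\<close> map is the cochain-level bracket \<open>[\<delta>, -]\<close>. If \<open>\<theta>\<close> is a
  comparison map from another resolution and \<open>\<delta>\<^sub>\<bullet>\<close> a lifting on it, then the defect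
  of \<open>\<theta>\<close> with respect to the two liftings is a bimodule chain map over zero, since the derivation terms
  cancel; hence it is null-homotopic and both sharp maps agree on cohomology.

  Vanishing of bimodule maps on the bar resolution is verified on the image of the contracting
  homotopy \<open>s x = 1 \<otimes> x\<close>, which generates the bar modules. There \<open>d s = 1 - s d\<close> reduces
  \<open>d d = 0\<close>, and the compatibility of \<open>d\<close> with the lifting of \<open>\<delta>\<close>, to the preceding degree, so that no
  double sum of face maps occurs.
\<close>

section \<open>Linear algebra over a noncommutative ring\<close>

text \<open>The homotopy \<open>cone\<close> is only \<open>k\<close>-linear, so it is no bimodule
  map; it acts through \<open>bar_maps_eq\<close>, where multiplying by \<open>t x \<one>\<close>
  recovers every word from its image. Since \<open>der\<close> is not a bimodule map either, only
  differences of composites with it are passed to \<open>bar_maps_eq\<close>. Projectivity of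
  \<open>A\<close> over \<open>k\<close> enters at one point: to split the canonical free cover of
  each bar module, multilinear maps on words are lifted through surjections by induction on the
  number of letters. Hochschild formulas are hardly computed with. As \<open>cochain_to_bar\<close>
  is a linear bijection onto bimodule maps, the vanishing square of the Hochschild differential and
  the compatibility of the bracket with it are read off on the bar side; one face-by-face comparison
  of the two differentials suffices. The identification with Ext and \<open>nabla\<close> rest on
  \<open>SOME\<close>, so existence and independence are both needed: the lifting property of
  projectives gives the first, null-homotopies the second.\<close>

declare (in left_module) lsmult_closed [simp, intro] lsmult_one [simp]

lemma left_moduleI:
  assumes "ring R" "abelian_group M"
    and "\<And>a x. \<lbrakk>a \<in> carrier R; x \<in> carrier M\<rbrakk> \<Longrightarrow> a \<odot>\<^bsub>M\<^esub> x \<in> carrier M"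
    and "\<And>a b x. \<lbrakk>a \<in> carrier R; b \<in> carrier R; x \<in> carrier M\<rbrakk> \<Longrightarrow>
        (a \<oplus>\<^bsub>R\<^esub> b) \<odot>\<^bsub>M\<^esub> x = a \<odot>\<^bsub>M\<^esub> x \<oplus>\<^bsub>M\<^esub> b \<odot>\<^bsub>M\<^esub> x"
    and "\<And>a x y. \<lbrakk>a \<in> carrier R; x \<in> carrier M; y \<in> carrier M\<rbrakk> \<Longrightarrow>
        a \<odot>\<^bsub>M\<^esub> (x \<oplus>\<^bsub>M\<^esub> y) = a \<odot>\<^bsub>M\<^esub> x \<oplus>\<^bsub>M\<^esub> a \<odot>\<^bsub>M\<^esub> y"
    and "\<And>a b x. \<lbrakk>a \<in> carrier R; b \<in> carrier R; x \<in> carrier M\<rbrakk> \<Longrightarrow>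
        (a \<otimes>\<^bsub>R\<^esub> b) \<odot>\<^bsub>M\<^esub> x = a \<odot>\<^bsub>M\<^esub> (b \<odot>\<^bsub>M\<^esub> x)"
    and "\<And>x. x \<in> carrier M \<Longrightarrow> \<one>\<^bsub>R\<^esub> \<odot>\<^bsub>M\<^esub> x = x"
  shows "left_module R M"
  using assms by (simp add: left_module_def left_module_axioms_def)

lemma left_module_imp_module:
  assumes "cring R" "left_module R M" shows "module R M"
proof -
  interpret left_module R M by fact
  show ?thesis
    by (rule moduleI) (simp_all add: assms M.abelian_group_axioms lsmult_l_distr lsmult_r_distr lsmult_assoc)
qed

lemma module_imp_left_module:
  assumes "module R M" shows "left_module R M"
proof -
  interpret module R M by fact
  show ?thesis
    by (rule left_moduleI)
      (simp_all add: R.ring_axioms M.abelian_group_axioms smult_l_distr smult_r_distr smult_assoc1)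
qed

context left_module
begin

lemma lsmult_l_null [simp]: "x \<in> carrier M \<Longrightarrow> \<zero> \<odot>\<^bsub>M\<^esub> x = \<zero>\<^bsub>M\<^esub>"
  using lsmult_l_distr [of \<zero> \<zero> x] by (metis M.add.r_cancel_one' R.zero_closed R.l_zero lsmult_closed)

lemma lsmult_r_null [simp]: "a \<in> carrier R \<Longrightarrow> a \<odot>\<^bsub>M\<^esub> \<zero>\<^bsub>M\<^esub> = \<zero>\<^bsub>M\<^esub>"
  using lsmult_r_distr [of a "\<zero>\<^bsub>M\<^esub>" "\<zero>\<^bsub>M\<^esub>"]
  by (metis M.add.r_cancel_one' M.zero_closed M.l_zero lsmult_closed)

lemma lsmult_l_minus:
  "\<lbrakk>a \<in> carrier R; x \<in> carrier M\<rbrakk> \<Longrightarrow> (\<ominus> a) \<odot>\<^bsub>M\<^esub> x = \<ominus>\<^bsub>M\<^esub> (a \<odot>\<^bsub>M\<^esub> x)"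
  by (metis M.add.inv_equality R.add.inv_closed R.l_neg lsmult_closed lsmult_l_distr lsmult_l_null)

lemma lsmult_r_minus:
  "\<lbrakk>a \<in> carrier R; x \<in> carrier M\<rbrakk> \<Longrightarrow> a \<odot>\<^bsub>M\<^esub> (\<ominus>\<^bsub>M\<^esub> x) = \<ominus>\<^bsub>M\<^esub> (a \<odot>\<^bsub>M\<^esub> x)"
  by (metis M.add.inv_equality M.add.inv_closed M.l_neg lsmult_closed lsmult_r_distr lsmult_r_null)

lemma lsmult_finsum:
  "\<lbrakk>finite S; a \<in> carrier R; f \<in> S \<rightarrow> carrier M\<rbrakk> \<Longrightarrow>
     a \<odot>\<^bsub>M\<^esub> (\<Oplus>\<^bsub>M\<^esub>i\<in>S. f i) = (\<Oplus>\<^bsub>M\<^esub>i\<in>S. a \<odot>\<^bsub>M\<^esub> f i)"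
proof (induct set: finite)
  case empty then show ?case by simp
next
  case (insert x F) then show ?case by (simp add: Pi_def lsmult_r_distr)
qed

end

subsection \<open>Linear maps\<close>

lemma linear_mapI:
  assumes "\<And>x. x \<in> carrier M \<Longrightarrow> f x \<in> carrier N"
    and "\<And>x y. \<lbrakk>x \<in> carrier M; y \<in> carrier M\<rbrakk> \<Longrightarrow> f (x \<oplus>\<^bsub>M\<^esub> y) = f x \<oplus>\<^bsub>N\<^esub> f y"
    and "\<And>r x. \<lbrakk>r \<in> carrier R; x \<in> carrier M\<rbrakk> \<Longrightarrow> f (r \<odot>\<^bsub>M\<^esub> x) = r \<odot>\<^bsub>N\<^esub> f x"
  shows "linear_map R M N f"
  using assms by (auto simp: linear_map_def)

lemma linear_map_closed: "\<lbrakk>linear_map R M N f; x \<in> carrier M\<rbrakk> \<Longrightarrow> f x \<in> carrier N"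
  and linear_map_add: "\<lbrakk>linear_map R M N f; x \<in> carrier M; y \<in> carrier M\<rbrakk> \<Longrightarrow>
    f (x \<oplus>\<^bsub>M\<^esub> y) = f x \<oplus>\<^bsub>N\<^esub> f y"
  and linear_map_smult: "\<lbrakk>linear_map R M N f; r \<in> carrier R; x \<in> carrier M\<rbrakk> \<Longrightarrow>
    f (r \<odot>\<^bsub>M\<^esub> x) = r \<odot>\<^bsub>N\<^esub> f x"
  by (auto simp: linear_map_def)

text \<open>Agreement on the carrier transfers to the linearity laws because sums and multiples stay
  inside; this is where \<open>M\<close> has to be a module.\<close>

lemma linear_map_cong:
  "(\<And>x. x \<in> carrier M \<Longrightarrow> f x = g x) \<Longrightarrow> left_module R M \<Longrightarrow> linear_map R M N f \<longleftrightarrow> linear_map R M N g"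
proof -
  assume fg: "\<And>x. x \<in> carrier M \<Longrightarrow> f x = g x" and M: "left_module R M"
  interpret left_module R M by fact
  show ?thesis by (auto simp: linear_map_def fg Pi_def)
qed

lemma linear_map_id: "linear_map R M M (\<lambda>x. x)"
  by (rule linear_mapI) simp_all

lemma linear_map_zero_map: "left_module R N \<Longrightarrow> linear_map R M N (\<lambda>x. \<zero>\<^bsub>N\<^esub>)"
proof -
  assume "left_module R N"
  interpret left_module R N by fact
  show ?thesis by (rule linear_mapI) simp_all
qed

lemma linear_map_comp:
  assumes "linear_map R M N f" "linear_map R N K g"
  shows "linear_map R M K (\<lambda>x. g (f x))"
  using assms by (auto simp: linear_map_def Pi_def)

locale linear_hom = M: left_module R M + N: left_module R N
  for R and M and N +
  fixes f
  assumes lin: "linear_map R M N f"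
begin

lemma f_closed [simp, intro]: "x \<in> carrier M \<Longrightarrow> f x \<in> carrier N"
  and f_add [simp]: "\<lbrakk>x \<in> carrier M; y \<in> carrier M\<rbrakk> \<Longrightarrow> f (x \<oplus>\<^bsub>M\<^esub> y) = f x \<oplus>\<^bsub>N\<^esub> f y"
  and f_smult [simp]: "\<lbrakk>r \<in> carrier R; x \<in> carrier M\<rbrakk> \<Longrightarrow> f (r \<odot>\<^bsub>M\<^esub> x) = r \<odot>\<^bsub>N\<^esub> f x"
  using lin by (auto simp: linear_map_def)

lemma f_zero [simp]: "f \<zero>\<^bsub>M\<^esub> = \<zero>\<^bsub>N\<^esub>"
  using f_add [of "\<zero>\<^bsub>M\<^esub>" "\<zero>\<^bsub>M\<^esub>"] by (metis N.M.add.r_cancel_one' M.M.zero_closed M.M.l_zero f_closed)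

lemma f_neg [simp]: "x \<in> carrier M \<Longrightarrow> f (\<ominus>\<^bsub>M\<^esub> x) = \<ominus>\<^bsub>N\<^esub> f x"
  by (metis M.M.add.inv_closed M.M.l_neg N.M.add.inv_equality f_add f_closed f_zero)

lemma f_minus [simp]: "\<lbrakk>x \<in> carrier M; y \<in> carrier M\<rbrakk> \<Longrightarrow> f (x \<ominus>\<^bsub>M\<^esub> y) = f x \<ominus>\<^bsub>N\<^esub> f y"
  by (simp add: M.M.minus_eq N.M.minus_eq)

lemma f_finsum:
  "\<lbrakk>finite S; g \<in> S \<rightarrow> carrier M\<rbrakk> \<Longrightarrow> f (\<Oplus>\<^bsub>M\<^esub>i\<in>S. g i) = (\<Oplus>\<^bsub>N\<^esub>i\<in>S. f (g i))"
proof (induct set: finite)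
  case empty then show ?case by simp
next
  case (insert x F) 
  then have "(\<lambda>i. f (g i)) \<in> F \<rightarrow> carrier N" by auto
  with insert show ?case by (simp add: Pi_def)
qed

lemma f_signed: "x \<in> carrier M \<Longrightarrow> f (signed M i x) = signed N i (f x)"
  by (simp add: signed_def)

end

lemma linear_homI: "\<lbrakk>left_module R M; left_module R N; linear_map R M N f\<rbrakk> \<Longrightarrow> linear_hom R M N f"
  by (simp add: linear_hom_def linear_hom_axioms_def)

lemma linear_map_0:
  "\<lbrakk>left_module R M; left_module R N; linear_map R M N f\<rbrakk> \<Longrightarrow> f \<zero>\<^bsub>M\<^esub> = \<zero>\<^bsub>N\<^esub>"
  using linear_hom.f_zero [OF linear_homI] .

lemma linear_map_minus:
  "\<lbrakk>left_module R M; left_module R N; linear_map R M N f; x \<in> carrier M; y \<in> carrier M\<rbrakk> \<Longrightarrow>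
    f (x \<ominus>\<^bsub>M\<^esub> y) = f x \<ominus>\<^bsub>N\<^esub> f y"
  using linear_hom.f_minus [OF linear_homI] .

lemma linear_map_plus_map:
  assumes "left_module R N" "linear_map R M N f" "linear_map R M N g"
  shows "linear_map R M N (\<lambda>x. f x \<oplus>\<^bsub>N\<^esub> g x)"
proof -
  interpret left_module R N by fact
  show ?thesis using assms(2,3)
    by (intro linear_mapI) (auto simp: linear_map_closed linear_map_add linear_map_smult
        lsmult_r_distr M.a_ac)
qed

lemma linear_map_minus_map:
  assumes "left_module R N" "linear_map R M N f" "linear_map R M N g"
  shows "linear_map R M N (\<lambda>x. f x \<ominus>\<^bsub>N\<^esub> g x)"
proof -
  interpret left_module R N by fact
  show ?thesis using assms(2,3)
    by (intro linear_mapI) (auto simp: linear_map_closed linear_map_add linear_map_smult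
        lsmult_r_distr M.a_ac M.minus_eq M.minus_add lsmult_r_minus)
qed

subsection \<open>Free modules\<close>

lemma free_module_simps [simp]:
  "\<zero>\<^bsub>free_module R I\<^esub> = (\<lambda>i. \<zero>\<^bsub>R\<^esub>)"
  "x \<oplus>\<^bsub>free_module R I\<^esub> y = (\<lambda>i. x i \<oplus>\<^bsub>R\<^esub> y i)"
  "r \<odot>\<^bsub>free_module R I\<^esub> x = (\<lambda>i. r \<otimes>\<^bsub>R\<^esub> x i)"
  by (simp_all add: free_module_def)

lemma free_module_carrier: "x \<in> carrier (free_module R I) \<longleftrightarrow>
   (\<forall>i. x i \<in> carrier R) \<and> (\<forall>i. i \<notin> I \<longrightarrow> x i = \<zero>\<^bsub>R\<^esub>) \<and> finite {i. x i \<noteq> \<zero>\<^bsub>R\<^esub>}"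
  by (simp add: free_module_def)

context ring
begin

lemma free_left_module: "left_module R (free_module R I)"
proof (rule left_moduleI)
  show "ring R" by (rule ring_axioms)
  show "abelian_group (free_module R I)"
  proof (rule abelian_groupI)
    fix x y assume "x \<in> carrier (free_module R I)" "y \<in> carrier (free_module R I)"
    moreover have "{i. x i \<oplus> y i \<noteq> \<zero>} \<subseteq> {i. x i \<noteq> \<zero>} \<union> {i. y i \<noteq> \<zero>}"
      using \<open>x \<in> carrier _\<close> by (auto simp: free_module_carrier)
    ultimately show "x \<oplus>\<^bsub>free_module R I\<^esub> y \<in> carrier (free_module R I)"
      by (auto simp: free_module_carrier intro: finite_subset [OF _ finite_UnI])
  next
    fix x assume x: "x \<in> carrier (free_module R I)"
    then have "(\<lambda>i. \<ominus> x i) \<in> carrier (free_module R I)"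
      by (auto simp: free_module_carrier elim!: finite_subset [rotated])
    with x show "\<exists>y\<in>carrier (free_module R I). y \<oplus>\<^bsub>free_module R I\<^esub> x = \<zero>\<^bsub>free_module R I\<^esub>"
      by (intro bexI [where x = "\<lambda>i. \<ominus> x i"]) (auto simp: free_module_carrier l_neg)
  qed (auto simp: free_module_carrier a_ac)
next
  fix a x assume "a \<in> carrier R" "x \<in> carrier (free_module R I)"
  then show "a \<odot>\<^bsub>free_module R I\<^esub> x \<in> carrier (free_module R I)"
    by (auto simp: free_module_carrier elim!: finite_subset [rotated])
qed (auto simp: free_module_carrier l_distr r_distr m_assoc)

lemma basis_elem_closed: "i \<in> I \<Longrightarrow> basis_elem R i \<in> carrier (free_module R I)"
  by (auto simp: basis_elem_def free_module_carrier intro: finite_subset [of _ "{i}"])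

text \<open>Induction on a finite set containing the support, starting from the zero
  function.\<close>

lemma free_module_induct [consumes 1, case_names zero basis add smult]:
  assumes x: "x \<in> carrier (free_module R I)"
    and z: "Q (\<lambda>i. \<zero>)"
    and b: "\<And>i. i \<in> I \<Longrightarrow> Q (basis_elem R i)"
    and a: "\<And>x y. \<lbrakk>x \<in> carrier (free_module R I); y \<in> carrier (free_module R I); Q x; Q y\<rbrakk> \<Longrightarrow>
       Q (x \<oplus>\<^bsub>free_module R I\<^esub> y)"
    and s: "\<And>r x. \<lbrakk>r \<in> carrier R; x \<in> carrier (free_module R I); Q x\<rbrakk> \<Longrightarrow>
       Q (r \<odot>\<^bsub>free_module R I\<^esub> x)"
  shows "Q x"
proof -
  interpret F: left_module R "free_module R I" by (rule free_left_module)
  have "finite S \<Longrightarrow> x \<in> carrier (free_module R I) \<Longrightarrow> {i. x i \<noteq> \<zero>} \<subseteq> S \<Longrightarrow> Q x" for S x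
  proof (induct S arbitrary: x rule: finite_induct)
    case empty
    then have "x = (\<lambda>i. \<zero>)" by auto
    then show ?case using z by simp
  next
    case (insert j S)
    \<comment> \<open>Deleting coordinate \<open>j\<close> puts the support inside \<open>S\<close>;
      the deleted part is a multiple of one basis element.\<close>
    define y where "y = x(j := \<zero>)"
    have y: "y \<in> carrier (free_module R I)"
      using insert(4) by (auto simp: y_def free_module_carrier elim!: finite_subset [rotated])
    have "{i. y i \<noteq> \<zero>} \<subseteq> S" using insert(5) by (auto simp: y_def)
    then have Qy: "Q y" by (rule insert(3) [OF y])
    show ?case
    proof (cases "j \<in> I")
      case True
      have xj: "x j \<in> carrier R" using insert(4) by (simp add: free_module_carrier)
      have "x = y \<oplus>\<^bsub>free_module R I\<^esub> (x j \<odot>\<^bsub>free_module R I\<^esub> basis_elem R j)"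
        using insert(4) by (auto simp: y_def basis_elem_def free_module_carrier fun_eq_iff)
      moreover have "Q \<dots>"
        by (intro a s b y Qy F.lsmult_closed basis_elem_closed True xj)
      ultimately show ?thesis by simp
    next
      \<comment> \<open>Outside \<open>I\<close> the coordinate is zero already.\<close>
      case False
      then have "x = y" using insert(4) by (auto simp: y_def free_module_carrier)
      then show ?thesis using Qy by simp
    qed
  qed
  then show ?thesis using x by (auto simp: free_module_carrier)
qed

end

lemma linear_maps_eq_free:
  assumes N: "left_module R N" and f: "linear_map R (free_module R I) N f"
    and g: "linear_map R (free_module R I) N g"
    and eq: "\<And>i. i \<in> I \<Longrightarrow> f (basis_elem R i) = g (basis_elem R i)"
    and x: "x \<in> carrier (free_module R I)"
  shows "f x = g x"
proof -
  interpret N: left_module R N by fact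
  note F = N.R.free_left_module
  from x show ?thesis
  proof (induct rule: N.R.free_module_induct)
    case zero
    show ?case using linear_map_0 [OF F N f] linear_map_0 [OF F N g] by simp
  qed (simp_all only: eq linear_map_add [OF f] linear_map_add [OF g] linear_map_smult [OF f]
      linear_map_smult [OF g])
qed

text \<open>Summing over the support keeps the sum finite for infinite index sets and makes the term
  the one that occurs inside \<open>tensor_lift\<close>.\<close>

definition lincomb ::
  "('r, 'x) ring_scheme \<Rightarrow> ('r, 'n, 'y) module_scheme \<Rightarrow> ('i \<Rightarrow> 'n) \<Rightarrow> ('i \<Rightarrow> 'r) \<Rightarrow> 'n" where
  "lincomb R N g x = (\<Oplus>\<^bsub>N\<^esub>i\<in>{i. x i \<noteq> \<zero>\<^bsub>R\<^esub>}. x i \<odot>\<^bsub>N\<^esub> g i)"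

context left_module
begin

text \<open>Indices outside the support contribute zero, so several combinations can be summed over
  one common finite set; additivity rests on this.\<close>

lemma lincomb_superset:
  assumes x: "x \<in> carrier (free_module R I)" and g: "g \<in> I \<rightarrow> carrier M"
    and S: "finite S" "{i. x i \<noteq> \<zero>} \<subseteq> S" "S \<subseteq> I"
  shows "lincomb R M g x = (\<Oplus>\<^bsub>M\<^esub>i\<in>S. x i \<odot>\<^bsub>M\<^esub> g i)"
  unfolding lincomb_def
  by (rule M.add.finprod_mono_neutral_cong_left)
    (use assms in \<open>auto simp: free_module_carrier Pi_def subset_iff\<close>)

end

context
  fixes R :: "('r, 'x) ring_scheme" (structure) and M :: "('r, 'm) module" (structure)
  assumes lm: "left_module R M"
begin

interpretation left_module R M by (fact lm)

lemma lincomb_linear: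
  assumes g: "g \<in> I \<rightarrow> carrier M"
  shows "linear_map R (free_module R I) M (lincomb R M g)"
proof (rule linear_mapI)
  interpret F: left_module R "free_module R I" by (rule R.free_left_module)
  have supp: "{i. x i \<noteq> \<zero>} \<subseteq> I" "finite {i. x i \<noteq> \<zero>}" "x i \<in> carrier R"
    if "x \<in> carrier (free_module R I)" for x i
    using that by (auto simp: free_module_carrier)
  have gc: "i \<in> I \<Longrightarrow> g i \<in> carrier M" for i using g by auto
  fix x assume x: "x \<in> carrier (free_module R I)"
  show "lincomb R M g x \<in> carrier M"
    unfolding lincomb_def using supp [OF x] gc by (intro M.finsum_closed) auto
  { fix y assume y: "y \<in> carrier (free_module R I)"
    define S where "S = {i. x i \<noteq> \<zero>} \<union> {i. y i \<noteq> \<zero>}"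
    have S: "finite S" "S \<subseteq> I" using supp x y by (auto simp: S_def)
    have "lincomb R M g (x \<oplus>\<^bsub>free_module R I\<^esub> y) = (\<Oplus>\<^bsub>M\<^esub>i\<in>S. (x i \<oplus> y i) \<odot>\<^bsub>M\<^esub> g i)"
      using S by (subst lincomb_superset [OF F.M.a_closed [OF x y] g, of S]) (auto simp: S_def)
    also have "\<dots> = (\<Oplus>\<^bsub>M\<^esub>i\<in>S. x i \<odot>\<^bsub>M\<^esub> g i \<oplus>\<^bsub>M\<^esub> y i \<odot>\<^bsub>M\<^esub> g i)"
      using S supp x y gc
      by (intro M.finsum_cong') (auto intro!: lsmult_l_distr simp: subset_iff)
    also have "\<dots> = (\<Oplus>\<^bsub>M\<^esub>i\<in>S. x i \<odot>\<^bsub>M\<^esub> g i) \<oplus>\<^bsub>M\<^esub> (\<Oplus>\<^bsub>M\<^esub>i\<in>S. y i \<odot>\<^bsub>M\<^esub> g i)"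
      using S supp x y gc by (intro M.finsum_addf) (auto simp: subset_iff)
    also have "\<dots> = lincomb R M g x \<oplus>\<^bsub>M\<^esub> lincomb R M g y"
      using S by (subst (1 2) lincomb_superset [of _ I _ S]) (auto simp: S_def g x y)
    finally show "lincomb R M g (x \<oplus>\<^bsub>free_module R I\<^esub> y) = lincomb R M g x \<oplus>\<^bsub>M\<^esub> lincomb R M g y" . }
  { fix r assume r: "r \<in> carrier R"
    define S where "S = {i. x i \<noteq> \<zero>}"
    have S: "finite S" "S \<subseteq> I" using supp x by (auto simp: S_def)
    have "lincomb R M g (r \<odot>\<^bsub>free_module R I\<^esub> x) = (\<Oplus>\<^bsub>M\<^esub>i\<in>S. (r \<otimes> x i) \<odot>\<^bsub>M\<^esub> g i)"
      using S r by (subst lincomb_superset [OF F.lsmult_closed [OF r x] g, of S]) (auto simp: S_def)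
    also have "\<dots> = (\<Oplus>\<^bsub>M\<^esub>i\<in>S. r \<odot>\<^bsub>M\<^esub> (x i \<odot>\<^bsub>M\<^esub> g i))"
      using S supp x r gc
      by (intro M.finsum_cong') (auto intro!: lsmult_assoc simp: subset_iff)
    also have "\<dots> = r \<odot>\<^bsub>M\<^esub> (\<Oplus>\<^bsub>M\<^esub>i\<in>S. x i \<odot>\<^bsub>M\<^esub> g i)"
      using S supp x gc r by (intro lsmult_finsum [symmetric]) (auto simp: subset_iff)
    also have "\<dots> = r \<odot>\<^bsub>M\<^esub> lincomb R M g x"
      using S by (subst lincomb_superset [of _ I _ S]) (auto simp: S_def g x)
    finally show "lincomb R M g (r \<odot>\<^bsub>free_module R I\<^esub> x) = r \<odot>\<^bsub>M\<^esub> lincomb R M g x" . }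
qed

lemma lincomb_basis:
  assumes i: "i \<in> I" and g: "g \<in> I \<rightarrow> carrier M"
  shows "lincomb R M g (basis_elem R i) = g i"
proof -
  have "lincomb R M g (basis_elem R i) = (\<Oplus>\<^bsub>M\<^esub>j\<in>{i}. basis_elem R i j \<odot>\<^bsub>M\<^esub> g j)"
    by (rule lincomb_superset [OF R.basis_elem_closed [OF i] g]) (auto simp: basis_elem_def i)
  also have "\<dots> = g i" using i g by (auto simp: basis_elem_def Pi_def)
  finally show ?thesis .
qed

end

subsection \<open>Projective modules\<close>

text \<open>Preimages under \<sigma> are chosen for the images of the basis elements, extended by
  \<open>lincomb\<close> and composed with the section \<iota>. The condition \<open>range\<close>
  is stated for the image of \<open>g\<close> only; when \<sigma> is a differential, it is exactness
  that provides it.\<close>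

lemma projective_module_lift:
  fixes Q :: "('r, 'q) module"
  assumes Q: "projective_module R Q" and N: "left_module R N" and N': "left_module R N'"
    and \<sigma>: "linear_map R N N' \<sigma>" and g: "linear_map R Q N' g"
    and range: "\<And>q. q \<in> carrier Q \<Longrightarrow> g q \<in> \<sigma> ` carrier N"
  obtains h where "linear_map R Q N h" "\<And>q. q \<in> carrier Q \<Longrightarrow> \<sigma> (h q) = g q"
proof -
  from Q obtain I :: "'q set" and \<iota> \<pi> where Qm: "left_module R Q"
    and \<iota>: "linear_map R Q (free_module R I) \<iota>" and \<pi>: "linear_map R (free_module R I) Q \<pi>"
    and \<pi>\<iota>: "\<And>x. x \<in> carrier Q \<Longrightarrow> \<pi> (\<iota> x) = x"
    unfolding projective_module_def by blast
  interpret N: left_module R N by fact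
  have "\<exists>n\<in>carrier N. \<sigma> n = g (\<pi> (basis_elem R i))" if "i \<in> I" for i
    using range [OF linear_map_closed [OF \<pi> N.R.basis_elem_closed [OF that]]] by (metis imageE)
  then obtain y where y: "\<And>i. i \<in> I \<Longrightarrow> y i \<in> carrier N \<and> \<sigma> (y i) = g (\<pi> (basis_elem R i))"
    by metis
  have yI: "y \<in> I \<rightarrow> carrier N" using y by auto
  note L = lincomb_linear [OF N yI]
  show thesis
  proof (rule that [of "\<lambda>q. lincomb R N y (\<iota> q)"])
    show "linear_map R Q N (\<lambda>q. lincomb R N y (\<iota> q))" by (rule linear_map_comp [OF \<iota> L])
    fix q assume q: "q \<in> carrier Q"
    have "\<sigma> (lincomb R N y x) = g (\<pi> x)" if "x \<in> carrier (free_module R I)" for x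
      by (rule linear_maps_eq_free [OF N' linear_map_comp [OF L \<sigma>] linear_map_comp [OF \<pi> g] _ that])
        (simp add: lincomb_basis [OF N] yI y)
    from this [OF linear_map_closed [OF \<iota> q]] show "\<sigma> (lincomb R N y (\<iota> q)) = g q"
      by (simp add: \<pi>\<iota> q)
  qed
qed

text \<open>A section of the canonical cover by the free module on the underlying set exhibits
  \<open>Q\<close> as a direct summand.\<close>

lemma projective_moduleI:
  assumes Q: "left_module R Q"
    and s: "linear_map R Q (free_module R (carrier Q)) s"
    and eq: "\<And>x. x \<in> carrier Q \<Longrightarrow> lincomb R Q (\<lambda>q. q) (s x) = x"
  shows "projective_module R Q"
  unfolding projective_module_def
  using assms lincomb_linear [OF Q, of "\<lambda>q. q" "carrier Q"] by blast

subsection \<open>Quotient modules\<close>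

context
  fixes R :: "('r, 'x) ring_scheme" (structure) and M :: "('r, 'm) module" (structure)
  assumes lm: "left_module R M"
begin

interpretation left_module R M by (fact lm)

lemma submodule_abelian_subgroup: "submodule N R M \<Longrightarrow> abelian_subgroup N M"
  by (intro abelian_subgroupI3 additive_subgroupI)
    (auto simp: submodule_def M.abelian_group_axioms)

lemma left_submoduleI:
  assumes "N \<subseteq> carrier M" "\<zero>\<^bsub>M\<^esub> \<in> N" "\<And>x y. \<lbrakk>x \<in> N; y \<in> N\<rbrakk> \<Longrightarrow> x \<oplus>\<^bsub>M\<^esub> y \<in> N"
    "\<And>r x. \<lbrakk>r \<in> carrier R; x \<in> N\<rbrakk> \<Longrightarrow> r \<odot>\<^bsub>M\<^esub> x \<in> N"
  shows "submodule N R M"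
proof -
  \<comment> \<open>Negatives arise by scaling with minus one.\<close>
  have "\<ominus>\<^bsub>M\<^esub> x \<in> N" if "x \<in> N" for x
    using assms(4) [of "\<ominus> \<one>" x] that assms(1) lsmult_l_minus [of \<one> x] by auto
  then show ?thesis
    using assms by (intro submodule.intro subgroup.intro submodule_axioms.intro) (auto simp: a_inv_def [symmetric])
qed

lemma submodule_coset_eq_iff:
  assumes N: "submodule N R M" and "x \<in> carrier M" "y \<in> carrier M"
  shows "N +>\<^bsub>M\<^esub> x = N +>\<^bsub>M\<^esub> y \<longleftrightarrow> x \<ominus>\<^bsub>M\<^esub> y \<in> N"
proof -
  interpret N: abelian_subgroup N M by (rule submodule_abelian_subgroup [OF N])
  show ?thesis
    using assms N.a_rcos_module [of y x] N.a_rcos_self N.a_repr_independence' [of x y]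
    by (auto simp: M.minus_eq)
qed

lemma submodule_coset_mem:
  assumes N: "submodule N R M" and "x \<in> carrier M" "z \<in> N +>\<^bsub>M\<^esub> x"
  obtains n where "n \<in> N" "n \<in> carrier M" "z = n \<oplus>\<^bsub>M\<^esub> x" "z \<in> carrier M"
proof -
  interpret N: abelian_subgroup N M by (rule submodule_abelian_subgroup [OF N])
  from assms obtain n where "n \<in> N" "z = n \<oplus>\<^bsub>M\<^esub> x" by (auto simp: a_r_coset_def')
  then show thesis using that [of n] assms by auto
qed

lemma quotient_carrier: "carrier (quotient_module M N) = (\<lambda>x. N +>\<^bsub>M\<^esub> x) ` carrier M"
  by (auto simp: quotient_module_def A_RCOSETS_def')

lemma quotient_add:
  assumes "submodule N R M" "x \<in> carrier M" "y \<in> carrier M"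
  shows "(N +>\<^bsub>M\<^esub> x) \<oplus>\<^bsub>quotient_module M N\<^esub> (N +>\<^bsub>M\<^esub> y) = N +>\<^bsub>M\<^esub> (x \<oplus>\<^bsub>M\<^esub> y)"
  using abelian_subgroup.a_rcos_sum [OF submodule_abelian_subgroup [OF assms(1)]] assms
  by (simp add: quotient_module_def)

text \<open>The scalar action is a union of cosets over all representatives. It collapses to one
  coset because representatives differ by elements of \<open>N\<close>, which is stable under
  scalars.\<close>

lemma quotient_smult:
  assumes N: "submodule N R M" and r: "r \<in> carrier R" and x: "x \<in> carrier M"
  shows "r \<odot>\<^bsub>quotient_module M N\<^esub> (N +>\<^bsub>M\<^esub> x) = N +>\<^bsub>M\<^esub> (r \<odot>\<^bsub>M\<^esub> x)"
proof -
  interpret N: abelian_subgroup N M by (rule submodule_abelian_subgroup [OF N])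
  have eq: "N +>\<^bsub>M\<^esub> (r \<odot>\<^bsub>M\<^esub> z) = N +>\<^bsub>M\<^esub> (r \<odot>\<^bsub>M\<^esub> x)" if z: "z \<in> N +>\<^bsub>M\<^esub> x" for z
  proof -
    obtain n where n: "n \<in> N" "n \<in> carrier M" "z = n \<oplus>\<^bsub>M\<^esub> x" "z \<in> carrier M"
      using submodule_coset_mem [OF N x z] .
    have "r \<odot>\<^bsub>M\<^esub> z \<ominus>\<^bsub>M\<^esub> r \<odot>\<^bsub>M\<^esub> x = r \<odot>\<^bsub>M\<^esub> n"
      using n r x by (simp add: lsmult_r_distr M.minus_eq M.a_assoc M.r_neg)
    also have "\<dots> \<in> N" using submodule.smult_closed [OF N r n(1)] .
    finally show ?thesis using submodule_coset_eq_iff [OF N] n r x by auto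
  qed
  have "N +>\<^bsub>M\<^esub> x \<noteq> {}" using N.a_rcos_self x by blast
  then have "(\<Union>z\<in>N +>\<^bsub>M\<^esub> x. N +>\<^bsub>M\<^esub> (r \<odot>\<^bsub>M\<^esub> z)) = N +>\<^bsub>M\<^esub> (r \<odot>\<^bsub>M\<^esub> x)"
    by (rule SUP_eq_const) (rule eq)
  then show ?thesis by (simp add: quotient_module_def)
qed

lemma quotient_zero: "submodule N R M \<Longrightarrow> \<zero>\<^bsub>quotient_module M N\<^esub> = N +>\<^bsub>M\<^esub> \<zero>\<^bsub>M\<^esub>"
  using abelian_subgroup.a_rcos_const [OF submodule_abelian_subgroup]
    additive_subgroup.zero_closed [OF abelian_subgroup.axioms(1) [OF submodule_abelian_subgroup]]
  by (simp add: quotient_module_def)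

lemma quotient_left_module:
  assumes N: "submodule N R M"
  shows "left_module R (quotient_module M N)"
proof (rule left_moduleI)
  note S = quotient_carrier quotient_add [OF N] quotient_smult [OF N] quotient_zero [OF N]
  show "ring R" by (rule R.ring_axioms)
  show "abelian_group (quotient_module M N)"
  proof (rule abelian_groupI)
    fix x assume "x \<in> carrier (quotient_module M N)"
    then obtain y where y: "y \<in> carrier M" "x = N +>\<^bsub>M\<^esub> y" by (auto simp: S)
    then show "\<exists>y\<in>carrier (quotient_module M N). y \<oplus>\<^bsub>quotient_module M N\<^esub> x = \<zero>\<^bsub>quotient_module M N\<^esub>"
      by (intro bexI [where x = "N +>\<^bsub>M\<^esub> (\<ominus>\<^bsub>M\<^esub> y)"]) (auto simp: S M.l_neg)
  next
    fix x y z assume "x \<in> carrier (quotient_module M N)" "y \<in> carrier (quotient_module M N)"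
      "z \<in> carrier (quotient_module M N)"
    then obtain x' y' z' where "x' \<in> carrier M" "x = N +>\<^bsub>M\<^esub> x'" "y' \<in> carrier M" "y = N +>\<^bsub>M\<^esub> y'"
      "z' \<in> carrier M" "z = N +>\<^bsub>M\<^esub> z'"
      by (auto simp: quotient_carrier)
    then show "x \<oplus>\<^bsub>quotient_module M N\<^esub> y \<oplus>\<^bsub>quotient_module M N\<^esub> z =
        x \<oplus>\<^bsub>quotient_module M N\<^esub> (y \<oplus>\<^bsub>quotient_module M N\<^esub> z)"
      by (simp add: S M.a_assoc)
  qed (auto simp: S M.a_comm)
  note S = quotient_carrier quotient_add [OF N] quotient_smult [OF N]
  fix a x assume a: "a \<in> carrier R" and x: "x \<in> carrier (quotient_module M N)"
  from x obtain x' where x': "x' \<in> carrier M" "x = N +>\<^bsub>M\<^esub> x'"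
    by (auto simp: quotient_carrier)
  show "a \<odot>\<^bsub>quotient_module M N\<^esub> x \<in> carrier (quotient_module M N)"
    using a x' by (simp add: S)
  { fix b assume b: "b \<in> carrier R"
    show "(a \<oplus> b) \<odot>\<^bsub>quotient_module M N\<^esub> x =
      a \<odot>\<^bsub>quotient_module M N\<^esub> x \<oplus>\<^bsub>quotient_module M N\<^esub> b \<odot>\<^bsub>quotient_module M N\<^esub> x"
      using a b x' by (simp add: S lsmult_l_distr)
    show "(a \<otimes> b) \<odot>\<^bsub>quotient_module M N\<^esub> x =
      a \<odot>\<^bsub>quotient_module M N\<^esub> (b \<odot>\<^bsub>quotient_module M N\<^esub> x)"
      using a b x' by (simp add: S lsmult_assoc) }
  { fix y assume "y \<in> carrier (quotient_module M N)"
    then obtain y' where "y' \<in> carrier M" "y = N +>\<^bsub>M\<^esub> y'" by (auto simp: quotient_carrier)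
    then show "a \<odot>\<^bsub>quotient_module M N\<^esub> (x \<oplus>\<^bsub>quotient_module M N\<^esub> y) =
      a \<odot>\<^bsub>quotient_module M N\<^esub> x \<oplus>\<^bsub>quotient_module M N\<^esub> a \<odot>\<^bsub>quotient_module M N\<^esub> y"
      using a x' by (simp add: S lsmult_r_distr) }
next
  fix x assume "x \<in> carrier (quotient_module M N)"
  then obtain x' where "x' \<in> carrier M" "x = N +>\<^bsub>M\<^esub> x'" by (auto simp: quotient_carrier)
  then show "\<one> \<odot>\<^bsub>quotient_module M N\<^esub> x = x" by (simp add: quotient_smult [OF N])
qed

lemma quotient_proj_linear:
  "submodule N R M \<Longrightarrow> linear_map R M (quotient_module M N) (\<lambda>x. N +>\<^bsub>M\<^esub> x)"
  by (rule linear_mapI) (auto simp: quotient_carrier quotient_add quotient_smult)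

end

lemma submoduleD:
  assumes "submodule N R M"
  shows "N \<subseteq> carrier M" "\<zero>\<^bsub>M\<^esub> \<in> N"
    and "\<lbrakk>x \<in> N; y \<in> N\<rbrakk> \<Longrightarrow> x \<oplus>\<^bsub>M\<^esub> y \<in> N"
    and "\<lbrakk>r \<in> carrier R; x \<in> N\<rbrakk> \<Longrightarrow> r \<odot>\<^bsub>M\<^esub> x \<in> N"
proof -
  interpret submodule N R M by fact
  show "N \<subseteq> carrier M" "\<zero>\<^bsub>M\<^esub> \<in> N"
    and "\<lbrakk>x \<in> N; y \<in> N\<rbrakk> \<Longrightarrow> x \<oplus>\<^bsub>M\<^esub> y \<in> N"
    and "\<lbrakk>r \<in> carrier R; x \<in> N\<rbrakk> \<Longrightarrow> r \<odot>\<^bsub>M\<^esub> x \<in> N"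
    using subset one_closed m_closed smult_closed by simp_all
qed

text \<open>From here on free modules are handled through the module laws, without unfolding their
  elements to functions.\<close>

declare free_module_simps [simp del]

section \<open>Tensor products\<close>

lemma tuples_iff:
  "l \<in> tuples Ms \<longleftrightarrow> length l = length Ms \<and> (\<forall>i<length Ms. l ! i \<in> carrier (Ms ! i))"
proof (induct Ms arbitrary: l)
  case Nil then show ?case by (simp add: tuples_def)
next
  case (Cons M Ms)
  show ?case
    by (cases l) (use Cons in \<open>auto simp: tuples_def set_Cons_def nth_Cons' less_Suc_eq_0_disj\<close>)
qed

lemma tuples_Cons [simp]: "x # l \<in> tuples (M # Ms) \<longleftrightarrow> x \<in> carrier M \<and> l \<in> tuples Ms"
  by (auto simp: tuples_def set_Cons_def)

lemma tuples_Nil [simp]: "tuples [] = {[]}"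
  by (simp add: tuples_def)

lemma tuples_snoc [simp]: "l @ [x] \<in> tuples (Ms @ [M]) \<longleftrightarrow> x \<in> carrier M \<and> l \<in> tuples Ms"
  by (auto simp: tuples_iff nth_append less_Suc_eq)

lemma tuples_update:
  "\<lbrakk>l \<in> tuples Ms; i < length Ms \<Longrightarrow> x \<in> carrier (Ms ! i)\<rbrakk> \<Longrightarrow> l[i := x] \<in> tuples Ms"
  by (cases "i < length Ms") (auto simp: tuples_iff nth_list_update)

lemma tuples_replicate: "l \<in> tuples (replicate n A) \<longleftrightarrow> length l = n \<and> set l \<subseteq> carrier A"
  by (auto simp: tuples_iff set_conv_nth subset_iff)

section \<open>Multilinear maps on tuples\<close>

definition multilinear ::
  "('k, 'x) ring_scheme \<Rightarrow> ('k, 'a) module list \<Rightarrow> ('k, 'n) module \<Rightarrow> ('a list \<Rightarrow> 'n) \<Rightarrow> bool" where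
  "multilinear k Ms N g \<longleftrightarrow> g \<in> tuples Ms \<rightarrow> carrier N \<and>
     (\<forall>l\<in>tuples Ms. \<forall>i<length Ms. linear_map k (Ms ! i) N (\<lambda>x. g (l[i := x])))"

lemma multilinearI:
  assumes "\<And>l. l \<in> tuples Ms \<Longrightarrow> g l \<in> carrier N"
    and "\<And>l i. \<lbrakk>l \<in> tuples Ms; i < length Ms\<rbrakk> \<Longrightarrow> linear_map k (Ms ! i) N (\<lambda>x. g (l[i := x]))"
  shows "multilinear k Ms N g"
  using assms by (auto simp: multilinear_def)

lemma multilinear_closed: "\<lbrakk>multilinear k Ms N g; l \<in> tuples Ms\<rbrakk> \<Longrightarrow> g l \<in> carrier N"
  and multilinear_linear: "\<lbrakk>multilinear k Ms N g; l \<in> tuples Ms; i < length Ms\<rbrakk> \<Longrightarrow>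
    linear_map k (Ms ! i) N (\<lambda>x. g (l[i := x]))"
  by (auto simp: multilinear_def)

lemma multilinear_comp:
  assumes "multilinear k Ms N g" "linear_map k N N' f"
  shows "multilinear k Ms N' (\<lambda>l. f (g l))"
  by (rule multilinearI)
    (auto intro: multilinear_closed [OF assms(1)] linear_map_closed [OF assms(2)]
      linear_map_comp [OF multilinear_linear [OF assms(1)] assms(2)])

text \<open>The condition \<open>slot\<close> says that changing entry \<open>j\<close> of
  \<open>l\<close> changes a single entry of \<open>T l\<close>, and does so linearly. Merging
  neighbours, inserting units and applying \<delta> to one entry are all of this kind.\<close>

lemma multilinear_pullback:
  assumes g: "multilinear k Ns N g"
    and T: "\<And>l. l \<in> tuples Ms \<Longrightarrow> T l \<in> tuples Ns"
    and slot: "\<And>l j. \<lbrakk>l \<in> tuples Ms; j < length Ms\<rbrakk> \<Longrightarrow>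
       \<exists>i<length Ns. \<exists>f. linear_map k (Ms ! j) (Ns ! i) f \<and>
         (\<forall>x\<in>carrier (Ms ! j). T (l[j := x]) = (T l)[i := f x])"
    and Ms: "\<And>M. M \<in> set Ms \<Longrightarrow> left_module k M"
  shows "multilinear k Ms N (\<lambda>l. g (T l))"
proof (rule multilinearI)
  fix l assume l: "l \<in> tuples Ms"
  then show "g (T l) \<in> carrier N" by (intro multilinear_closed [OF g] T)
  fix j assume j: "j < length Ms"
  from slot [OF l j] obtain i f where i: "i < length Ns" and f: "linear_map k (Ms ! j) (Ns ! i) f"
    and eq: "\<And>x. x \<in> carrier (Ms ! j) \<Longrightarrow> T (l[j := x]) = (T l)[i := f x]" by blast
  have "linear_map k (Ms ! j) N (\<lambda>x. g ((T l)[i := f x]))"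
    by (rule linear_map_comp [OF f multilinear_linear [OF g T [OF l] i]])
  then show "linear_map k (Ms ! j) N (\<lambda>x. g (T (l[j := x])))"
    using linear_map_cong [of "Ms ! j" "\<lambda>x. g (T (l[j := x]))" "\<lambda>x. g ((T l)[i := f x])" k N]
      eq Ms [OF nth_mem [OF j]] by simp
qed

lemma multilinear_cong:
  assumes "\<And>l. l \<in> tuples Ms \<Longrightarrow> f l = g l" and "\<And>M. M \<in> set Ms \<Longrightarrow> left_module k M"
    and g: "multilinear k Ms N g"
  shows "multilinear k Ms N f"
proof (rule multilinearI)
  fix l assume l: "l \<in> tuples Ms"
  then show "f l \<in> carrier N" using assms multilinear_closed [OF g] by simp
  fix i assume i: "i < length Ms"
  show "linear_map k (Ms ! i) N (\<lambda>x. f (l[i := x]))"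
    using linear_map_cong [of "Ms ! i" "\<lambda>x. f (l[i := x])" "\<lambda>x. g (l[i := x])" k N]
      assms(1) tuples_update [OF l] multilinear_linear [OF g l i] assms(2) [OF nth_mem [OF i]]
    by auto
qed

lemma multilinear_add:
  assumes N: "left_module k N" and f: "multilinear k Ms N f" and g: "multilinear k Ms N g"
  shows "multilinear k Ms N (\<lambda>l. f l \<oplus>\<^bsub>N\<^esub> g l)"
proof -
  interpret N: left_module k N by fact
  show ?thesis
    by (rule multilinearI)
      (auto intro: multilinear_closed [OF f] multilinear_closed [OF g]
        intro!: linear_map_plus_map [OF N] multilinear_linear [OF f] multilinear_linear [OF g])
qed

lemma multilinear_zero:
  assumes "left_module k N" shows "multilinear k Ms N (\<lambda>l. \<zero>\<^bsub>N\<^esub>)"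
proof -
  interpret N: left_module k N by fact
  show ?thesis by (rule multilinearI) (simp_all add: linear_map_zero_map assms)
qed

lemma multilinear_finsum:
  assumes N: "left_module k N" and S: "finite S" and g: "\<And>i. i \<in> S \<Longrightarrow> multilinear k Ms N (g i)"
    and Ms: "\<And>M. M \<in> set Ms \<Longrightarrow> left_module k M"
  shows "multilinear k Ms N (\<lambda>l. \<Oplus>\<^bsub>N\<^esub>i\<in>S. g i l)"
proof -
  interpret N: left_module k N by fact
  show ?thesis using S g
  proof (induct S rule: finite_induct)
    case empty show ?case using multilinear_zero [OF N] by simp
  next
    case (insert i S)
    show ?case
      by (rule multilinear_cong [OF _ Ms multilinear_add [OF N insert(4) insert(3)]])
        (use insert in \<open>auto intro!: N.M.finsum_insert intro: multilinear_closed [OF insert(4)]\<close>)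
  qed
qed

lemma (in left_module) signed_closed [simp, intro]: "x \<in> carrier M \<Longrightarrow> signed M i x \<in> carrier M"
  by (simp add: signed_def)

lemma linear_map_neg:
  assumes "left_module R M" shows "linear_map R M M (a_inv M)"
proof -
  interpret left_module R M by fact
  show ?thesis by (rule linear_mapI) (simp_all add: M.minus_add lsmult_r_minus)
qed

lemma linear_map_signed:
  assumes "left_module R M" shows "linear_map R M M (signed M i)"
proof -
  have "signed M i = (if even i then (\<lambda>x. x) else a_inv M)" by (auto simp: signed_def)
  then show ?thesis using linear_map_neg [OF assms] linear_map_id [of R M] by simp
qed

text \<open>Currying in the first entry, the form in which multilinear maps are built by induction
  on the number of factors.\<close>

lemma multilinear_Cons_iff:
  assumes M: "left_module k M" and N: "left_module k N" and Ms: "\<And>M. M \<in> set Ms \<Longrightarrow> left_module k M"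
  shows "multilinear k (M # Ms) N g \<longleftrightarrow>
    (\<forall>x\<in>carrier M. multilinear k Ms N (\<lambda>l. g (x # l))) \<and>
    (\<forall>l\<in>tuples Ms. linear_map k M N (\<lambda>x. g (x # l)))" (is "?L \<longleftrightarrow> ?R")
proof
  assume g: ?L
  show ?R
  proof (intro conjI ballI multilinearI)
    fix x l assume x: "x \<in> carrier M" and l: "l \<in> tuples Ms"
    then show "g (x # l) \<in> carrier N" by (intro multilinear_closed [OF g]) simp
    fix i assume "i < length Ms"
    then show "linear_map k (Ms ! i) N (\<lambda>y. g (x # l[i := y]))"
      using multilinear_linear [OF g, of "x # l" "Suc i"] x l by simp
  next
    fix l assume l: "l \<in> tuples Ms"
    interpret left_module k M by fact
    show "linear_map k M N (\<lambda>x. g (x # l))"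
      \<comment> \<open>The entry \<open>\<zero>\<close> is a placeholder that the update
        overwrites.\<close>
      using multilinear_linear [OF g, of "\<zero>\<^bsub>M\<^esub> # l" 0] l by simp
  qed
next
  assume R: ?R
  show ?L
  proof (rule multilinearI)
    fix l assume "l \<in> tuples (M # Ms)"
    then obtain x m where l: "l = x # m" "x \<in> carrier M" "m \<in> tuples Ms"
      by (cases l) (auto simp: tuples_iff [of "[]"])
    show "g l \<in> carrier N" using R l by (auto intro: multilinear_closed)
    fix i assume i: "i < length (M # Ms)"
    then show "linear_map k ((M # Ms) ! i) N (\<lambda>y. g (l[i := y]))"
      using R l multilinear_linear [of k Ms N "\<lambda>m. g (x # m)" m] by (cases i) auto
  qed
qed

lemma multilinear_snoc:
  assumes "\<And>x. x \<in> carrier M \<Longrightarrow> multilinear k Ms N (\<lambda>l. g (l @ [x]))"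
    and "\<And>l. l \<in> tuples Ms \<Longrightarrow> linear_map k M N (\<lambda>x. g (l @ [x]))"
  shows "multilinear k (Ms @ [M]) N g"
proof (rule multilinearI)
  fix l assume "l \<in> tuples (Ms @ [M])"
  moreover from this have "l \<noteq> []" by (auto simp: tuples_iff)
  ultimately obtain x m where l: "l = m @ [x]" "x \<in> carrier M" "m \<in> tuples Ms"
    by (metis append_butlast_last_id tuples_snoc)
  show "g l \<in> carrier N" using multilinear_closed [OF assms(1)] l by simp
  fix i assume i: "i < length (Ms @ [M])"
  have len: "length m = length Ms" using l by (simp add: tuples_iff)
  show "linear_map k ((Ms @ [M]) ! i) N (\<lambda>y. g (l[i := y]))"
  proof (cases "i < length Ms")
    case True
    then show ?thesis using multilinear_linear [OF assms(1) [OF l(2)] l(3) True] l(1) len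
      by (simp add: nth_append list_update_append)
  next
    case False
    then have "i = length Ms" using i by simp
    then show ?thesis using assms(2) [OF l(3)] l(1) len by (simp add: nth_append list_update_append)
  qed
qed

lemma tuples_pair: "l \<in> tuples [M, N] \<longleftrightarrow> (\<exists>x\<in>carrier M. \<exists>y\<in>carrier N. l = [x, y])"
  by (auto simp: tuples_iff length_Suc_conv less_Suc_eq numeral_2_eq_2)

lemma multilinear_pairI:
  assumes "\<And>x. x \<in> carrier M \<Longrightarrow> linear_map k N L (\<lambda>y. g [x, y])"
    and "\<And>y. y \<in> carrier N \<Longrightarrow> linear_map k M L (\<lambda>x. g [x, y])"
  shows "multilinear k [M, N] L g"
proof (rule multilinearI)
  fix l assume "l \<in> tuples [M, N]"
  then obtain x y where l: "x \<in> carrier M" "y \<in> carrier N" "l = [x, y]" by (auto simp: tuples_pair)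
  show "g l \<in> carrier L" using linear_map_closed [OF assms(1)] l by simp
  fix i assume "i < length [M, N]"
  then show "linear_map k ([M, N] ! i) L (\<lambda>x. g (l[i := x]))"
    using l assms by (auto simp: less_Suc_eq)
qed

section \<open>The universal property of the tensor product\<close>

locale tensor_factors =
  fixes k :: "('k, 'x) ring_scheme" and Ms :: "('k, 'a) module list"
  assumes k_cring: "cring k" and factor_module: "M \<in> set Ms \<Longrightarrow> left_module k M"
begin

abbreviation "F \<equiv> free_module k (tuples Ms)"
abbreviation "T \<equiv> tensor k Ms"
abbreviation "null \<equiv> tensor_null k Ms"

sublocale k: cring k by (rule k_cring)
sublocale F: left_module k F by (rule k.free_left_module)

lemma tensor_relation_cases [consumes 1, case_names add smult]:
  assumes "y \<in> tensor_relations k Ms"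
  obtains l i u v where "l \<in> tuples Ms" "i < length Ms" "u \<in> carrier (Ms ! i)" "v \<in> carrier (Ms ! i)"
      "y = basis_elem k (l[i := u \<oplus>\<^bsub>Ms ! i\<^esub> v]) \<ominus>\<^bsub>F\<^esub> (basis_elem k (l[i := u]) \<oplus>\<^bsub>F\<^esub> basis_elem k (l[i := v]))"
    | l i r u where "l \<in> tuples Ms" "i < length Ms" "r \<in> carrier k" "u \<in> carrier (Ms ! i)"
      "y = basis_elem k (l[i := r \<odot>\<^bsub>Ms ! i\<^esub> u]) \<ominus>\<^bsub>F\<^esub> (r \<odot>\<^bsub>F\<^esub> basis_elem k (l[i := u]))"
  using assms unfolding tensor_relations_def Let_def by blast

lemma tensor_relation_add:
  "\<lbrakk>l \<in> tuples Ms; i < length Ms; u \<in> carrier (Ms ! i); v \<in> carrier (Ms ! i)\<rbrakk> \<Longrightarrow>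
   basis_elem k (l[i := u \<oplus>\<^bsub>Ms ! i\<^esub> v]) \<ominus>\<^bsub>F\<^esub> (basis_elem k (l[i := u]) \<oplus>\<^bsub>F\<^esub> basis_elem k (l[i := v]))
     \<in> tensor_relations k Ms"
  unfolding tensor_relations_def Let_def by (rule UnI1, rule CollectI, intro exI conjI) (rule refl)

lemma tensor_relation_smult:
  "\<lbrakk>l \<in> tuples Ms; i < length Ms; r \<in> carrier k; u \<in> carrier (Ms ! i)\<rbrakk> \<Longrightarrow>
   basis_elem k (l[i := r \<odot>\<^bsub>Ms ! i\<^esub> u]) \<ominus>\<^bsub>F\<^esub> (r \<odot>\<^bsub>F\<^esub> basis_elem k (l[i := u]))
     \<in> tensor_relations k Ms"
  unfolding tensor_relations_def Let_def by (rule UnI2, rule CollectI, intro exI conjI) (rule refl)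

lemma relations_subset: "tensor_relations k Ms \<subseteq> carrier F"
proof
  fix y assume "y \<in> tensor_relations k Ms"
  then show "y \<in> carrier F"
  proof (cases rule: tensor_relation_cases)
    case (add l i u v)
    interpret Mi: left_module k "Ms ! i" by (rule factor_module [OF nth_mem [OF add(2)]])
    show ?thesis
      using add tuples_update [OF add(1)] by (simp add: k.basis_elem_closed)
  next
    case (smult l i r u)
    interpret Mi: left_module k "Ms ! i" by (rule factor_module [OF nth_mem [OF smult(2)]])
    show ?thesis
      using smult tuples_update [OF smult(1)] by (simp add: k.basis_elem_closed)
  qed
qed

lemma relations_null: "tensor_relations k Ms \<subseteq> null"
  unfolding tensor_null_def span_submodule_def by (rule Inter_greatest) simp

lemma null_least: "\<lbrakk>submodule N k F; tensor_relations k Ms \<subseteq> N\<rbrakk> \<Longrightarrow> null \<subseteq> N"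
  unfolding tensor_null_def span_submodule_def by (rule Inter_lower) simp

lemma null_submodule: "submodule null k F"
proof (rule left_submoduleI [OF F.left_module_axioms])
  \<comment> \<open>The whole free module is one of the submodules being intersected, which bounds
    the span.\<close>
  have "submodule (carrier F) k F" by (rule left_submoduleI [OF F.left_module_axioms]) simp_all
  then show "null \<subseteq> carrier F" by (rule null_least [OF _ relations_subset])
next
  show "\<zero>\<^bsub>F\<^esub> \<in> null"
    unfolding tensor_null_def span_submodule_def by (rule InterI) (auto dest: submoduleD(2))
next
  fix x y assume "x \<in> null" "y \<in> null"
  then show "x \<oplus>\<^bsub>F\<^esub> y \<in> null"
    unfolding tensor_null_def span_submodule_def by (auto intro!: submoduleD(3) [of _ k F])
next
  fix r x assume "r \<in> carrier k" "x \<in> null"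
  then show "r \<odot>\<^bsub>F\<^esub> x \<in> null"
    unfolding tensor_null_def span_submodule_def by (auto intro!: submoduleD(4) [of _ k F])
qed

sublocale T: left_module k T
  unfolding tensor_def by (rule quotient_left_module [OF F.left_module_axioms null_submodule])

lemma tensor_carrier: "carrier T = (\<lambda>x. null +>\<^bsub>F\<^esub> x) ` carrier F"
  unfolding tensor_def by (rule quotient_carrier [OF F.left_module_axioms])

lemma proj_linear: "linear_map k F T (\<lambda>x. null +>\<^bsub>F\<^esub> x)"
  unfolding tensor_def by (rule quotient_proj_linear [OF F.left_module_axioms null_submodule])

lemma pure_closed [simp, intro]: "l \<in> tuples Ms \<Longrightarrow> pure_tensor k Ms l \<in> carrier T"
  unfolding pure_tensor_def by (rule linear_map_closed [OF proj_linear k.basis_elem_closed])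

text \<open>Each linearity law is one of the defining relations, read modulo the submodule that they
  span.\<close>

lemma pure_multilinear: "multilinear k Ms T (pure_tensor k Ms)"
proof (rule multilinearI)
  interpret q: linear_hom k F T "\<lambda>x. null +>\<^bsub>F\<^esub> x"
    by (rule linear_homI [OF F.left_module_axioms T.left_module_axioms proj_linear])
  fix l i assume l: "l \<in> tuples Ms" and i: "i < length Ms"
  interpret Mi: left_module k "Ms ! i" by (rule factor_module [OF nth_mem [OF i]])
  note b = k.basis_elem_closed [OF tuples_update [OF l]]
  show "linear_map k (Ms ! i) T (\<lambda>x. pure_tensor k Ms (l[i := x]))"
  proof (rule linear_mapI)
    fix x y assume x: "x \<in> carrier (Ms ! i)" and y: "y \<in> carrier (Ms ! i)"
    have "basis_elem k (l[i := x \<oplus>\<^bsub>Ms ! i\<^esub> y]) \<ominus>\<^bsub>F\<^esub>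
        (basis_elem k (l[i := x]) \<oplus>\<^bsub>F\<^esub> basis_elem k (l[i := y])) \<in> null"
      using relations_null tensor_relation_add [OF l i x y] by (rule subsetD)
    then have "null +>\<^bsub>F\<^esub> basis_elem k (l[i := x \<oplus>\<^bsub>Ms ! i\<^esub> y]) =
        null +>\<^bsub>F\<^esub> (basis_elem k (l[i := x]) \<oplus>\<^bsub>F\<^esub> basis_elem k (l[i := y]))"
      using x y b by (subst submodule_coset_eq_iff [OF F.left_module_axioms null_submodule]) auto
    then show "pure_tensor k Ms (l[i := x \<oplus>\<^bsub>Ms ! i\<^esub> y]) =
        pure_tensor k Ms (l[i := x]) \<oplus>\<^bsub>T\<^esub> pure_tensor k Ms (l[i := y])"
      using x y b by (simp add: pure_tensor_def)
  next
    fix r x assume r: "r \<in> carrier k" and x: "x \<in> carrier (Ms ! i)"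
    have "basis_elem k (l[i := r \<odot>\<^bsub>Ms ! i\<^esub> x]) \<ominus>\<^bsub>F\<^esub> (r \<odot>\<^bsub>F\<^esub> basis_elem k (l[i := x])) \<in> null"
      using relations_null tensor_relation_smult [OF l i r x] by (rule subsetD)
    then have "null +>\<^bsub>F\<^esub> basis_elem k (l[i := r \<odot>\<^bsub>Ms ! i\<^esub> x]) =
        null +>\<^bsub>F\<^esub> (r \<odot>\<^bsub>F\<^esub> basis_elem k (l[i := x]))"
      using x r b by (subst submodule_coset_eq_iff [OF F.left_module_axioms null_submodule]) auto
    then show "pure_tensor k Ms (l[i := r \<odot>\<^bsub>Ms ! i\<^esub> x]) = r \<odot>\<^bsub>T\<^esub> pure_tensor k Ms (l[i := x])"
      using x r b by (simp add: pure_tensor_def)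
  qed (use tuples_update [OF l] in auto)
qed auto

lemma tuples_nonempty: "\<exists>l. l \<in> tuples Ms"
proof
  show "map zero Ms \<in> tuples Ms"
    using factor_module [OF nth_mem]
    by (auto simp: tuples_iff intro!: abelian_monoid.zero_closed abelian_group.axioms left_module.axioms)
qed

text \<open>A case for zero is absent since zero is the scalar zero times any pure tensor, and
  \<open>tuples_nonempty\<close> provides one.\<close>

lemma tensor_induct [consumes 1, case_names pure add smult]:
  assumes X: "X \<in> carrier T"
    and pure: "\<And>l. l \<in> tuples Ms \<Longrightarrow> Q (pure_tensor k Ms l)"
    and add: "\<And>X Y. \<lbrakk>X \<in> carrier T; Y \<in> carrier T; Q X; Q Y\<rbrakk> \<Longrightarrow> Q (X \<oplus>\<^bsub>T\<^esub> Y)"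
    and smult: "\<And>r X. \<lbrakk>r \<in> carrier k; X \<in> carrier T; Q X\<rbrakk> \<Longrightarrow> Q (r \<odot>\<^bsub>T\<^esub> X)"
  shows "Q X"
proof -
  interpret q: linear_hom k F T "\<lambda>x. null +>\<^bsub>F\<^esub> x"
    by (rule linear_homI [OF F.left_module_axioms T.left_module_axioms proj_linear])
  obtain l where "l \<in> tuples Ms" using tuples_nonempty by blast
  then have Q0: "Q \<zero>\<^bsub>T\<^esub>" using smult [of "\<zero>\<^bsub>k\<^esub>" "pure_tensor k Ms l"] pure by simp
  from X obtain x where x: "x \<in> carrier F" "X = null +>\<^bsub>F\<^esub> x" by (auto simp: tensor_carrier)
  have "Q (null +>\<^bsub>F\<^esub> x)" using x(1)
  proof (induct rule: k.free_module_induct)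
    case zero show ?case using Q0 q.f_zero by (simp add: free_module_simps)
  next
    case (basis l) then show ?case using pure [of l] by (simp add: pure_tensor_def)
  qed (simp_all add: add smult)
  then show ?thesis by (simp add: x)
qed

lemma linear_maps_eq:
  assumes f: "linear_map k T N f" and g: "linear_map k T N g"
    and eq: "\<And>l. l \<in> tuples Ms \<Longrightarrow> f (pure_tensor k Ms l) = g (pure_tensor k Ms l)"
    and X: "X \<in> carrier T"
  shows "f X = g X"
  using X by (induct rule: tensor_induct)
    (simp_all only: eq linear_map_add [OF f] linear_map_add [OF g]
      linear_map_smult [OF f] linear_map_smult [OF g])

text \<open>Well-definedness of the lift: by multilinearity of \<open>g\<close> the kernel of
  \<open>lincomb k N g\<close> contains the defining relations, hence all of \<open>null\<close>, so
  the linear combination is constant on each coset and the image in \<open>tensor_lift\<close> is a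
  singleton.\<close>

lemma tensor_lift_coset:
  assumes N: "left_module k N" and g: "multilinear k Ms N g" and x: "x \<in> carrier F"
  shows "tensor_lift k N g (null +>\<^bsub>F\<^esub> x) = lincomb k N g x"
proof -
  interpret N: left_module k N by fact
  have gP: "g \<in> tuples Ms \<rightarrow> carrier N" using multilinear_closed [OF g] by auto
  interpret L: linear_hom k F N "lincomb k N g"
    by (rule linear_homI [OF F.left_module_axioms N lincomb_linear [OF N gP]])
  define K where "K = {y \<in> carrier F. lincomb k N g y = \<zero>\<^bsub>N\<^esub>}"
  have K: "submodule K k F"
    by (rule left_submoduleI [OF F.left_module_axioms]) (auto simp: K_def)
  have "tensor_relations k Ms \<subseteq> K"
  proof
    fix y assume y: "y \<in> tensor_relations k Ms"
    then have yF: "y \<in> carrier F" using relations_subset by blast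
    from y have "lincomb k N g y = \<zero>\<^bsub>N\<^esub>"
    proof (cases rule: tensor_relation_cases)
        case a: (add l i u v)
        interpret Mi: left_module k "Ms ! i" by (rule factor_module [OF nth_mem [OF a(2)]])
        note t = tuples_update [OF a(1)]
        show ?thesis
          using a t multilinear_closed [OF g t] linear_map_add [OF multilinear_linear [OF g a(1,2)]]
          by (simp add: k.basis_elem_closed lincomb_basis [OF N _ gP] N.M.minus_eq N.M.r_neg)
      next
        case s: (smult l i r u)
        interpret Mi: left_module k "Ms ! i" by (rule factor_module [OF nth_mem [OF s(2)]])
        note t = tuples_update [OF s(1)]
        show ?thesis
          using s t multilinear_closed [OF g t] linear_map_smult [OF multilinear_linear [OF g s(1,2)]]
          by (simp add: k.basis_elem_closed lincomb_basis [OF N _ gP] N.M.minus_eq N.M.r_neg)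
    qed
    then show "y \<in> K" using yF by (simp add: K_def)
  qed
  then have nK: "null \<subseteq> K" by (rule null_least [OF K])
  have "lincomb k N g z = lincomb k N g x" if z: "z \<in> null +>\<^bsub>F\<^esub> x" for z
  proof -
    obtain n where "n \<in> null" "n \<in> carrier F" "z = n \<oplus>\<^bsub>F\<^esub> x"
      using submodule_coset_mem [OF F.left_module_axioms null_submodule x z] .
    then show ?thesis using nK x by (auto simp: K_def)
  qed
  moreover have "x \<in> null +>\<^bsub>F\<^esub> x"
    by (rule abelian_subgroup.a_rcos_self
        [OF submodule_abelian_subgroup [OF F.left_module_axioms null_submodule] x])
  ultimately have "lincomb k N g ` (null +>\<^bsub>F\<^esub> x) = {lincomb k N g x}" by blast
  then show ?thesis by (simp add: tensor_lift_def lincomb_def [abs_def])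
qed

lemma tensor_lift_linear:
  assumes N: "left_module k N" and g: "multilinear k Ms N g"
  shows "linear_map k T N (tensor_lift k N g)"
proof -
  interpret N: left_module k N by fact
  interpret q: linear_hom k F T "\<lambda>x. null +>\<^bsub>F\<^esub> x"
    by (rule linear_homI [OF F.left_module_axioms T.left_module_axioms proj_linear])
  have gP: "g \<in> tuples Ms \<rightarrow> carrier N" using multilinear_closed [OF g] by auto
  interpret L: linear_hom k F N "lincomb k N g"
    by (rule linear_homI [OF F.left_module_axioms N lincomb_linear [OF N gP]])
  note lc = tensor_lift_coset [OF N g]
  show ?thesis
  proof (rule linear_mapI)
    fix X Y r assume "X \<in> carrier T" and r: "r \<in> carrier k"
    then obtain x where x: "x \<in> carrier F" "X = null +>\<^bsub>F\<^esub> x" by (auto simp: tensor_carrier)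
    show "tensor_lift k N g (r \<odot>\<^bsub>T\<^esub> X) = r \<odot>\<^bsub>N\<^esub> tensor_lift k N g X"
      using x r lc [of "r \<odot>\<^bsub>F\<^esub> x"] by (simp add: lc)
  next
    fix X Y assume "X \<in> carrier T" "Y \<in> carrier T"
    then obtain x y where xy: "x \<in> carrier F" "X = null +>\<^bsub>F\<^esub> x" "y \<in> carrier F" "Y = null +>\<^bsub>F\<^esub> y"
      by (auto simp: tensor_carrier)
    show "tensor_lift k N g (X \<oplus>\<^bsub>T\<^esub> Y) = tensor_lift k N g X \<oplus>\<^bsub>N\<^esub> tensor_lift k N g Y"
      using xy lc [of "x \<oplus>\<^bsub>F\<^esub> y"] by (simp add: lc)
  qed (auto simp: tensor_carrier lc)
qed

lemma tensor_lift_pure: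
  assumes "left_module k N" "multilinear k Ms N g" "l \<in> tuples Ms"
  shows "tensor_lift k N g (pure_tensor k Ms l) = g l"
proof -
  have gP: "g \<in> tuples Ms \<rightarrow> carrier N" using multilinear_closed [OF assms(2)] by auto
  show ?thesis unfolding pure_tensor_def
    using tensor_lift_coset [OF assms(1,2) k.basis_elem_closed [OF assms(3)]]
      lincomb_basis [OF assms(1,3) gP] by simp
qed

end

text \<open>Nested lifts of this form define both the product of the enveloping algebra and its
  action on the bar modules, so both get bilinearity from here.\<close>

locale tensor_bilinear = S: tensor_factors k Ms + T: tensor_factors k Ns + N: left_module k N
  for k :: "('k, 'x) ring_scheme" and Ms :: "('k, 'a) module list" and Ns :: "('k, 'b) module list"
    and N :: "('k, 'n) module" +
  fixes G
  assumes G1: "m \<in> tuples Ns \<Longrightarrow> multilinear k Ms N (\<lambda>l. G l m)"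
    and G2: "l \<in> tuples Ms \<Longrightarrow> multilinear k Ns N (G l)"
begin

abbreviation "B X Y \<equiv> tensor_lift k N (\<lambda>l. tensor_lift k N (G l) Y) X"

text \<open>The laws in an entry of \<open>l\<close> are identities between linear maps in
  \<open>Y\<close>; on pure tensors they reduce to \<open>G1\<close>.\<close>

lemma inner_multilinear:
  assumes Y: "Y \<in> carrier (tensor k Ns)"
  shows "multilinear k Ms N (\<lambda>l. tensor_lift k N (G l) Y)"
proof (rule multilinearI)
  note N = N.left_module_axioms
  fix l assume l: "l \<in> tuples Ms"
  note L = T.tensor_lift_linear [OF N G2]
  show "tensor_lift k N (G l) Y \<in> carrier N" by (rule linear_map_closed [OF L [OF l] Y])
  fix i assume i: "i < length Ms"
  interpret Mi: left_module k "Ms ! i" by (rule S.factor_module [OF nth_mem [OF i]])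
  note t = tuples_update [OF l]
  show "linear_map k (Ms ! i) N (\<lambda>x. tensor_lift k N (G (l[i := x])) Y)"
  proof (rule linear_mapI)
    fix x assume x: "x \<in> carrier (Ms ! i)"
    show "tensor_lift k N (G (l[i := x])) Y \<in> carrier N"
      by (rule linear_map_closed [OF L [OF t] Y]) (rule x)
    {
      fix y assume y: "y \<in> carrier (Ms ! i)"
      show "tensor_lift k N (G (l[i := x \<oplus>\<^bsub>Ms ! i\<^esub> y])) Y =
        tensor_lift k N (G (l[i := x])) Y \<oplus>\<^bsub>N\<^esub> tensor_lift k N (G (l[i := y])) Y"
      proof (rule T.linear_maps_eq [OF L linear_map_plus_map [OF N L L] _ Y])
        fix m assume m: "m \<in> tuples Ns"
        show "tensor_lift k N (G (l[i := x \<oplus>\<^bsub>Ms ! i\<^esub> y])) (pure_tensor k Ns m) =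
          tensor_lift k N (G (l[i := x])) (pure_tensor k Ns m) \<oplus>\<^bsub>N\<^esub>
          tensor_lift k N (G (l[i := y])) (pure_tensor k Ns m)"
          using t x y m linear_map_add [OF multilinear_linear [OF G1 [OF m] l i] x y]
          by (simp add: T.tensor_lift_pure [OF N G2])
      qed (use t x y in auto) }
    { fix r assume r: "r \<in> carrier k"
      \<comment> \<open>Scaling is a linear map by commutativity of \<open>k\<close>.\<close>
      have sm: "linear_map k N N (\<lambda>z. r \<odot>\<^bsub>N\<^esub> z)"
        by (rule linear_mapI)
          (simp_all add: r N.lsmult_r_distr N.lsmult_assoc [symmetric] S.k.m_comm)
      show "tensor_lift k N (G (l[i := r \<odot>\<^bsub>Ms ! i\<^esub> x])) Y = r \<odot>\<^bsub>N\<^esub> tensor_lift k N (G (l[i := x])) Y"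
      proof (rule T.linear_maps_eq [OF L linear_map_comp [OF L sm] _ Y])
        fix m assume m: "m \<in> tuples Ns"
        show "tensor_lift k N (G (l[i := r \<odot>\<^bsub>Ms ! i\<^esub> x])) (pure_tensor k Ns m) =
          r \<odot>\<^bsub>N\<^esub> tensor_lift k N (G (l[i := x])) (pure_tensor k Ns m)"
          using t x r m linear_map_smult [OF multilinear_linear [OF G1 [OF m] l i] r x]
          by (simp add: T.tensor_lift_pure [OF N G2])
      qed (use t x r in auto) }
  qed
qed

lemma linear_left: "Y \<in> carrier (tensor k Ns) \<Longrightarrow> linear_map k (tensor k Ms) N (\<lambda>X. B X Y)"
  by (rule S.tensor_lift_linear [OF N.left_module_axioms inner_multilinear])

lemma pure_left: "\<lbrakk>l \<in> tuples Ms; Y \<in> carrier (tensor k Ns)\<rbrakk> \<Longrightarrow>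
    B (pure_tensor k Ms l) Y = tensor_lift k N (G l) Y"
  by (rule S.tensor_lift_pure [OF N.left_module_axioms inner_multilinear])

lemma pure_pure: "\<lbrakk>l \<in> tuples Ms; m \<in> tuples Ns\<rbrakk> \<Longrightarrow>
    B (pure_tensor k Ms l) (pure_tensor k Ns m) = G l m"
  by (simp add: pure_left T.tensor_lift_pure [OF N.left_module_axioms G2])

text \<open>Both sides of each law are linear in \<open>X\<close>, and for pure \<open>X\<close>
  only the inner lift remains, which is linear in \<open>Y\<close>.\<close>

lemma linear_right:
  assumes X: "X \<in> carrier (tensor k Ms)"
  shows "linear_map k (tensor k Ns) N (\<lambda>Y. B X Y)"
proof (rule linear_mapI)
  note N = N.left_module_axioms
  note L = T.tensor_lift_linear [OF N G2]
  fix Y assume Y: "Y \<in> carrier (tensor k Ns)"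
  show "B X Y \<in> carrier N" by (rule linear_map_closed [OF linear_left [OF Y] X])
  { fix Z assume Z: "Z \<in> carrier (tensor k Ns)"
    show "B X (Y \<oplus>\<^bsub>tensor k Ns\<^esub> Z) = B X Y \<oplus>\<^bsub>N\<^esub> B X Z"
      by (rule S.linear_maps_eq [OF linear_left [OF T.T.M.a_closed [OF Y Z]]
            linear_map_plus_map [OF N linear_left [OF Y] linear_left [OF Z]] _ X])
        (simp add: pure_left Y Z linear_map_add [OF L]) }
  { fix r assume r: "r \<in> carrier k"
    have sm: "linear_map k N N (\<lambda>z. r \<odot>\<^bsub>N\<^esub> z)"
      by (rule linear_mapI)
        (simp_all add: r N.lsmult_r_distr N.lsmult_assoc [symmetric] S.k.m_comm)
    show "B X (r \<odot>\<^bsub>tensor k Ns\<^esub> Y) = r \<odot>\<^bsub>N\<^esub> B X Y"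
      by (rule S.linear_maps_eq [OF linear_left [OF T.T.lsmult_closed [OF r Y]]
            linear_map_comp [OF linear_left [OF Y] sm] _ X])
        (simp add: pure_left Y r linear_map_smult [OF L]) }
qed

end

section \<open>Cohomology of cochain complexes\<close>

text \<open>Cosets do not see the carrier. Cohomology is a quotient of the cocycles, but its classes
  may thus be written as cosets inside \<open>C n\<close>.\<close>

lemma a_r_coset_carrier_update: "N +>\<^bsub>M\<lparr>carrier := S\<rparr>\<^esub> x = N +>\<^bsub>M\<^esub> x"
  by (simp add: a_r_coset_def r_coset_def)

locale cochain_complex =
  fixes k :: "('k, 'x) ring_scheme" and C :: "nat \<Rightarrow> ('k, 'c) module" and D
  assumes C_module: "left_module k (C n)"
    and D_linear: "linear_map k (C n) (C (Suc n)) (D n)"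
    and D_D: "x \<in> carrier (C n) \<Longrightarrow> D (Suc n) (D n x) = \<zero>\<^bsub>C (Suc (Suc n))\<^esub>"
begin

abbreviation "Z n \<equiv> cocycles C D n"
abbreviation "Bd n \<equiv> coboundaries C D n"
abbreviation "cls n x \<equiv> Bd n +>\<^bsub>C n\<^esub> x"

sublocale C: left_module k "C n" for n by (rule C_module)
sublocale D: linear_hom k "C n" "C (Suc n)" "D n" for n
  by (rule linear_homI [OF C_module C_module D_linear])

lemma Z_iff: "x \<in> Z n \<longleftrightarrow> x \<in> carrier (C n) \<and> D n x = \<zero>\<^bsub>C (Suc n)\<^esub>"
  by (simp add: cocycles_def)

lemma Bd_cases:
  assumes "x \<in> Bd n"
  obtains "n = 0" "x = \<zero>\<^bsub>C n\<^esub>" | m y where "n = Suc m" "y \<in> carrier (C m)" "x = D m y"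
  using assms by (auto simp: coboundaries_def split: nat.splits)

lemma Z_left_module: "left_module k ((C n)\<lparr>carrier := Z n\<rparr>)"
proof (rule left_moduleI)
  show "ring k" by (rule C.R.ring_axioms)
  show "abelian_group ((C n)\<lparr>carrier := Z n\<rparr>)"
  proof (rule abelian_groupI)
    fix x assume "x \<in> carrier ((C n)\<lparr>carrier := Z n\<rparr>)"
    then show "\<exists>y\<in>carrier ((C n)\<lparr>carrier := Z n\<rparr>). y \<oplus>\<^bsub>(C n)\<lparr>carrier := Z n\<rparr>\<^esub> x = \<zero>\<^bsub>(C n)\<lparr>carrier := Z n\<rparr>\<^esub>"
      by (intro bexI [where x = "\<ominus>\<^bsub>C n\<^esub> x"]) (auto simp: Z_iff C.M.l_neg)
  qed (auto simp: Z_iff C.M.a_ac)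
qed (auto simp: Z_iff C.lsmult_l_distr C.lsmult_r_distr C.lsmult_assoc)

lemma Bd_subset_Z: "Bd n \<subseteq> Z n"
  by (auto elim!: Bd_cases simp: Z_iff D_D)

lemma Bd_zero: "\<zero>\<^bsub>C n\<^esub> \<in> Bd n"
  by (auto simp: coboundaries_def split: nat.splits intro!: image_eqI [where x = "\<zero>\<^bsub>C m\<^esub>" for m])

lemma Bd_submodule: "submodule (Bd n) k ((C n)\<lparr>carrier := Z n\<rparr>)"
proof (rule left_submoduleI [OF Z_left_module])
  fix x y assume "x \<in> Bd n" "y \<in> Bd n"
  then show "x \<oplus>\<^bsub>(C n)\<lparr>carrier := Z n\<rparr>\<^esub> y \<in> Bd n"
    by (cases n) (auto simp: coboundaries_def simp flip: D.f_add intro!: image_eqI [OF refl])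
next
  fix r x assume "r \<in> carrier k" "x \<in> Bd n"
  then show "r \<odot>\<^bsub>(C n)\<lparr>carrier := Z n\<rparr>\<^esub> x \<in> Bd n"
    by (cases n) (auto simp: coboundaries_def simp flip: D.f_smult intro!: image_eqI [OF refl])
qed (use Bd_subset_Z Bd_zero in auto)

lemma cohomology_carrier: "carrier (cohomology C D n) = cls n ` Z n"
  unfolding cohomology_def
  by (simp add: quotient_carrier [OF Z_left_module] a_r_coset_carrier_update)

lemma cohomology_add: "\<lbrakk>x \<in> Z n; y \<in> Z n\<rbrakk> \<Longrightarrow>
    cls n x \<oplus>\<^bsub>cohomology C D n\<^esub> cls n y = cls n (x \<oplus>\<^bsub>C n\<^esub> y)"
  unfolding cohomology_def
  using quotient_add [OF Z_left_module Bd_submodule, of x n y] by (simp add: a_r_coset_carrier_update)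

lemma cohomology_smult: "\<lbrakk>r \<in> carrier k; x \<in> Z n\<rbrakk> \<Longrightarrow>
    r \<odot>\<^bsub>cohomology C D n\<^esub> cls n x = cls n (r \<odot>\<^bsub>C n\<^esub> x)"
  unfolding cohomology_def
  using quotient_smult [OF Z_left_module Bd_submodule, of r x n] by (simp add: a_r_coset_carrier_update)

text \<open>Negation is a definite description over the carrier, so restricting the carrier to
  cocycles might change it; uniqueness of negatives in \<open>C n\<close> excludes that.\<close>

lemma Z_minus: "\<lbrakk>x \<in> Z n; y \<in> Z n\<rbrakk> \<Longrightarrow> x \<ominus>\<^bsub>(C n)\<lparr>carrier := Z n\<rparr>\<^esub> y = x \<ominus>\<^bsub>C n\<^esub> y"
proof -
  assume x: "x \<in> Z n" and y: "y \<in> Z n"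
  interpret Z: left_module k "(C n)\<lparr>carrier := Z n\<rparr>" by (rule Z_left_module)
  have "\<ominus>\<^bsub>C n\<^esub> y = \<ominus>\<^bsub>(C n)\<lparr>carrier := Z n\<rparr>\<^esub> y"
    using y Z.M.l_neg [of y] Z.M.a_inv_closed [of y] by (intro C.M.minus_equality) (auto simp: Z_iff)
  then show ?thesis by (simp add: a_minus_def)
qed

lemma cls_eq_iff: "\<lbrakk>x \<in> Z n; y \<in> Z n\<rbrakk> \<Longrightarrow> cls n x = cls n y \<longleftrightarrow> x \<ominus>\<^bsub>C n\<^esub> y \<in> Bd n"
  using submodule_coset_eq_iff [OF Z_left_module Bd_submodule, of x n y]
  by (simp add: a_r_coset_carrier_update Z_minus)

end

locale cochain_morphism = S: cochain_complex k C D + T: cochain_complex k C' D'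
  for k :: "('k, 'x) ring_scheme" and C :: "nat \<Rightarrow> ('k, 'c) module" and D
    and C' :: "nat \<Rightarrow> ('k, 'e) module" and D' +
  fixes F
  assumes F: "cochain_map k C D C' D' F"
begin

lemma F_linear: "linear_map k (C n) (C' n) (F n)"
  and F_D: "x \<in> carrier (C n) \<Longrightarrow> F (Suc n) (D n x) = D' n (F n x)"
  using F by (auto simp: cochain_map_def)

sublocale F: linear_hom k "C n" "C' n" "F n" for n
  by (rule linear_homI [OF S.C_module T.C_module F_linear])

lemma F_Z: "x \<in> S.Z n \<Longrightarrow> F n x \<in> T.Z n"
  by (auto simp: S.Z_iff T.Z_iff F_D [symmetric])

lemma F_Bd: "x \<in> S.Bd n \<Longrightarrow> F n x \<in> T.Bd n"
  by (erule S.Bd_cases) (auto simp: T.Bd_zero F_D coboundaries_def)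

text \<open>\<open>cohomology_map\<close> extracts the only element of an image over a whole class.
  Coboundaries go to coboundaries, so that image is a singleton and any representative computes
  it.\<close>

lemma cohomology_map_cls:
  assumes x: "x \<in> S.Z n"
  shows "cohomology_map C' D' F n (S.cls n x) = T.cls n (F n x)"
proof -
  have "T.cls n (F n z) = T.cls n (F n x)" if z: "z \<in> S.cls n x" for z
  proof -
    from z obtain b where b: "b \<in> S.Bd n" "z = b \<oplus>\<^bsub>C n\<^esub> x" by (auto simp: a_r_coset_def')
    have bZ: "b \<in> S.Z n" using b S.Bd_subset_Z by blast
    have zZ: "z \<in> S.Z n" using b bZ x by (auto simp: S.Z_iff)
    have "F n z \<ominus>\<^bsub>C' n\<^esub> F n x = F n b"
      using b bZ x by (simp add: S.Z_iff T.C.M.minus_eq T.C.M.a_assoc T.C.M.r_neg)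
    also have "\<dots> \<in> T.Bd n" by (rule F_Bd [OF b(1)])
    finally show ?thesis by (simp add: T.cls_eq_iff F_Z x zZ)
  qed
  moreover have "x \<in> S.cls n x"
    using S.Bd_zero [of n] x by (auto simp: a_r_coset_def' S.Z_iff intro!: bexI [where x = "\<zero>\<^bsub>C n\<^esub>"])
  ultimately have "(\<lambda>z. T.cls n (F n z)) ` S.cls n x = {T.cls n (F n x)}" by blast
  then show ?thesis by (simp add: cohomology_map_def)
qed

lemma cohomology_map_linear:
  "linear_map k (cohomology C D n) (cohomology C' D' n) (cohomology_map C' D' F n)"
proof (rule linear_mapI)
  fix X Y assume "X \<in> carrier (cohomology C D n)" "Y \<in> carrier (cohomology C D n)"
  then obtain x y where xy: "x \<in> S.Z n" "X = S.cls n x" "y \<in> S.Z n" "Y = S.cls n y"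
    by (auto simp: S.cohomology_carrier)
  have "x \<oplus>\<^bsub>C n\<^esub> y \<in> S.Z n" using xy by (auto simp: S.Z_iff)
  then show "cohomology_map C' D' F n (X \<oplus>\<^bsub>cohomology C D n\<^esub> Y) =
     cohomology_map C' D' F n X \<oplus>\<^bsub>cohomology C' D' n\<^esub> cohomology_map C' D' F n Y"
    using xy by (simp add: S.cohomology_add cohomology_map_cls T.cohomology_add F_Z)
       (simp add: S.Z_iff)
next
  fix X r assume r: "r \<in> carrier k" and "X \<in> carrier (cohomology C D n)" 
  then obtain x where x: "x \<in> S.Z n" "X = S.cls n x" by (auto simp: S.cohomology_carrier)
  have "r \<odot>\<^bsub>C n\<^esub> x \<in> S.Z n" using x r by (auto simp: S.Z_iff)
  then show "cohomology_map C' D' F n (r \<odot>\<^bsub>cohomology C D n\<^esub> X) =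
     r \<odot>\<^bsub>cohomology C' D' n\<^esub> cohomology_map C' D' F n X"
    using x r by (simp add: S.cohomology_smult cohomology_map_cls T.cohomology_smult F_Z)
       (simp add: S.Z_iff)
qed (auto simp: S.cohomology_carrier T.cohomology_carrier cohomology_map_cls F_Z)

end

section \<open>Comparison of resolutions\<close>

locale resolution =
  fixes B :: "('b, 'x) ring_scheme" and M :: "('b, 'm) module" and P :: "nat \<Rightarrow> ('b, 'p) module"
    and dP and \<epsilon>
  assumes res: "projective_resolution B M P dP \<epsilon>"
begin

lemma M_module: "left_module B M"
  and P_projective: "projective_module B (P n)"
  and d_linear: "linear_map B (P (Suc n)) (P n) (dP n)"
  and eps_linear: "linear_map B (P 0) M \<epsilon>"
  and eps_surj: "\<epsilon> ` carrier (P 0) = carrier M"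
  and ker_0: "dP 0 ` carrier (P (Suc 0)) = {p \<in> carrier (P 0). \<epsilon> p = \<zero>\<^bsub>M\<^esub>}"
  and ker_Suc: "dP (Suc n) ` carrier (P (Suc (Suc n))) = {p \<in> carrier (P (Suc n)). dP n p = \<zero>\<^bsub>P n\<^esub>}"
  using res by (auto simp: projective_resolution_def)

lemma P_module: "left_module B (P n)"
  using P_projective by (simp add: projective_module_def)

sublocale M: left_module B M by (rule M_module)
sublocale P: left_module B "P n" for n by (rule P_module)
sublocale d: linear_hom B "P (Suc n)" "P n" "dP n" for n
  by (rule linear_homI [OF P_module P_module d_linear])
sublocale eps: linear_hom B "P 0" M \<epsilon>
  by (rule linear_homI [OF P_module M_module eps_linear])

lemma eps_d: "p \<in> carrier (P (Suc 0)) \<Longrightarrow> \<epsilon> (dP 0 p) = \<zero>\<^bsub>M\<^esub>"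
  using ker_0 by blast

lemma d_d: "p \<in> carrier (P (Suc (Suc n))) \<Longrightarrow> dP n (dP (Suc n) p) = \<zero>\<^bsub>P n\<^esub>"
  using ker_Suc [of n] by blast

end

locale two_resolutions = P: resolution B M P dP \<epsilon> + Q: resolution B M Q dQ \<epsilon>'
  for B :: "('b, 'x) ring_scheme" and M :: "('b, 'm) module" and P :: "nat \<Rightarrow> ('b, 'p) module"
    and dP \<epsilon> and Q :: "nat \<Rightarrow> ('b, 'q) module" and dQ \<epsilon>'
begin

text \<open>The predicate \<open>adm\<close> covers both module homomorphisms and \<open>d\<close>-operators: in either case any
  admissible map can be corrected by a linear one, and the defect of two consecutive admissible maps
  is linear.\<close>

lemma lifting_exists:
  assumes ex: "\<And>n. \<exists>t. adm n t"
    and corr: "\<And>n t h. \<lbrakk>adm n t; linear_map B (P n) (Q n) h\<rbrakk> \<Longrightarrow> adm n (\<lambda>p. t p \<oplus>\<^bsub>Q n\<^esub> h p)"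
    and cl: "\<And>n t p. \<lbrakk>adm n t; p \<in> carrier (P n)\<rbrakk> \<Longrightarrow> t p \<in> carrier (Q n)"
    and z: "\<And>n t. adm n t \<Longrightarrow> t \<zero>\<^bsub>P n\<^esub> = \<zero>\<^bsub>Q n\<^esub>"
    and diff: "\<And>n t u. \<lbrakk>adm n t; adm (Suc n) u\<rbrakk> \<Longrightarrow>
       linear_map B (P (Suc n)) (Q n) (\<lambda>p. t (dP n p) \<ominus>\<^bsub>Q n\<^esub> dQ n (u p))"
    and diff0: "\<And>t. adm 0 t \<Longrightarrow> linear_map B (P 0) M (\<lambda>p. f (\<epsilon> p) \<ominus>\<^bsub>M\<^esub> \<epsilon>' (t p))"
    and f: "f \<zero>\<^bsub>M\<^esub> = \<zero>\<^bsub>M\<^esub>" "f \<in> carrier M \<rightarrow> carrier M"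
  shows "\<exists>\<theta>. (\<forall>n. adm n (\<theta> n)) \<and>
     (\<forall>n. \<forall>p\<in>carrier (P (Suc n)). \<theta> n (dP n p) = dQ n (\<theta> (Suc n) p)) \<and>
     (\<forall>p\<in>carrier (P 0). \<epsilon>' (\<theta> 0 p) = f (\<epsilon> p))"
proof -
  \<comment> \<open>The last clause, that \<open>t\<close> after the differential lands in the next
    image, is what makes stage \<open>Suc n\<close> constructible; exactness of \<open>Q\<close>
    re-establishes it there.\<close>
  define good where "good n t \<longleftrightarrow> adm n t \<and> (n = 0 \<longrightarrow> (\<forall>p\<in>carrier (P 0). \<epsilon>' (t p) = f (\<epsilon> p))) \<and>
     (\<forall>p\<in>carrier (P (Suc n)). t (dP n p) \<in> dQ n ` carrier (Q (Suc n)))" for n t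
  have "\<exists>t. good 0 t"
  proof -
    obtain t where t: "adm 0 t" using ex by blast
    obtain h where h: "linear_map B (P 0) (Q 0) h"
      and eh: "\<And>p. p \<in> carrier (P 0) \<Longrightarrow> \<epsilon>' (h p) = f (\<epsilon> p) \<ominus>\<^bsub>M\<^esub> \<epsilon>' (t p)"
      by (rule projective_module_lift [OF P.P_projective Q.P_module P.M_module Q.eps_linear diff0 [OF t]])
        (use linear_map_closed [OF diff0 [OF t]] Q.eps_surj in auto)
    define u where "u p = t p \<oplus>\<^bsub>Q 0\<^esub> h p" for p
    have u: "adm 0 u" unfolding u_def by (rule corr [OF t h])
    have eu: "\<epsilon>' (u p) = f (\<epsilon> p)" if p: "p \<in> carrier (P 0)" for p
    proof -
      have "f (\<epsilon> p) \<in> carrier M" using f p by auto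
      then show ?thesis
        using p cl [OF t p] linear_map_closed [OF h p] eh [OF p]
        by (simp add: u_def P.M.M.minus_eq P.M.M.a_lcomm [of "\<epsilon>' (t p)"] P.M.M.r_neg)
    qed
    have "u (dP 0 p) \<in> dQ 0 ` carrier (Q (Suc 0))" if "p \<in> carrier (P (Suc 0))" for p
      using that by (simp add: Q.ker_0 eu P.eps_d f cl [OF u])
    then show ?thesis using u eu by (auto simp: good_def)
  qed
  moreover have "\<exists>u. good (Suc n) u \<and> (\<forall>p\<in>carrier (P (Suc n)). t (dP n p) = dQ n (u p))"
    if "good n t" for n t
  proof -
    have t: "adm n t" and im: "\<And>p. p \<in> carrier (P (Suc n)) \<Longrightarrow> t (dP n p) \<in> dQ n ` carrier (Q (Suc n))"
      using that by (auto simp: good_def)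
    \<comment> \<open>An arbitrary admissible map, to be corrected by a lift of its linear defect
      through \<open>dQ n\<close>.\<close>
    obtain s where s: "adm (Suc n) s" using ex by blast
    have "t (dP n p) \<ominus>\<^bsub>Q n\<^esub> dQ n (s p) \<in> dQ n ` carrier (Q (Suc n))" if p: "p \<in> carrier (P (Suc n))" for p
    proof -
      obtain q where q: "q \<in> carrier (Q (Suc n))" "t (dP n p) = dQ n q" using im [OF p] by blast
      then show ?thesis using cl [OF s p] by (intro image_eqI [where x = "q \<ominus>\<^bsub>Q (Suc n)\<^esub> s p"]) simp_all
    qed
    then obtain h where h: "linear_map B (P (Suc n)) (Q (Suc n)) h"
      and dh: "\<And>p. p \<in> carrier (P (Suc n)) \<Longrightarrow> dQ n (h p) = t (dP n p) \<ominus>\<^bsub>Q n\<^esub> dQ n (s p)"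
      using projective_module_lift [OF P.P_projective Q.P_module Q.P_module Q.d_linear diff [OF t s]]
      by blast
    define u where "u p = s p \<oplus>\<^bsub>Q (Suc n)\<^esub> h p" for p
    have u: "adm (Suc n) u" unfolding u_def by (rule corr [OF s h])
    have du: "t (dP n p) = dQ n (u p)" if p: "p \<in> carrier (P (Suc n))" for p
    proof -
      have "t (dP n p) \<in> carrier (Q n)" using cl [OF t] p by simp
      then show ?thesis
        using p cl [OF s p] linear_map_closed [OF h p] dh [OF p]
        by (simp add: u_def Q.P.M.minus_eq Q.P.M.a_lcomm [where x = "dQ n (s p)"] Q.P.M.r_neg)
    qed
    have "u (dP (Suc n) p) \<in> dQ (Suc n) ` carrier (Q (Suc (Suc n)))"
      if "p \<in> carrier (P (Suc (Suc n)))" for p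
      using that by (simp add: Q.ker_Suc du [symmetric] P.d_d z [OF t] cl [OF u])
    then show ?thesis using u du by (auto simp: good_def)
  qed
  ultimately obtain \<theta> where
    "\<And>n. good n (\<theta> n) \<and> (\<forall>p\<in>carrier (P (Suc n)). \<theta> n (dP n p) = dQ n (\<theta> (Suc n) p))"
    using dependent_nat_choice [of good "\<lambda>n t u. \<forall>p\<in>carrier (P (Suc n)). t (dP n p) = dQ n (u p)"]
    by blast
  then show ?thesis unfolding good_def by blast
qed

text \<open>The instance of \<open>lifting_exists\<close> in which admissible means linear; zero
  maps serve as the uncorrected choices.\<close>

lemma resolution_map_exists: "\<exists>\<theta>. resolution_map B P dP \<epsilon> Q dQ \<epsilon>' \<theta>"
  unfolding resolution_map_def
proof (rule lifting_exists [where adm = "\<lambda>n. linear_map B (P n) (Q n)" and f = "\<lambda>x. x"])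
  show "\<exists>t. linear_map B (P n) (Q n) t" for n using linear_map_zero_map [OF Q.P_module] by blast
  show "linear_map B (P (Suc n)) (Q n) (\<lambda>p. t (dP n p) \<ominus>\<^bsub>Q n\<^esub> dQ n (u p))"
    if "linear_map B (P n) (Q n) t" "linear_map B (P (Suc n)) (Q (Suc n)) u" for n t u
    by (rule linear_map_minus_map [OF Q.P_module linear_map_comp [OF P.d_linear that(1)]
          linear_map_comp [OF that(2) Q.d_linear]])
  show "linear_map B (P 0) M (\<lambda>p. \<epsilon> p \<ominus>\<^bsub>M\<^esub> \<epsilon>' (t p))" if "linear_map B (P 0) (Q 0) t" for t
    by (rule linear_map_minus_map [OF P.M_module P.eps_linear linear_map_comp [OF that Q.eps_linear]])
qed (auto intro: linear_map_plus_map [OF Q.P_module] linear_map_0 [OF P.P_module Q.P_module] linear_map_closed)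

lemma null_homotopy:
  assumes lin: "\<And>n. linear_map B (P n) (Q n) (u n)"
    and comm: "\<And>n p. p \<in> carrier (P (Suc n)) \<Longrightarrow> u n (dP n p) = dQ n (u (Suc n) p)"
    and base: "\<And>p. p \<in> carrier (P 0) \<Longrightarrow> \<epsilon>' (u 0 p) = \<zero>\<^bsub>M\<^esub>"
  obtains h where "\<And>n. linear_map B (P n) (Q (Suc n)) (h n)"
    and "\<And>p. p \<in> carrier (P 0) \<Longrightarrow> u 0 p = dQ 0 (h 0 p)"
    and "\<And>n p. p \<in> carrier (P (Suc n)) \<Longrightarrow>
      u (Suc n) p = dQ (Suc n) (h (Suc n) p) \<oplus>\<^bsub>Q (Suc n)\<^esub> h n (dP n p)"
proof -
  interpret u: linear_hom B "P n" "Q n" "u n" for n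
    by (rule linear_homI [OF P.P_module Q.P_module lin])
  \<comment> \<open>The last clause is the homotopy relation on boundaries, where the summand from
    the previous degree vanishes. With it, \<open>u (Suc n)\<close> minus \<open>h\<close> after
    \<open>dP n\<close> takes values in the kernel of \<open>dQ n\<close>, which is an
    image.\<close>
  define good where "good n h \<longleftrightarrow> linear_map B (P n) (Q (Suc n)) h \<and>
     (n = 0 \<longrightarrow> (\<forall>p\<in>carrier (P 0). u 0 p = dQ 0 (h p))) \<and>
     (\<forall>p\<in>carrier (P (Suc n)). u n (dP n p) = dQ n (h (dP n p)))" for n h
  have "\<exists>h. good 0 h"
  proof -
    have "u 0 p \<in> dQ 0 ` carrier (Q (Suc 0))" if "p \<in> carrier (P 0)" for p
      using that by (simp add: Q.ker_0 base)
    then obtain h where "linear_map B (P 0) (Q (Suc 0)) h" "\<And>p. p \<in> carrier (P 0) \<Longrightarrow> dQ 0 (h p) = u 0 p"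
      using projective_module_lift [OF P.P_projective Q.P_module Q.P_module Q.d_linear lin] by blast
    then show ?thesis by (auto simp: good_def)
  qed
  moreover have "\<exists>g. good (Suc n) g \<and> (\<forall>p\<in>carrier (P (Suc n)).
      u (Suc n) p = dQ (Suc n) (g p) \<oplus>\<^bsub>Q (Suc n)\<^esub> h (dP n p))" if "good n h" for n h
  proof -
    have h: "linear_map B (P n) (Q (Suc n)) h"
      and eq: "\<And>p. p \<in> carrier (P (Suc n)) \<Longrightarrow> u n (dP n p) = dQ n (h (dP n p))"
      using that by (auto simp: good_def)
    interpret h: linear_hom B "P n" "Q (Suc n)" h
      by (rule linear_homI [OF P.P_module Q.P_module h])
    have D: "linear_map B (P (Suc n)) (Q (Suc n)) (\<lambda>p. u (Suc n) p \<ominus>\<^bsub>Q (Suc n)\<^esub> h (dP n p))"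
      by (rule linear_map_minus_map [OF Q.P_module lin linear_map_comp [OF P.d_linear h]])
    have "u (Suc n) p \<ominus>\<^bsub>Q (Suc n)\<^esub> h (dP n p) \<in> dQ (Suc n) ` carrier (Q (Suc (Suc n)))"
      if p: "p \<in> carrier (P (Suc n))" for p
      using p eq [OF p] comm [OF p] by (simp add: Q.ker_Suc Q.P.M.minus_eq Q.P.M.r_neg)
    then obtain g where g: "linear_map B (P (Suc n)) (Q (Suc (Suc n))) g"
      and dg: "\<And>p. p \<in> carrier (P (Suc n)) \<Longrightarrow> dQ (Suc n) (g p) = u (Suc n) p \<ominus>\<^bsub>Q (Suc n)\<^esub> h (dP n p)"
      using projective_module_lift [OF P.P_projective Q.P_module Q.P_module Q.d_linear D] by blast
    have "good (Suc n) g"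
      unfolding good_def using g by (auto simp: dg P.d_d Q.P.M.minus_eq)
    moreover have "u (Suc n) p = dQ (Suc n) (g p) \<oplus>\<^bsub>Q (Suc n)\<^esub> h (dP n p)"
      if p: "p \<in> carrier (P (Suc n))" for p
      using p by (simp add: dg Q.P.M.minus_eq Q.P.M.a_assoc Q.P.M.l_neg)
    ultimately show ?thesis by blast
  qed
  ultimately obtain h where
    "\<And>n. good n (h n) \<and> (\<forall>p\<in>carrier (P (Suc n)).
      u (Suc n) p = dQ (Suc n) (h (Suc n) p) \<oplus>\<^bsub>Q (Suc n)\<^esub> h n (dP n p))"
    using dependent_nat_choice [of good "\<lambda>n h g. \<forall>p\<in>carrier (P (Suc n)).
      u (Suc n) p = dQ (Suc n) (g p) \<oplus>\<^bsub>Q (Suc n)\<^esub> h (dP n p)"]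
    by blast
  then show thesis using that [of h] unfolding good_def by blast
qed

end

section \<open>Hom complexes\<close>

lemma hom_module_simps:
  "carrier (hom_module R M N s) = {\<phi> \<in> extensional (carrier M). linear_map R M N \<phi>}"
  "\<zero>\<^bsub>hom_module R M N s\<^esub> = (\<lambda>p\<in>carrier M. \<zero>\<^bsub>N\<^esub>)"
  "\<phi> \<oplus>\<^bsub>hom_module R M N s\<^esub> \<psi> = (\<lambda>p\<in>carrier M. \<phi> p \<oplus>\<^bsub>N\<^esub> \<psi> p)"
  "r \<odot>\<^bsub>hom_module R M N s\<^esub> \<phi> = (\<lambda>p\<in>carrier M. s r (\<phi> p))"
  by (simp_all add: hom_module_def)

lemma linear_map_restrict:
  assumes "left_module R M"
  shows "linear_map R M N (\<lambda>p\<in>carrier M. f p) \<longleftrightarrow> linear_map R M N f"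
  by (rule linear_map_cong [OF _ assms]) simp

text \<open>\<open>K\<close> is \<open>N\<close> with other scalars, and \<open>comm\<close> keeps
  pointwise multiples \<open>R\<close>-linear. One instance has \<open>R = k\<close> and gives
  Hochschild cochains, the other has an algebra \<open>B\<close> for \<open>R\<close> and gives hom
  complexes.\<close>

lemma hom_module_left_module:
  assumes M: "left_module R M" and N: "left_module R N" and K: "left_module k K"
    and same: "carrier K = carrier N" "add K = add N" "zero K = zero N"
    and comm: "\<And>r b x. \<lbrakk>r \<in> carrier k; b \<in> carrier R; x \<in> carrier N\<rbrakk> \<Longrightarrow>
       r \<odot>\<^bsub>K\<^esub> (b \<odot>\<^bsub>N\<^esub> x) = b \<odot>\<^bsub>N\<^esub> (r \<odot>\<^bsub>K\<^esub> x)"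
  shows "left_module k (hom_module R M N (smult K))"
proof -
  interpret M: left_module R M by fact
  interpret N: left_module R N by fact
  interpret K: left_module k K by fact
  note cl = linear_map_closed [of R M N]
  have sc: "r \<odot>\<^bsub>K\<^esub> x \<in> carrier N" if "r \<in> carrier k" "x \<in> carrier N" for r x
    using K.lsmult_closed [of r x] that same by simp
  note R = linear_map_restrict [OF M]
  have ext: "\<phi> = \<psi>" if "\<phi> \<in> extensional (carrier M)" "\<psi> \<in> extensional (carrier M)"
    "\<And>p. p \<in> carrier M \<Longrightarrow> \<phi> p = \<psi> p" for \<phi> \<psi> :: "_ \<Rightarrow> _"
    using that by (rule extensionalityI)
  show ?thesis
  proof (rule left_moduleI)
    show "ring k" by (rule K.R.ring_axioms)
    show "abelian_group (hom_module R M N (smult K))"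
    proof (rule abelian_groupI)
      fix \<phi> assume "\<phi> \<in> carrier (hom_module R M N (smult K))"
      then have \<phi>: "\<phi> \<in> extensional (carrier M)" "linear_map R M N \<phi>" by (auto simp: hom_module_simps)
      show "\<exists>\<psi>\<in>carrier (hom_module R M N (smult K)). \<psi> \<oplus>\<^bsub>hom_module R M N (smult K)\<^esub> \<phi> =
         \<zero>\<^bsub>hom_module R M N (smult K)\<^esub>"
      proof
        show "(\<lambda>p\<in>carrier M. \<ominus>\<^bsub>N\<^esub> \<phi> p) \<in> carrier (hom_module R M N (smult K))"
          using linear_map_comp [OF \<phi>(2) linear_map_neg [OF N]] by (simp add: hom_module_simps R)
      qed (use \<phi> in \<open>auto simp: hom_module_simps cl N.M.l_neg intro!: restrict_ext\<close>)
    next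
      fix \<phi> \<psi> \<chi>
      assume "\<phi> \<in> carrier (hom_module R M N (smult K))" "\<psi> \<in> carrier (hom_module R M N (smult K))"
        "\<chi> \<in> carrier (hom_module R M N (smult K))"
      then show "\<phi> \<oplus>\<^bsub>hom_module R M N (smult K)\<^esub> \<psi> \<oplus>\<^bsub>hom_module R M N (smult K)\<^esub> \<chi> =
         \<phi> \<oplus>\<^bsub>hom_module R M N (smult K)\<^esub> (\<psi> \<oplus>\<^bsub>hom_module R M N (smult K)\<^esub> \<chi>)"
        by (auto simp: hom_module_simps cl N.M.a_assoc intro!: restrict_ext)
    qed (auto simp: hom_module_simps R cl N.M.a_comm linear_map_zero_map [OF N]
        intro!: linear_map_plus_map [OF N] restrict_ext ext)
  next
    fix r \<phi> assume r: "r \<in> carrier k" and "\<phi> \<in> carrier (hom_module R M N (smult K))"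
    then have \<phi>: "\<phi> \<in> extensional (carrier M)" "linear_map R M N \<phi>" by (auto simp: hom_module_simps)
    have "linear_map R M N (\<lambda>p. r \<odot>\<^bsub>K\<^esub> \<phi> p)"
      by (rule linear_mapI)
        (use r in \<open>simp_all add: cl [OF \<phi>(2)] sc linear_map_add [OF \<phi>(2)] linear_map_smult [OF \<phi>(2)]
          comm K.lsmult_r_distr [unfolded same]\<close>)
    then show "r \<odot>\<^bsub>hom_module R M N (smult K)\<^esub> \<phi> \<in> carrier (hom_module R M N (smult K))"
      by (simp add: hom_module_simps R)
  qed (auto simp: hom_module_simps cl sc K.lsmult_l_distr [unfolded same] K.lsmult_r_distr [unfolded same]
      K.lsmult_assoc [unfolded same] K.lsmult_one [unfolded same] intro!: restrict_ext ext)
qed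

lemma restrict_scalars_simps [simp]:
  "carrier (restrict_scalars B M) = carrier M"
  "\<zero>\<^bsub>restrict_scalars B M\<^esub> = \<zero>\<^bsub>M\<^esub>"
  "add (restrict_scalars B M) = add M"
  "r \<odot>\<^bsub>restrict_scalars B M\<^esub> x = (r \<odot>\<^bsub>B\<^esub> \<one>\<^bsub>B\<^esub>) \<odot>\<^bsub>M\<^esub> x"
  by (simp_all add: restrict_scalars_def)

context assoc_algebra
begin

lemma scalar_mult_left: "\<lbrakk>r \<in> carrier k; x \<in> carrier A\<rbrakk> \<Longrightarrow> (r \<odot>\<^bsub>A\<^esub> \<one>\<^bsub>A\<^esub>) \<otimes>\<^bsub>A\<^esub> x = r \<odot>\<^bsub>A\<^esub> x"
  and scalar_mult_right: "\<lbrakk>r \<in> carrier k; x \<in> carrier A\<rbrakk> \<Longrightarrow> x \<otimes>\<^bsub>A\<^esub> (r \<odot>\<^bsub>A\<^esub> \<one>\<^bsub>A\<^esub>) = r \<odot>\<^bsub>A\<^esub> x"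
  by (simp_all add: smult_mult_left smult_mult_right)

end

locale algebra_module = B: assoc_algebra k B + M: left_module B M
  for k :: "('k, 'x) ring_scheme" and B :: "('k, 'b) module" and M :: "('b, 'm) module"
begin

lemma scalar_smult: "\<lbrakk>r \<in> carrier k; b \<in> carrier B; x \<in> carrier M\<rbrakk> \<Longrightarrow>
    (r \<odot>\<^bsub>B\<^esub> \<one>\<^bsub>B\<^esub>) \<odot>\<^bsub>M\<^esub> (b \<odot>\<^bsub>M\<^esub> x) = (r \<odot>\<^bsub>B\<^esub> b) \<odot>\<^bsub>M\<^esub> x"
  by (simp add: M.lsmult_assoc [symmetric] B.scalar_mult_left)

lemma scalar_comm: "\<lbrakk>r \<in> carrier k; b \<in> carrier B; x \<in> carrier M\<rbrakk> \<Longrightarrow>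
    (r \<odot>\<^bsub>B\<^esub> \<one>\<^bsub>B\<^esub>) \<odot>\<^bsub>M\<^esub> (b \<odot>\<^bsub>M\<^esub> x) = b \<odot>\<^bsub>M\<^esub> ((r \<odot>\<^bsub>B\<^esub> \<one>\<^bsub>B\<^esub>) \<odot>\<^bsub>M\<^esub> x)"
  by (simp add: M.lsmult_assoc [symmetric] B.scalar_mult_left B.scalar_mult_right)

lemma restrict_scalars_module: "left_module k (restrict_scalars B M)"
proof (rule left_moduleI)
  show "ring k" by (rule B.R.ring_axioms)
  show "abelian_group (restrict_scalars B M)"
  proof (rule abelian_groupI)
    fix x assume "x \<in> carrier (restrict_scalars B M)"
    then show "\<exists>y\<in>carrier (restrict_scalars B M). y \<oplus>\<^bsub>restrict_scalars B M\<^esub> x = \<zero>\<^bsub>restrict_scalars B M\<^esub>"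
      by (intro bexI [where x = "\<ominus>\<^bsub>M\<^esub> x"]) (auto simp: M.M.l_neg)
  qed (auto simp: M.M.a_ac)
next
  fix a b x assume "a \<in> carrier k" "b \<in> carrier k" "x \<in> carrier (restrict_scalars B M)"
  then show "(a \<otimes>\<^bsub>k\<^esub> b) \<odot>\<^bsub>restrict_scalars B M\<^esub> x =
      a \<odot>\<^bsub>restrict_scalars B M\<^esub> (b \<odot>\<^bsub>restrict_scalars B M\<^esub> x)"
    by (simp add: M.lsmult_assoc [symmetric] B.scalar_mult_left B.smult_assoc1)
qed (auto simp: B.smult_l_distr M.lsmult_l_distr M.lsmult_r_distr)

lemma linear_imp_restrict_linear:
  "linear_map B M N f \<Longrightarrow> linear_map k (restrict_scalars B M) (restrict_scalars B N) f"
  by (auto simp: linear_map_def)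

end

lemma algebra_moduleI: "\<lbrakk>assoc_algebra k B; left_module B M\<rbrakk> \<Longrightarrow> algebra_module k B M"
  by (simp add: algebra_module_def)

lemma hom_complex_module:
  assumes "algebra_module k B M" "left_module B (P n)"
  shows "left_module k (hom_complex B P M n)"
proof -
  interpret algebra_module k B M by fact
  show ?thesis unfolding hom_complex_def
    by (rule hom_module_left_module [OF assms(2) M.left_module_axioms restrict_scalars_module])
      (simp_all add: scalar_comm)
qed

lemma hom_complex_carrier:
  "\<phi> \<in> carrier (hom_complex B P M n) \<longleftrightarrow> \<phi> \<in> extensional (carrier (P n)) \<and> linear_map B (P n) M \<phi>"
  by (simp add: hom_complex_def hom_module_simps)

lemma hom_complex_simps:
  "\<zero>\<^bsub>hom_complex B P M n\<^esub> = (\<lambda>p\<in>carrier (P n). \<zero>\<^bsub>M\<^esub>)"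
  "\<phi> \<oplus>\<^bsub>hom_complex B P M n\<^esub> \<psi> = (\<lambda>p\<in>carrier (P n). \<phi> p \<oplus>\<^bsub>M\<^esub> \<psi> p)"
  "r \<odot>\<^bsub>hom_complex B P M n\<^esub> \<phi> = (\<lambda>p\<in>carrier (P n). (r \<odot>\<^bsub>B\<^esub> \<one>\<^bsub>B\<^esub>) \<odot>\<^bsub>M\<^esub> \<phi> p)"
  by (simp_all add: hom_complex_def hom_module_simps)

lemma hom_complex_minus:
  assumes "algebra_module k B M" "left_module B (P n)"
    and \<phi>: "\<phi> \<in> carrier (hom_complex B P M n)" and \<psi>: "\<psi> \<in> carrier (hom_complex B P M n)"
  shows "\<phi> \<ominus>\<^bsub>hom_complex B P M n\<^esub> \<psi> = (\<lambda>p\<in>carrier (P n). \<phi> p \<ominus>\<^bsub>M\<^esub> \<psi> p)"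
proof -
  interpret algebra_module k B M by fact
  interpret H: left_module k "hom_complex B P M n" by (rule hom_complex_module) fact+
  interpret P: left_module B "P n" by fact
  have e: "(\<lambda>p\<in>carrier (P n). \<ominus>\<^bsub>M\<^esub> \<psi> p) \<in> carrier (hom_complex B P M n)"
    using linear_map_comp [OF _ linear_map_neg [OF M.left_module_axioms]] \<psi>
    by (auto simp: hom_complex_carrier linear_map_restrict [OF assms(2)])
  have "\<ominus>\<^bsub>hom_complex B P M n\<^esub> \<psi> = (\<lambda>p\<in>carrier (P n). \<ominus>\<^bsub>M\<^esub> \<psi> p)"
    by (rule H.M.minus_equality [OF _ \<psi> e])
      (use \<psi> in \<open>auto simp: hom_complex_simps hom_complex_carrier M.M.l_neg linear_map_closed intro!: restrict_ext\<close>)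
  then show ?thesis by (auto simp: a_minus_def hom_complex_simps intro!: restrict_ext)
qed

locale algebra_resolution = resolution B M P dP \<epsilon> + algebra_module k B M
  for k :: "('k, 'x) ring_scheme" and B :: "('k, 'b) module" and M :: "('b, 'm) module"
    and P :: "nat \<Rightarrow> ('b, 'p) module" and dP \<epsilon>
begin

abbreviation "H \<equiv> hom_complex B P M"

lemma algebra_module: "algebra_module k B M" ..

lemma hom_diff_closed:
  "\<phi> \<in> carrier (H n) \<Longrightarrow> hom_diff P dP n \<phi> \<in> carrier (H (Suc n))"
  using linear_map_comp [OF d_linear]
  by (auto simp: hom_complex_carrier hom_diff_def linear_map_restrict [OF P_module])

sublocale H: cochain_complex k H "hom_diff P dP"
proof (rule cochain_complex.intro)
  fix n
  show "left_module k (H n)" by (rule hom_complex_module [where P = P, OF algebra_module P_module])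
  show "linear_map k (H n) (H (Suc n)) (hom_diff P dP n)"
    by (rule linear_mapI, erule hom_diff_closed)
      (auto simp: hom_complex_simps hom_diff_def intro!: restrict_ext)
  fix \<phi> assume "\<phi> \<in> carrier (H n)"
  then have \<phi>: "linear_map B (P n) M \<phi>" by (simp add: hom_complex_carrier)
  show "hom_diff P dP (Suc n) (hom_diff P dP n \<phi>) = \<zero>\<^bsub>H (Suc (Suc n))\<^esub>"
    by (auto simp: hom_diff_def hom_complex_simps d_d linear_map_0 [OF P_module M_module \<phi>]
        intro!: restrict_ext)
qed

lemma cocycle_iff: "\<phi> \<in> H.Z n \<longleftrightarrow> \<phi> \<in> extensional (carrier (P n)) \<and> linear_map B (P n) M \<phi> \<and>
    (\<forall>p\<in>carrier (P (Suc n)). \<phi> (dP n p) = \<zero>\<^bsub>M\<^esub>)"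
  by (auto simp: H.Z_iff hom_complex_carrier hom_complex_simps hom_diff_def restrict_def fun_eq_iff)

end

locale algebra_two_resolutions = two_resolutions B M P dP \<epsilon> Q dQ \<epsilon>' + algebra_module k B M
  for k :: "('k, 'x) ring_scheme" and B :: "('k, 'b) module" and M :: "('b, 'm) module"
    and P :: "nat \<Rightarrow> ('b, 'p) module" and dP \<epsilon> and Q :: "nat \<Rightarrow> ('b, 'q) module" and dQ \<epsilon>'
begin

sublocale PP: algebra_resolution k B M P dP \<epsilon> ..
sublocale QQ: algebra_resolution k B M Q dQ \<epsilon>' ..

text \<open>Composing \<open>u = d h + h d\<close> with the cocycle \<psi> kills the first summand
  and leaves the coboundary of \<psi> after \<open>h\<close>. In degree zero the second summand is
  missing, and the composite is zero.\<close>

lemma null_homotopic_coboundary: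
  assumes lin: "\<And>n. linear_map B (P n) (Q n) (u n)"
    and comm: "\<And>n p. p \<in> carrier (P (Suc n)) \<Longrightarrow> u n (dP n p) = dQ n (u (Suc n) p)"
    and base: "\<And>p. p \<in> carrier (P 0) \<Longrightarrow> \<epsilon>' (u 0 p) = \<zero>\<^bsub>M\<^esub>"
    and \<psi>: "\<psi> \<in> QQ.H.Z n"
  shows "(\<lambda>p\<in>carrier (P n). \<psi> (u n p)) \<in> PP.H.Bd n"
proof -
  obtain h where h: "\<And>n. linear_map B (P n) (Q (Suc n)) (h n)"
    and h0: "\<And>p. p \<in> carrier (P 0) \<Longrightarrow> u 0 p = dQ 0 (h 0 p)"
    and hS: "\<And>n p. p \<in> carrier (P (Suc n)) \<Longrightarrow>
      u (Suc n) p = dQ (Suc n) (h (Suc n) p) \<oplus>\<^bsub>Q (Suc n)\<^esub> h n (dP n p)"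
    using null_homotopy [of u, OF lin comm base] by blast
  interpret h: linear_hom B "P i" "Q (Suc i)" "h i" for i
    by (rule linear_homI [OF P.P_module Q.P_module h])
  have \<psi>l: "linear_map B (Q n) M \<psi>" and \<psi>d: "\<And>q. q \<in> carrier (Q (Suc n)) \<Longrightarrow> \<psi> (dQ n q) = \<zero>\<^bsub>M\<^esub>"
    using \<psi> by (auto simp: QQ.cocycle_iff)
  interpret \<psi>: linear_hom B "Q n" M \<psi> by (rule linear_homI [OF Q.P_module P.M_module \<psi>l])
  show ?thesis
  proof (cases n)
    case 0
    then show ?thesis using \<psi>d h0 by (auto simp: coboundaries_def hom_complex_simps intro!: restrict_ext)
  next
    case (Suc m)
    have "(\<lambda>p\<in>carrier (P n). \<psi> (u n p)) = hom_diff P dP m (\<lambda>p\<in>carrier (P m). \<psi> (h m p))"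
      using \<psi>d hS \<psi>l [unfolded Suc] linear_map_add [OF \<psi>l]
      by (auto simp: Suc hom_diff_def linear_map_closed intro!: restrict_ext)
    moreover have "(\<lambda>p\<in>carrier (P m). \<psi> (h m p)) \<in> carrier (PP.H m)"
      using linear_map_comp [OF h \<psi>l [unfolded Suc]]
      by (simp add: hom_complex_carrier linear_map_restrict [OF P.P_module])
    ultimately show ?thesis by (simp add: Suc coboundaries_def)
  qed
qed

lemma pullback_cochain_map:
  assumes "\<And>n. linear_map B (P n) (Q n) (u n)"
    and "\<And>n p. p \<in> carrier (P (Suc n)) \<Longrightarrow> u n (dP n p) = dQ n (u (Suc n) p)"
  shows "cochain_map k QQ.H (hom_diff Q dQ) PP.H (hom_diff P dP)
    (\<lambda>n \<psi>. \<lambda>p\<in>carrier (P n). \<psi> (u n p))"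
  unfolding cochain_map_def
proof (intro allI conjI ballI)
  note cl = linear_map_closed [OF assms(1)]
  fix n
  show "linear_map k (QQ.H n) (PP.H n) (\<lambda>\<psi>. \<lambda>p\<in>carrier (P n). \<psi> (u n p))"
    using linear_map_comp [OF assms(1)]
    by (intro linear_mapI)
      (auto simp: hom_complex_carrier hom_complex_simps cl linear_map_restrict [OF P.P_module] intro!: restrict_ext)
  fix \<psi> assume "\<psi> \<in> carrier (QQ.H n)"
  show "(\<lambda>p\<in>carrier (P (Suc n)). hom_diff Q dQ n \<psi> (u (Suc n) p)) =
     hom_diff P dP n (\<lambda>p\<in>carrier (P n). \<psi> (u n p))"
    by (auto simp: hom_diff_def cl assms(2) intro!: restrict_ext)
qed

end

section \<open>Lifting of \<open>d\<close>-operators\<close>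

locale algebra_derivation = B: assoc_algebra k B
  for k :: "('k, 'x) ring_scheme" and B :: "('k, 'b) module" +
  fixes d
  assumes d: "derivation k B d"
begin

lemma B_left_module: "left_module k B"
  by (rule module_imp_left_module) (rule B.module_axioms)

sublocale d: linear_hom k B B d
  using d by (intro linear_homI B_left_module) (simp add: derivation_def)

lemma d_mult: "\<lbrakk>x \<in> carrier B; y \<in> carrier B\<rbrakk> \<Longrightarrow> d (x \<otimes>\<^bsub>B\<^esub> y) = d x \<otimes>\<^bsub>B\<^esub> y \<oplus>\<^bsub>B\<^esub> x \<otimes>\<^bsub>B\<^esub> d y"
  using d by (simp add: derivation_def)

lemma d_one: "d \<one>\<^bsub>B\<^esub> = \<zero>\<^bsub>B\<^esub>"
proof -
  have "d \<one>\<^bsub>B\<^esub> = d \<one>\<^bsub>B\<^esub> \<oplus>\<^bsub>B\<^esub> d \<one>\<^bsub>B\<^esub>" using d_mult [of "\<one>\<^bsub>B\<^esub>" "\<one>\<^bsub>B\<^esub>"] by simp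
  then show ?thesis by (metis B.M.add.r_cancel_one' B.A.one_closed d.f_closed)
qed

text \<open>On a free module \<open>d\<close> acts coordinatewise. The Leibniz rule passes to the
  summand because \<iota> and \<pi> are \<open>B\<close>-linear and \<pi> after \<iota> is the
  identity, which restores the term \<open>d b\<close> times \<open>q\<close>.\<close>

lemma projective_d_operator:
  fixes Q :: "('b, 'q) module"
  assumes "projective_module B Q"
  shows "\<exists>f. d_operator k B d Q f"
proof -
  from assms obtain I :: "'q set" and \<iota> \<pi> where Q: "left_module B Q"
    and \<iota>: "linear_map B Q (free_module B I) \<iota>" and \<pi>: "linear_map B (free_module B I) Q \<pi>"
    and \<pi>\<iota>: "\<And>x. x \<in> carrier Q \<Longrightarrow> \<pi> (\<iota> x) = x"
    unfolding projective_module_def by blast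
  interpret Q: left_module B Q by fact
  interpret F: left_module B "free_module B I" by (rule B.A.free_left_module)
  interpret \<iota>: linear_hom B Q "free_module B I" \<iota> by (rule linear_homI [OF Q F.left_module_axioms \<iota>])
  interpret \<pi>: linear_hom B "free_module B I" Q \<pi> by (rule linear_homI [OF F.left_module_axioms Q \<pi>])
  define D where "D x = (\<lambda>i. d (x i))" for x :: "'q \<Rightarrow> 'b"
  have Dc: "D x \<in> carrier (free_module B I)" if "x \<in> carrier (free_module B I)" for x
    using that by (auto simp: D_def free_module_carrier elim!: finite_subset [rotated])
  have Da: "D (x \<oplus>\<^bsub>free_module B I\<^esub> y) = D x \<oplus>\<^bsub>free_module B I\<^esub> D y"
    if "x \<in> carrier (free_module B I)" "y \<in> carrier (free_module B I)" for x y
    using that by (auto simp: D_def free_module_carrier free_module_simps)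
  have Ds: "D (b \<odot>\<^bsub>free_module B I\<^esub> x) =
      d b \<odot>\<^bsub>free_module B I\<^esub> x \<oplus>\<^bsub>free_module B I\<^esub> b \<odot>\<^bsub>free_module B I\<^esub> D x"
    if "b \<in> carrier B" "x \<in> carrier (free_module B I)" for b x
    using that by (auto simp: D_def free_module_carrier free_module_simps d_mult)
  have leib: "\<pi> (D (\<iota> (b \<odot>\<^bsub>Q\<^esub> q))) = d b \<odot>\<^bsub>Q\<^esub> q \<oplus>\<^bsub>Q\<^esub> b \<odot>\<^bsub>Q\<^esub> \<pi> (D (\<iota> q))"
    if "b \<in> carrier B" "q \<in> carrier Q" for b q
    using that by (simp add: Ds Dc \<pi>\<iota>)
  have "d_operator k B d Q (\<lambda>q. \<pi> (D (\<iota> q)))"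
    unfolding d_operator_def
  proof (intro conjI ballI linear_mapI)
    fix r x assume "r \<in> carrier k" "x \<in> carrier (restrict_scalars B Q)"
    then show "\<pi> (D (\<iota> (r \<odot>\<^bsub>restrict_scalars B Q\<^esub> x))) = r \<odot>\<^bsub>restrict_scalars B Q\<^esub> \<pi> (D (\<iota> x))"
      \<comment> \<open>By \<open>d_one\<close>, multiples of the unit have derivative zero, and the
        Leibniz rule turns into \<open>k\<close>-linearity.\<close>
      using leib [of "r \<odot>\<^bsub>B\<^esub> \<one>\<^bsub>B\<^esub>" x] by (simp add: d_one Dc)
  qed (simp_all add: Da Dc leib del: \<iota>.f_smult)
  then show ?thesis by blast
qed

lemma d_operatorD:
  assumes "d_operator k B d M f"
  shows d_operator_closed: "x \<in> carrier M \<Longrightarrow> f x \<in> carrier M"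
    and d_operator_add: "\<lbrakk>x \<in> carrier M; y \<in> carrier M\<rbrakk> \<Longrightarrow> f (x \<oplus>\<^bsub>M\<^esub> y) = f x \<oplus>\<^bsub>M\<^esub> f y"
    and d_operator_scalar: "\<lbrakk>r \<in> carrier k; x \<in> carrier M\<rbrakk> \<Longrightarrow>
       f ((r \<odot>\<^bsub>B\<^esub> \<one>\<^bsub>B\<^esub>) \<odot>\<^bsub>M\<^esub> x) = (r \<odot>\<^bsub>B\<^esub> \<one>\<^bsub>B\<^esub>) \<odot>\<^bsub>M\<^esub> f x"
    and d_operator_leibniz: "\<lbrakk>b \<in> carrier B; x \<in> carrier M\<rbrakk> \<Longrightarrow>
       f (b \<odot>\<^bsub>M\<^esub> x) = d b \<odot>\<^bsub>M\<^esub> x \<oplus>\<^bsub>M\<^esub> b \<odot>\<^bsub>M\<^esub> f x"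
  using assms by (auto simp: d_operator_def linear_map_def)

lemma d_operator_zero:
  assumes "left_module B M" "d_operator k B d M f" shows "f \<zero>\<^bsub>M\<^esub> = \<zero>\<^bsub>M\<^esub>"
proof -
  interpret left_module B M by fact
  show ?thesis using d_operatorD(2) [OF assms(2), of "\<zero>\<^bsub>M\<^esub>" "\<zero>\<^bsub>M\<^esub>"] d_operatorD(1) [OF assms(2), of "\<zero>\<^bsub>M\<^esub>"]
    by (metis M.add.r_cancel_one' M.zero_closed M.l_zero)
qed

text \<open>Both composites obey a Leibniz rule with the same extra term \<open>d b\<close> times
  \<open>h x\<close>, which cancels in the difference. The role of \<open>h\<close> is taken by
  differentials and augmentations, by comparison maps and by cochains.\<close>

lemma d_operator_defect_linear:
  assumes M: "left_module B M" and N: "left_module B N" and f: "d_operator k B d M f"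
    and g: "d_operator k B d N g" and h: "linear_map B M N h"
  shows "linear_map B M N (\<lambda>x. g (h x) \<ominus>\<^bsub>N\<^esub> h (f x))"
proof -
  interpret h: linear_hom B M N h by (rule linear_homI [OF M N h])
  note f' = d_operatorD [OF f] and g' = d_operatorD [OF g]
  show ?thesis
  proof (rule linear_mapI)
    fix b x assume b: "b \<in> carrier B" and x: "x \<in> carrier M"
    have "u \<oplus>\<^bsub>N\<^esub> v \<ominus>\<^bsub>N\<^esub> (u \<oplus>\<^bsub>N\<^esub> w) = v \<ominus>\<^bsub>N\<^esub> w"
      if "u \<in> carrier N" "v \<in> carrier N" "w \<in> carrier N" for u v w
    proof -
      have "u \<oplus>\<^bsub>N\<^esub> v \<ominus>\<^bsub>N\<^esub> (u \<oplus>\<^bsub>N\<^esub> w) = v \<oplus>\<^bsub>N\<^esub> (u \<oplus>\<^bsub>N\<^esub> (\<ominus>\<^bsub>N\<^esub> u \<oplus>\<^bsub>N\<^esub> \<ominus>\<^bsub>N\<^esub> w))"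
        using that by (simp add: h.N.M.minus_eq h.N.M.minus_add h.N.M.a_ac)
      also have "\<dots> = v \<ominus>\<^bsub>N\<^esub> w" using that by (simp add: h.N.M.r_neg2 h.N.M.minus_eq)
      finally show ?thesis .
    qed
    then show "g (h (b \<odot>\<^bsub>M\<^esub> x)) \<ominus>\<^bsub>N\<^esub> h (f (b \<odot>\<^bsub>M\<^esub> x)) = b \<odot>\<^bsub>N\<^esub> (g (h x) \<ominus>\<^bsub>N\<^esub> h (f x))"
      using b x f' g' by (simp add: h.N.M.minus_eq h.N.lsmult_r_distr h.N.lsmult_r_minus)
  qed (use f' g' in \<open>simp_all add: h.N.M.minus_eq h.N.M.minus_add h.N.M.a_ac\<close>)
qed

lemma d_operator_plus_linear:
  assumes M: "left_module B M" and f: "d_operator k B d M f" and h: "linear_map B M M h"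
  shows "d_operator k B d M (\<lambda>x. f x \<oplus>\<^bsub>M\<^esub> h x)"
proof -
  interpret h: linear_hom B M M h by (rule linear_homI [OF M M h])
  note f' = d_operatorD [OF f]
  show ?thesis unfolding d_operator_def
    by (intro conjI ballI linear_mapI) (simp_all add: f' d_one h.M.M.a_ac h.M.lsmult_r_distr)
qed

text \<open>The instance of \<open>lifting_exists\<close> in which admissible means being a
  \<open>d\<close>-operator; its defects are linear by
  \<open>d_operator_defect_linear\<close>.\<close>

lemma d_lifting_exists:
  assumes res: "projective_resolution B M P dP \<epsilon>" and f: "d_operator k B d M f"
  shows "\<exists>fs. d_lifting k B d P dP \<epsilon> f fs"
proof -
  interpret two_resolutions B M P dP \<epsilon> P dP \<epsilon> by (simp add: two_resolutions_def resolution_def res)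
  note mods = P.P_module P.M_module
  show ?thesis unfolding d_lifting_def
  proof (rule lifting_exists [where adm = "\<lambda>n. d_operator k B d (P n)"])
    show "\<exists>t. d_operator k B d (P n) t" for n by (rule projective_d_operator [OF P.P_projective])
    show "f \<zero>\<^bsub>M\<^esub> = \<zero>\<^bsub>M\<^esub>" by (rule d_operator_zero [OF P.M_module f])
    show "f \<in> carrier M \<rightarrow> carrier M" using d_operatorD(1) [OF f] by auto
  qed (auto intro: d_operator_plus_linear [OF P.P_module] d_operatorD(1) d_operator_zero [OF P.P_module]
      d_operator_defect_linear P.P_module P.M_module P.d_linear P.eps_linear f)
qed

text \<open>With \<phi> in the role of \<open>h\<close>, \<open>d_operator_defect_linear\<close>
  makes the values of \<open>sharp\<close> linear over \<open>B\<close>. Commutation with the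
  differential is that of the lifting.\<close>

lemma sharp_cochain_map:
  assumes "algebra_resolution k B M P dP \<epsilon>" and f: "d_operator k B d M f"
    and fs: "d_lifting k B d P dP \<epsilon> f fs"
  shows "cochain_map k (hom_complex B P M) (hom_diff P dP) (hom_complex B P M) (hom_diff P dP)
      (sharp P M f fs)"
proof -
  interpret algebra_resolution k B M P dP \<epsilon> by fact
  note f' = d_operatorD [OF f]
  have fsn: "d_operator k B d (P n) (fs n)" for n using fs by (simp add: d_lifting_def)
  note fs' = d_operatorD [OF fsn]
  show ?thesis unfolding cochain_map_def
  proof (intro allI conjI ballI)
    fix n
    show "linear_map k (H n) (H n) (sharp P M f fs n)"
    proof (rule linear_mapI)
      fix \<phi> assume "\<phi> \<in> carrier (H n)"
      then show "sharp P M f fs n \<phi> \<in> carrier (H n)"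
        using d_operator_defect_linear [OF P_module M_module fsn f, of n \<phi>]
        by (simp add: hom_complex_carrier sharp_def linear_map_restrict [OF P_module])
    next
      fix \<phi> \<psi> assume "\<phi> \<in> carrier (H n)" "\<psi> \<in> carrier (H n)"
      then have l: "linear_map B (P n) M \<phi>" "linear_map B (P n) M \<psi>" by (auto simp: hom_complex_carrier)
      note c = linear_map_closed [OF l(1)] linear_map_closed [OF l(2)]
      show "sharp P M f fs n (\<phi> \<oplus>\<^bsub>H n\<^esub> \<psi>) = sharp P M f fs n \<phi> \<oplus>\<^bsub>H n\<^esub> sharp P M f fs n \<psi>"
        using c fs'(1) f'(1,2)
        by (auto simp: hom_complex_simps sharp_def M.M.minus_eq M.M.minus_add M.M.a_ac intro!: restrict_ext)
    next
      fix r \<phi> assume r: "r \<in> carrier k" and "\<phi> \<in> carrier (H n)"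
      then have l: "linear_map B (P n) M \<phi>" by (auto simp: hom_complex_carrier)
      show "sharp P M f fs n (r \<odot>\<^bsub>H n\<^esub> \<phi>) = r \<odot>\<^bsub>H n\<^esub> sharp P M f fs n \<phi>"
        using r linear_map_closed [OF l] fs'(1) f'(1,3)
        by (auto simp: hom_complex_simps sharp_def M.M.minus_eq M.lsmult_r_distr M.lsmult_r_minus intro!: restrict_ext)
    qed
    fix \<phi> assume "\<phi> \<in> carrier (H n)"
    then have l: "linear_map B (P n) M \<phi>" by (auto simp: hom_complex_carrier)
    show "sharp P M f fs (Suc n) (hom_diff P dP n \<phi>) = hom_diff P dP n (sharp P M f fs n \<phi>)"
      using fs fs'(1) by (auto simp: hom_diff_def sharp_def d_lifting_def intro!: restrict_ext)
  qed
qed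

end

section \<open>The enveloping algebra\<close>

lemma opposite_algebra_simps [simp]:
  "carrier (opposite_algebra A) = carrier A"
  "add (opposite_algebra A) = add A"
  "zero (opposite_algebra A) = zero A"
  "smult (opposite_algebra A) = smult A"
  "one (opposite_algebra A) = one A"
  "x \<otimes>\<^bsub>opposite_algebra A\<^esub> y = y \<otimes>\<^bsub>A\<^esub> x"
  by (simp_all add: opposite_algebra_def)

lemma left_module_same:
  assumes "left_module R M" "carrier N = carrier M" "add N = add M" "zero N = zero M" "smult N = smult M"
  shows "left_module R N"
proof -
  interpret left_module R M by fact
  show ?thesis
  proof (rule left_moduleI)
    show "abelian_group N"
    proof (rule abelian_groupI)
      fix x assume "x \<in> carrier N"
      then show "\<exists>y\<in>carrier N. y \<oplus>\<^bsub>N\<^esub> x = \<zero>\<^bsub>N\<^esub>"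
        by (intro bexI [where x = "\<ominus>\<^bsub>M\<^esub> x"]) (auto simp: assms(2-) M.l_neg)
    qed (auto simp: assms(2-) M.a_ac)
  qed (auto simp: assms(2-) R.ring_axioms lsmult_l_distr lsmult_r_distr lsmult_assoc)
qed

locale hoch =
  fixes k :: "('k, 'x) ring_scheme" and A :: "('k, 'a) module" (structure)
  assumes k_cring: "cring k" and A_algebra: "assoc_algebra k A"
begin

sublocale A: assoc_algebra k A by (rule A_algebra)

lemma A_module: "left_module k A"
  by (rule module_imp_left_module) (rule A.module_axioms)

sublocale AM: left_module k A by (rule A_module)

lemma op_module: "left_module k (opposite_algebra A)"
  by (rule left_module_same [OF A_module]) simp_all

lemma linear_map_op_dom [simp]: "linear_map k (opposite_algebra A) N f \<longleftrightarrow> linear_map k A N f"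
  by (simp add: linear_map_def)

lemma mult_left_linear: "a \<in> carrier A \<Longrightarrow> linear_map k A A (\<lambda>x. a \<otimes> x)"
  by (rule linear_mapI) (simp_all add: A.A.r_distr A.smult_mult_right)

lemma mult_right_linear: "a \<in> carrier A \<Longrightarrow> linear_map k A A (\<lambda>x. x \<otimes> a)"
  by (rule linear_mapI) (simp_all add: A.A.l_distr A.smult_mult_left)

abbreviation "AA \<equiv> [A, opposite_algebra A]"
abbreviation "T2 \<equiv> tensor k AA"
abbreviation "t a b \<equiv> pure_tensor k AA [a, b]"
abbreviation "E \<equiv> enveloping_algebra k A"

sublocale T2: tensor_factors k AA
  using A_module op_module k_cring by (auto simp: tensor_factors_def)

lemma E_simps:
  "carrier E = carrier T2" "add E = add T2" "zero E = zero T2" "smult E = smult T2"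
  "one E = t \<one> \<one>"
  by (simp_all add: enveloping_algebra_def tensor_algebra_def)

lemma E_linear_dom: "linear_map k E N f \<longleftrightarrow> linear_map k T2 N f"
  and E_linear_cod: "linear_map k N' E h \<longleftrightarrow> linear_map k N' T2 h"
  by (simp_all add: linear_map_def E_simps)

lemma E_left_module: "left_module k E"
  by (rule left_module_same [OF T2.T.left_module_axioms]) (simp_all add: E_simps)

sublocale EM: left_module k E by (rule E_left_module)

lemma t_closed [simp, intro]: "\<lbrakk>a \<in> carrier A; b \<in> carrier A\<rbrakk> \<Longrightarrow> t a b \<in> carrier E"
  by (simp add: E_simps tuples_pair)

lemma t_linear_left: "b \<in> carrier A \<Longrightarrow> linear_map k A E (\<lambda>a. t a b)"
  using multilinear_linear [OF T2.pure_multilinear, of "[\<zero>, b]" 0]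
  by (simp add: tuples_pair E_linear_cod)

lemma t_linear_right: "a \<in> carrier A \<Longrightarrow> linear_map k A E (\<lambda>b. t a b)"
  using multilinear_linear [OF T2.pure_multilinear, of "[a, \<zero>]" 1]
  by (simp add: tuples_pair E_linear_cod)

lemma E_induct [consumes 1, case_names pure add smult]:
  assumes "u \<in> carrier E"
    and "\<And>a b. \<lbrakk>a \<in> carrier A; b \<in> carrier A\<rbrakk> \<Longrightarrow> Q (t a b)"
    and "\<And>u v. \<lbrakk>u \<in> carrier E; v \<in> carrier E; Q u; Q v\<rbrakk> \<Longrightarrow> Q (u \<oplus>\<^bsub>E\<^esub> v)"
    and "\<And>r u. \<lbrakk>r \<in> carrier k; u \<in> carrier E; Q u\<rbrakk> \<Longrightarrow> Q (r \<odot>\<^bsub>E\<^esub> u)"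
  shows "Q u"
  using assms(1) unfolding E_simps
  by (induct rule: T2.tensor_induct) (use assms(2-) in \<open>auto simp: E_simps tuples_pair\<close>)

lemma E_maps_eq:
  assumes f: "linear_map k E N f" and g: "linear_map k E N g"
    and eq: "\<And>a b. \<lbrakk>a \<in> carrier A; b \<in> carrier A\<rbrakk> \<Longrightarrow> f (t a b) = g (t a b)"
    and u: "u \<in> carrier E"
  shows "f u = g u"
  using u by (induct rule: E_induct)
    (simp_all only: eq linear_map_add [OF f] linear_map_add [OF g]
      linear_map_smult [OF f] linear_map_smult [OF g])

lemma E_lift:
  assumes N: "left_module k N"
    and "\<And>a. a \<in> carrier A \<Longrightarrow> linear_map k A N (\<lambda>b. g [a, b])"
    and "\<And>b. b \<in> carrier A \<Longrightarrow> linear_map k A N (\<lambda>a. g [a, b])"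
  shows E_lift_linear: "linear_map k E N (tensor_lift k N g)"
    and E_lift_pure: "\<lbrakk>a \<in> carrier A; b \<in> carrier A\<rbrakk> \<Longrightarrow> tensor_lift k N g (t a b) = g [a, b]"
proof -
  have g: "multilinear k AA N g" by (rule multilinear_pairI) (simp_all add: assms)
  show "linear_map k E N (tensor_lift k N g)"
    using T2.tensor_lift_linear [OF N g] by (simp add: E_linear_dom)
  show "\<lbrakk>a \<in> carrier A; b \<in> carrier A\<rbrakk> \<Longrightarrow> tensor_lift k N g (t a b) = g [a, b]"
    by (rule T2.tensor_lift_pure [OF N g]) (simp add: tuples_pair)
qed

subsection \<open>The algebra structure\<close>

abbreviation "mult_tuple l m \<equiv>
  pure_tensor k AA (map (\<lambda>i. l ! i \<otimes>\<^bsub>AA ! i\<^esub> m ! i) [0..<length AA])"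

sublocale mu: tensor_bilinear k AA AA T2 mult_tuple
proof (intro_locales, rule tensor_bilinear_axioms.intro)
  fix m assume "m \<in> tuples AA"
  then obtain c e where m: "c \<in> carrier A" "e \<in> carrier A" "m = [c, e]" by (auto simp: tuples_pair)
  show "multilinear k AA T2 (\<lambda>l. mult_tuple l m)"
    by (rule multilinear_pairI)
      (use m linear_map_comp [OF mult_right_linear t_linear_left] linear_map_comp [OF mult_left_linear t_linear_right]
       in \<open>simp_all add: upt_rec E_linear_cod\<close>)
next
  fix l assume "l \<in> tuples AA"
  then obtain a b where l: "a \<in> carrier A" "b \<in> carrier A" "l = [a, b]" by (auto simp: tuples_pair)
  show "multilinear k AA T2 (mult_tuple l)"
    by (rule multilinear_pairI)
      (use l linear_map_comp [OF mult_left_linear t_linear_left] linear_map_comp [OF mult_right_linear t_linear_right]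
       in \<open>simp_all add: upt_rec E_linear_cod\<close>)
qed

lemma E_mult: "X \<otimes>\<^bsub>E\<^esub> Y = mu.B X Y"
  by (simp add: enveloping_algebra_def tensor_algebra_def)

lemma E_mult_linear_left: "Y \<in> carrier E \<Longrightarrow> linear_map k E E (\<lambda>X. X \<otimes>\<^bsub>E\<^esub> Y)"
  using mu.linear_left [of Y] by (simp add: E_mult E_linear_dom E_linear_cod) (simp add: E_simps)

lemma E_mult_linear_right: "X \<in> carrier E \<Longrightarrow> linear_map k E E (\<lambda>Y. X \<otimes>\<^bsub>E\<^esub> Y)"
  using mu.linear_right [of X] by (simp add: E_mult E_linear_dom E_linear_cod) (simp add: E_simps)

text \<open>The order \<open>e \<otimes> b\<close> reflects that second factors are multiplied in
  the opposite algebra.\<close>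

lemma t_mult: "\<lbrakk>a \<in> carrier A; b \<in> carrier A; c \<in> carrier A; e \<in> carrier A\<rbrakk> \<Longrightarrow>
    t a b \<otimes>\<^bsub>E\<^esub> t c e = t (a \<otimes> c) (e \<otimes> b)"
  using mu.pure_pure [of "[a, b]" "[c, e]"] unfolding E_mult by (simp add: tuples_pair upt_rec)

lemma E_mult_closed: "\<lbrakk>X \<in> carrier E; Y \<in> carrier E\<rbrakk> \<Longrightarrow> X \<otimes>\<^bsub>E\<^esub> Y \<in> carrier E"
  by (rule linear_map_closed [OF E_mult_linear_left])

text \<open>Both sides are linear in each argument, so pure tensors can be substituted one argument
  at a time.\<close>

lemma E_assoc:
  assumes X: "X \<in> carrier E" and Y: "Y \<in> carrier E" and Z: "Z \<in> carrier E"
  shows "X \<otimes>\<^bsub>E\<^esub> Y \<otimes>\<^bsub>E\<^esub> Z = X \<otimes>\<^bsub>E\<^esub> (Y \<otimes>\<^bsub>E\<^esub> Z)"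
proof -
  note L = E_mult_linear_left and R = E_mult_linear_right and C = E_mult_closed
  have 1: "t a b \<otimes>\<^bsub>E\<^esub> t c e \<otimes>\<^bsub>E\<^esub> Z = t a b \<otimes>\<^bsub>E\<^esub> (t c e \<otimes>\<^bsub>E\<^esub> Z)"
    if "a \<in> carrier A" "b \<in> carrier A" "c \<in> carrier A" "e \<in> carrier A" for a b c e
    by (rule E_maps_eq [OF R linear_map_comp [OF R R] _ Z])
      (use that in \<open>auto simp: t_mult A.A.m_assoc intro: C\<close>)
  have 2: "t a b \<otimes>\<^bsub>E\<^esub> Y \<otimes>\<^bsub>E\<^esub> Z = t a b \<otimes>\<^bsub>E\<^esub> (Y \<otimes>\<^bsub>E\<^esub> Z)"
    if "a \<in> carrier A" "b \<in> carrier A" for a b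
    by (rule E_maps_eq [OF linear_map_comp [OF R L] linear_map_comp [OF L R] _ Y])
      (use that Z in \<open>auto simp: 1\<close>)
  show ?thesis
    by (rule E_maps_eq [OF linear_map_comp [OF L L] L _ X]) (use Y Z in \<open>auto simp: 2 intro: C\<close>)
qed

lemma E_algebra: "assoc_algebra k E"
proof (intro assoc_algebra.intro assoc_algebra_axioms.intro)
  note L = E_mult_linear_left and R = E_mult_linear_right and C = E_mult_closed
  have 1: "\<one>\<^bsub>E\<^esub> \<in> carrier E" by (simp add: E_simps(5))
  show "module k E" by (rule left_module_imp_module [OF k_cring E_left_module])
  show "ring E"
  proof (rule ringI)
    show "abelian_group E" by (rule EM.M.abelian_group_axioms)
    show "monoid E"
    proof (rule monoidI)
      fix X assume X: "X \<in> carrier E"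
      show "\<one>\<^bsub>E\<^esub> \<otimes>\<^bsub>E\<^esub> X = X"
        by (rule E_maps_eq [OF R [OF 1] linear_map_id _ X]) (simp add: E_simps(5) t_mult)
      show "X \<otimes>\<^bsub>E\<^esub> \<one>\<^bsub>E\<^esub> = X"
        by (rule E_maps_eq [OF L [OF 1] linear_map_id _ X]) (simp add: E_simps(5) t_mult)
    qed (simp_all add: C 1 E_assoc)
  qed (auto simp: linear_map_add [OF L] linear_map_add [OF R])
qed (auto simp: linear_map_smult [OF E_mult_linear_left] linear_map_smult [OF E_mult_linear_right])

sublocale E: assoc_algebra k E by (rule E_algebra)

subsection \<open>Modules over the enveloping algebra\<close>

text \<open>Bimodule laws need checking on pure tensors only. \<open>K\<close> is the intended
  underlying \<open>k\<close>-module, and the second conclusion confirms that restricting scalars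
  along the enveloping algebra gives its scalar action back.\<close>

lemma env_left_moduleI:
  fixes N :: "(('a list \<Rightarrow> 'k) set, 'n) module" and K :: "('k, 'n) module"
  assumes K: "left_module k K" and same: "carrier K = carrier N" "add K = add N" "zero K = zero N"
    and lin_u: "\<And>x. x \<in> carrier N \<Longrightarrow> linear_map k E K (\<lambda>u. u \<odot>\<^bsub>N\<^esub> x)"
    and lin_x: "\<And>a b. \<lbrakk>a \<in> carrier A; b \<in> carrier A\<rbrakk> \<Longrightarrow> linear_map k K K (\<lambda>x. t a b \<odot>\<^bsub>N\<^esub> x)"
    and act: "\<And>a b c e x. \<lbrakk>a \<in> carrier A; b \<in> carrier A; c \<in> carrier A; e \<in> carrier A; x \<in> carrier N\<rbrakk> \<Longrightarrow>
       t a b \<odot>\<^bsub>N\<^esub> (t c e \<odot>\<^bsub>N\<^esub> x) = t (a \<otimes> c) (e \<otimes> b) \<odot>\<^bsub>N\<^esub> x"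
    and one: "\<And>x. x \<in> carrier N \<Longrightarrow> t \<one> \<one> \<odot>\<^bsub>N\<^esub> x = x"
  shows env_left_module: "left_module E N"
    and env_scalar: "\<lbrakk>r \<in> carrier k; x \<in> carrier N\<rbrakk> \<Longrightarrow> (r \<odot>\<^bsub>E\<^esub> \<one>\<^bsub>E\<^esub>) \<odot>\<^bsub>N\<^esub> x = r \<odot>\<^bsub>K\<^esub> x"
proof -
  interpret K: left_module k K by fact
  note S = same [symmetric]
  have cl: "u \<odot>\<^bsub>N\<^esub> x \<in> carrier K" if "u \<in> carrier E" "x \<in> carrier K" for u x
    using linear_map_closed [OF lin_u that(1)] that by (simp add: S)
  \<comment> \<open>Linearity in \<open>x\<close> is given for pure tensors; induction over the
    enveloping algebra extends it to every \<open>u\<close>.\<close>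
  have LX: "linear_map k K K (\<lambda>x. u \<odot>\<^bsub>N\<^esub> x)" if "u \<in> carrier E" for u
    using that
  proof (induct rule: E_induct)
    case (add u v)
    show ?case
      using linear_map_plus_map [OF K add(3,4)] add(1,2) linear_map_add [OF lin_u]
      by (subst linear_map_cong [OF _ K]) (auto simp: S)
  next
    case (smult r u)
    have "linear_map k K K (\<lambda>x. r \<odot>\<^bsub>K\<^esub> x)"
      by (rule linear_mapI) (simp_all add: smult K.lsmult_r_distr K.lsmult_assoc [symmetric] A.R.m_comm)
    from linear_map_comp [OF smult(3) this] show ?case
      using smult(1,2) linear_map_smult [OF lin_u]
      by (subst linear_map_cong [OF _ K]) (auto simp: S)
  qed (rule lin_x)
  have 1: "t a b \<odot>\<^bsub>N\<^esub> (v \<odot>\<^bsub>N\<^esub> x) = (t a b \<otimes>\<^bsub>E\<^esub> v) \<odot>\<^bsub>N\<^esub> x"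
    if "a \<in> carrier A" "b \<in> carrier A" "v \<in> carrier E" "x \<in> carrier K" for a b v x
    by (rule E_maps_eq [OF linear_map_comp [OF lin_u LX] linear_map_comp [OF E_mult_linear_right lin_u] _ that(3)])
      (use that in \<open>auto simp: S act t_mult\<close>)
  have assoc: "u \<odot>\<^bsub>N\<^esub> (v \<odot>\<^bsub>N\<^esub> x) = (u \<otimes>\<^bsub>E\<^esub> v) \<odot>\<^bsub>N\<^esub> x"
    if "u \<in> carrier E" "v \<in> carrier E" "x \<in> carrier K" for u v x
    by (rule E_maps_eq [OF lin_u linear_map_comp [OF E_mult_linear_left lin_u] _ that(1)])
      (use that cl in \<open>auto simp: S 1\<close>)
  show "left_module E N"
  proof (rule left_moduleI)
    show "ring E" by (rule E.A.ring_axioms)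
    show "abelian_group N"
    proof (rule abelian_groupI)
      fix x assume "x \<in> carrier N"
      then show "\<exists>y\<in>carrier N. y \<oplus>\<^bsub>N\<^esub> x = \<zero>\<^bsub>N\<^esub>"
        by (intro bexI [where x = "\<ominus>\<^bsub>K\<^esub> x"]) (auto simp: S K.M.l_neg)
    qed (auto simp: S K.M.a_ac)
  qed (use linear_map_add [OF LX] linear_map_add [OF lin_u] cl one in \<open>auto simp: S assoc E_simps(5)\<close>)
  show "\<lbrakk>r \<in> carrier k; x \<in> carrier N\<rbrakk> \<Longrightarrow> (r \<odot>\<^bsub>E\<^esub> \<one>\<^bsub>E\<^esub>) \<odot>\<^bsub>N\<^esub> x = r \<odot>\<^bsub>K\<^esub> x"
    using linear_map_smult [OF lin_u] one E.A.one_closed by (simp add: E_simps(5))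
qed

text \<open>Induction over the first argument of the action: sums are covered by additivity of
  \<open>f\<close>, multiples by its compatibility with the multiples of the unit.\<close>

lemma env_linearI:
  assumes N: "left_module E N" and N': "left_module E N'"
    and f: "linear_map k (restrict_scalars E N) (restrict_scalars E N') f"
    and pure: "\<And>a b x. \<lbrakk>a \<in> carrier A; b \<in> carrier A; x \<in> carrier N\<rbrakk> \<Longrightarrow>
      f (t a b \<odot>\<^bsub>N\<^esub> x) = t a b \<odot>\<^bsub>N'\<^esub> f x"
  shows "linear_map E N N' f"
proof -
  interpret N: left_module E N by fact
  interpret N': left_module E N' by fact
  interpret N: algebra_module k E N by (rule algebra_moduleI [OF E_algebra N])
  interpret N': algebra_module k E N' by (rule algebra_moduleI [OF E_algebra N'])
  have cl: "f x \<in> carrier N'" and ad: "f (x \<oplus>\<^bsub>N\<^esub> y) = f x \<oplus>\<^bsub>N'\<^esub> f y"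
    and sm: "r \<in> carrier k \<Longrightarrow> f ((r \<odot>\<^bsub>E\<^esub> \<one>\<^bsub>E\<^esub>) \<odot>\<^bsub>N\<^esub> x) = (r \<odot>\<^bsub>E\<^esub> \<one>\<^bsub>E\<^esub>) \<odot>\<^bsub>N'\<^esub> f x"
    if "x \<in> carrier N" "y \<in> carrier N" for x y r
    using f that by (auto simp: linear_map_def)
  show ?thesis
  proof (rule linear_mapI)
    fix u x assume "u \<in> carrier E" and x: "x \<in> carrier N"
    then show "f (u \<odot>\<^bsub>N\<^esub> x) = u \<odot>\<^bsub>N'\<^esub> f x"
    proof (induct rule: E_induct)
      case (add u v) then show ?case using x cl [OF x x]
        by (simp add: N.lsmult_l_distr N'.lsmult_l_distr ad)
    next
      case (smult r u) then show ?case using x cl [OF x x] sm [of "u \<odot>\<^bsub>N\<^esub> x" "u \<odot>\<^bsub>N\<^esub> x" r]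
        by (simp add: N.scalar_smult N'.scalar_smult)
    qed (use x pure in auto)
  qed (use cl ad in auto)
qed

end

locale hoch_der = hoch k A for k :: "('k, 'x) ring_scheme" and A :: "('k, 'a) module" (structure) +
  fixes \<delta>
  assumes \<delta>: "derivation k A \<delta>"
begin

sublocale \<delta>: algebra_derivation k A \<delta>
  by (simp add: algebra_derivation_def algebra_derivation_axioms_def A_algebra \<delta>)

abbreviation "\<delta>e \<equiv> enveloping_derivation k A \<delta>"

lemma de_linear: "linear_map k E E \<delta>e"
  and de_pure: "\<lbrakk>a \<in> carrier A; b \<in> carrier A\<rbrakk> \<Longrightarrow> \<delta>e (t a b) = t (\<delta> a) b \<oplus>\<^bsub>E\<^esub> t a (\<delta> b)"
proof -
  note T = T2.T.left_module_axioms
  have 1: "linear_map k A T2 (\<lambda>b. pure_tensor k AA (map2 (\<lambda>f x. f x) [\<delta>, id] [a, b]))"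
     "linear_map k A T2 (\<lambda>b. pure_tensor k AA (map2 (\<lambda>f x. f x) [id, \<delta>] [a, b]))" if "a \<in> carrier A" for a
    using that t_linear_right [of "\<delta> a"] linear_map_comp [OF \<delta>.d.lin t_linear_right [OF that]]
    by (simp_all add: E_linear_cod)
  have 2: "linear_map k A T2 (\<lambda>a. pure_tensor k AA (map2 (\<lambda>f x. f x) [\<delta>, id] [a, b]))"
     "linear_map k A T2 (\<lambda>a. pure_tensor k AA (map2 (\<lambda>f x. f x) [id, \<delta>] [a, b]))" if "b \<in> carrier A" for b
    using that t_linear_left [of "\<delta> b"] linear_map_comp [OF \<delta>.d.lin t_linear_left [OF that]]
    by (simp_all add: E_linear_cod)
  let ?g = "\<lambda>l. pure_tensor k AA (map2 (\<lambda>f x. f x) [\<delta>, id] l)"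
  let ?h = "\<lambda>l. pure_tensor k AA (map2 (\<lambda>f x. f x) [id, \<delta>] l)"
  note L = E_lift_linear [where g = ?g, OF T 1(1) 2(1)] E_lift_linear [where g = ?h, OF T 1(2) 2(2)]
  show "linear_map k E E \<delta>e"
    using linear_map_plus_map [OF T L]
    by (simp add: enveloping_derivation_def [abs_def] tensor_map_def E_linear_cod E_simps)
  show "\<delta>e (t a b) = t (\<delta> a) b \<oplus>\<^bsub>E\<^esub> t a (\<delta> b)" if "a \<in> carrier A" "b \<in> carrier A"
    using that E_lift_pure [where g = ?g, OF T 1(1) 2(1)] E_lift_pure [where g = ?h, OF T 1(2) 2(2)]
    by (simp add: enveloping_derivation_def tensor_map_def)
qed

text \<open>On pure tensors the Leibniz rule of \<delta> is applied in each factor; in the opposite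
  factor its two summands trade places, which a sum does not notice. Linearity in each argument does
  the rest.\<close>

lemma de_derivation: "derivation k E \<delta>e"
  unfolding derivation_def
proof (intro conjI ballI)
  show lin: "linear_map k E E \<delta>e" by (rule de_linear)
  note L = E_mult_linear_left and R = E_mult_linear_right
  interpret de: linear_hom k E E \<delta>e by (rule linear_homI [OF E_left_module E_left_module lin])
  have 1: "\<delta>e (t a b \<otimes>\<^bsub>E\<^esub> t c e) = \<delta>e (t a b) \<otimes>\<^bsub>E\<^esub> t c e \<oplus>\<^bsub>E\<^esub> t a b \<otimes>\<^bsub>E\<^esub> \<delta>e (t c e)"
    if "a \<in> carrier A" "b \<in> carrier A" "c \<in> carrier A" "e \<in> carrier A" for a b c e
    using that
    by (simp add: t_mult de_pure \<delta>.d_mult E.A.l_distr E.A.r_distr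
        linear_map_add [OF t_linear_left] linear_map_add [OF t_linear_right] EM.M.a_ac)
  have 2: "\<delta>e (t a b \<otimes>\<^bsub>E\<^esub> v) = \<delta>e (t a b) \<otimes>\<^bsub>E\<^esub> v \<oplus>\<^bsub>E\<^esub> t a b \<otimes>\<^bsub>E\<^esub> \<delta>e v"
    if "a \<in> carrier A" "b \<in> carrier A" "v \<in> carrier E" for a b v
    by (rule E_maps_eq [OF linear_map_comp [OF R lin]
          linear_map_plus_map [OF E_left_module R linear_map_comp [OF lin R]] _ that(3)])
      (use that in \<open>auto simp: 1\<close>)
  fix u v assume u: "u \<in> carrier E" and v: "v \<in> carrier E"
  show "\<delta>e (u \<otimes>\<^bsub>E\<^esub> v) = \<delta>e u \<otimes>\<^bsub>E\<^esub> v \<oplus>\<^bsub>E\<^esub> u \<otimes>\<^bsub>E\<^esub> \<delta>e v"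
    by (rule E_maps_eq [OF linear_map_comp [OF L lin]
          linear_map_plus_map [OF E_left_module linear_map_comp [OF lin L] L] _ u])
      (use v in \<open>auto simp: 2\<close>)
qed

sublocale de: algebra_derivation k E \<delta>e
  by (simp add: algebra_derivation_def algebra_derivation_axioms_def E_algebra de_derivation)

lemma env_d_operatorI:
  assumes N: "left_module E N"
    and f: "linear_map k (restrict_scalars E N) (restrict_scalars E N) f"
    and pure: "\<And>a b x. \<lbrakk>a \<in> carrier A; b \<in> carrier A; x \<in> carrier N\<rbrakk> \<Longrightarrow>
      f (t a b \<odot>\<^bsub>N\<^esub> x) = \<delta>e (t a b) \<odot>\<^bsub>N\<^esub> x \<oplus>\<^bsub>N\<^esub> t a b \<odot>\<^bsub>N\<^esub> f x"
  shows "d_operator k E \<delta>e N f"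
  unfolding d_operator_def
proof (intro conjI ballI f)
  interpret N: algebra_module k E N by (rule algebra_moduleI [OF E_algebra N])
  have cl: "f x \<in> carrier N" and ad: "f (x \<oplus>\<^bsub>N\<^esub> y) = f x \<oplus>\<^bsub>N\<^esub> f y"
    and sm: "r \<in> carrier k \<Longrightarrow> f ((r \<odot>\<^bsub>E\<^esub> \<one>\<^bsub>E\<^esub>) \<odot>\<^bsub>N\<^esub> x) = (r \<odot>\<^bsub>E\<^esub> \<one>\<^bsub>E\<^esub>) \<odot>\<^bsub>N\<^esub> f x"
    if "x \<in> carrier N" "y \<in> carrier N" for x y r
    using f that by (auto simp: linear_map_def)
  fix u x assume "u \<in> carrier E" and x: "x \<in> carrier N"
  then show "f (u \<odot>\<^bsub>N\<^esub> x) = \<delta>e u \<odot>\<^bsub>N\<^esub> x \<oplus>\<^bsub>N\<^esub> u \<odot>\<^bsub>N\<^esub> f x"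
  proof (induct rule: E_induct)
    case (add u v) then show ?case using x cl [OF x x]
      by (simp add: N.M.lsmult_l_distr ad N.M.M.a_ac)
  next
    case (smult r u) then show ?case using x cl [OF x x] sm [of "u \<odot>\<^bsub>N\<^esub> x" "u \<odot>\<^bsub>N\<^esub> x" r]
      by (simp add: N.scalar_smult N.M.lsmult_r_distr)
  qed (use x pure in auto)
qed

end

context hoch
begin

subsection \<open>The regular bimodule\<close>

abbreviation "M \<equiv> enveloping_self_module k A"

lemma M_simps [simp]: "carrier M = carrier A" "add M = add A" "zero M = zero A"
  by (simp_all add: enveloping_self_module_def)

lemma M_act_linear: "x \<in> carrier A \<Longrightarrow> linear_map k E A (\<lambda>u. u \<odot>\<^bsub>M\<^esub> x)"
  and M_act [simp]: "\<lbrakk>a \<in> carrier A; b \<in> carrier A; x \<in> carrier A\<rbrakk> \<Longrightarrow>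
     t a b \<odot>\<^bsub>M\<^esub> x = a \<otimes> x \<otimes> b"
proof -
  have 1: "linear_map k A A (\<lambda>b. [a, b] ! 0 \<otimes> x \<otimes> [a, b] ! 1)"
    if "a \<in> carrier A" "x \<in> carrier A" for a x using that by (simp add: mult_left_linear)
  have 2: "linear_map k A A (\<lambda>a. [a, b] ! 0 \<otimes> x \<otimes> [a, b] ! 1)"
    if "b \<in> carrier A" "x \<in> carrier A" for b x
    using linear_map_comp [OF mult_right_linear mult_right_linear] that by simp
  note E = E_lift [OF A_module, of "\<lambda>l. l ! 0 \<otimes> x \<otimes> l ! 1" for x, OF 1 2]
  show "x \<in> carrier A \<Longrightarrow> linear_map k E A (\<lambda>u. u \<odot>\<^bsub>M\<^esub> x)"
    using E(1) [of x] by (simp add: enveloping_self_module_def)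
  show "\<lbrakk>a \<in> carrier A; b \<in> carrier A; x \<in> carrier A\<rbrakk> \<Longrightarrow> t a b \<odot>\<^bsub>M\<^esub> x = a \<otimes> x \<otimes> b"
    using E(2) [of x a b] by (simp add: enveloping_self_module_def)
qed

lemma M_left_module: "left_module E M"
  and M_scalar [simp]: "\<lbrakk>r \<in> carrier k; x \<in> carrier A\<rbrakk> \<Longrightarrow> (r \<odot>\<^bsub>E\<^esub> \<one>\<^bsub>E\<^esub>) \<odot>\<^bsub>M\<^esub> x = r \<odot> x"
proof -
  have L: "linear_map k A A (\<lambda>x. t a b \<odot>\<^bsub>M\<^esub> x)" if "a \<in> carrier A" "b \<in> carrier A" for a b
    using linear_map_comp [OF mult_left_linear mult_right_linear, OF that] that
    by (subst linear_map_cong [OF _ A_module]) auto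
  note I = env_left_moduleI [OF A_module, of M]
  show "left_module E M" by (rule I(1)) (simp_all add: M_act_linear L A.A.m_assoc)
  show "\<lbrakk>r \<in> carrier k; x \<in> carrier A\<rbrakk> \<Longrightarrow> (r \<odot>\<^bsub>E\<^esub> \<one>\<^bsub>E\<^esub>) \<odot>\<^bsub>M\<^esub> x = r \<odot> x"
    by (rule I(2)) (simp_all add: M_act_linear L A.A.m_assoc)
qed

sublocale M: algebra_module k E M by (rule algebra_moduleI [OF E_algebra M_left_module])

end

text \<open>The Leibniz rule for the threefold product \<open>a x b\<close>: the terms with \<delta>
  on \<open>a\<close> or \<open>b\<close> form the action of \<open>\<delta>e (t a b)\<close>, the
  middle one that of \<open>t a b\<close> on \<open>\<delta> x\<close>.\<close>

lemma (in hoch_der) M_d_operator: "d_operator k E \<delta>e M \<delta>"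
proof (rule env_d_operatorI [OF M_left_module])
  show "linear_map k (restrict_scalars E M) (restrict_scalars E M) \<delta>"
    using \<delta>.d.lin by (simp add: linear_map_def)
  fix a b x assume "a \<in> carrier A" "b \<in> carrier A" "x \<in> carrier M"
  then show "\<delta> (t a b \<odot>\<^bsub>M\<^esub> x) = \<delta>e (t a b) \<odot>\<^bsub>M\<^esub> x \<oplus>\<^bsub>M\<^esub> t a b \<odot>\<^bsub>M\<^esub> \<delta> x"
    by (simp add: de_pure \<delta>.d_mult linear_map_add [OF M_act_linear] A.A.l_distr A.A.r_distr A.M.a_ac)
qed

section \<open>The bar resolution\<close>

text \<open>Keeps tensor powers in the shape \<open>replicate n A\<close>, which the interpretations
  for tensor powers expect.\<close>

declare replicate_Suc [simp del]

section \<open>Words: merging adjacent letters, splitting sums at their ends\<close>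

lemma contract_length: "Suc i < length l \<Longrightarrow> length (contract A i l) = length l - 1"
  by (simp add: contract_def)

lemma contract_nth: "\<lbrakk>Suc i < length l; j < length l - 1\<rbrakk> \<Longrightarrow> contract A i l ! j =
    (if j < i then l ! j else if j = i then l ! i \<otimes>\<^bsub>A\<^esub> l ! Suc i else l ! Suc j)"
  by (auto simp: contract_def nth_append nth_Cons')

lemma contract_Cons: "contract A (Suc i) (x # l) = x # contract A i l"
  by (simp add: contract_def)

lemma contract_Cons_0: "contract A 0 (x # y # l) = (x \<otimes>\<^bsub>A\<^esub> y) # l"
  by (simp add: contract_def)

lemma contract_snoc: "Suc i < length l \<Longrightarrow> contract A i (l @ [y]) = contract A i l @ [y]"
  by (simp add: contract_def nth_append)

lemma contract_last: "contract A (length l) (l @ [x, y]) = l @ [x \<otimes>\<^bsub>A\<^esub> y]"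
  by (simp add: contract_def nth_append)

text \<open>Tells in which position of the merged word a changed letter ends up, and through which
  map: the identity away from \<open>i\<close> and \<open>Suc i\<close>, a multiplication at these
  two. This is the \<open>slot\<close> condition for faces.\<close>

lemma contract_update:
  assumes "Suc i < length l" "j < length l"
  shows "contract A i (l[j := x]) =
    (if j < i then (contract A i l)[j := x]
     else if j = i then (contract A i l)[i := x \<otimes>\<^bsub>A\<^esub> l ! Suc i]
     else if j = Suc i then (contract A i l)[i := l ! i \<otimes>\<^bsub>A\<^esub> x]
     else (contract A i l)[j - 1 := x])"
  using assms
  by (intro nth_equalityI) (auto simp: contract_length contract_nth nth_list_update)

lemma Cons_snoc_cases:
  assumes "length l = Suc (Suc n)"
  obtains x m y where "l = x # m @ [y]" "length m = n"
proof -
  obtain x l' where l: "l = x # l'" "length l' = Suc n" using assms by (auto simp: length_Suc_conv)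
  then have "l' = butlast l' @ [last l']" by (intro append_butlast_last_id [symmetric]) auto
  then show thesis using that [of x "butlast l'" "last l'"] l by simp
qed

lemma (in abelian_group) minus_zero_eq: "\<ominus> \<zero> = \<zero>"
  by (rule minus_equality) simp_all

context abelian_monoid
begin

lemma finsum_lessThan_Suc_shift:
  assumes "f \<in> {..<Suc n} \<rightarrow> carrier G"
  shows "finsum G f {..<Suc n} = f 0 \<oplus> finsum G (\<lambda>i. f (Suc i)) {..<n}"
proof -
  have "finsum G f (Suc ` {..<n}) = finsum G (\<lambda>i. f (Suc i)) {..<n}"
    by (rule add.finprod_reindex) (use assms in auto)
  then show ?thesis using assms
    by (simp add: lessThan_Suc_eq_insert_0 Pi_def)
qed

lemma finsum_lessThan_Suc:
  assumes "f \<in> {..<Suc n} \<rightarrow> carrier G"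
  shows "finsum G f {..<Suc n} = f n \<oplus> finsum G f {..<n}"
  using assms by (simp add: lessThan_Suc Pi_def)

text \<open>Separates the two summands that involve the outer letters of a bar word from those that
  involve only inner ones.\<close>

lemma finsum_ends:
  assumes "f \<in> {..<Suc (Suc n)} \<rightarrow> carrier G"
  shows "finsum G f {..<Suc (Suc n)} = f 0 \<oplus> (f (Suc n) \<oplus> finsum G (\<lambda>i. f (Suc i)) {..<n})"
proof -
  have "finsum G f {..<Suc (Suc n)} = f 0 \<oplus> finsum G (\<lambda>i. f (Suc i)) {..<Suc n}"
    by (rule finsum_lessThan_Suc_shift [OF assms])
  also have "finsum G (\<lambda>i. f (Suc i)) {..<Suc n} = f (Suc n) \<oplus> finsum G (\<lambda>i. f (Suc i)) {..<n}"
    by (rule finsum_lessThan_Suc) (use assms in auto)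
  finally show ?thesis .
qed

end

context hoch
begin

abbreviation "Tn n \<equiv> tensor_power k A n"
abbreviation "pe n \<equiv> power_elem k A n"
abbreviation "BT n \<equiv> Tn (Suc (Suc n))"
abbreviation "bp n \<equiv> pe (Suc (Suc n))"
abbreviation "words n \<equiv> {l. length l = n \<and> set l \<subseteq> carrier A}"

lemma Tn_factors: "tensor_factors k (replicate n A)"
  using A_module k_cring by (auto simp: tensor_factors_def)

sublocale Tn: tensor_factors k "replicate n A" for n by (rule Tn_factors)

lemma Tn_module: "left_module k (Tn n)"
  by (rule Tn.T.left_module_axioms)

lemma pe_closed [simp, intro]: "\<lbrakk>length l = n; set l \<subseteq> carrier A\<rbrakk> \<Longrightarrow> pe n l \<in> carrier (Tn n)"
  by (rule Tn.pure_closed) (simp add: tuples_replicate)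

lemma Tn_maps_eq:
  assumes "linear_map k (Tn n) N f" "linear_map k (Tn n) N g"
    and "\<And>l. l \<in> words n \<Longrightarrow> f (pe n l) = g (pe n l)" and "X \<in> carrier (Tn n)"
  shows "f X = g X"
  by (rule Tn.linear_maps_eq [OF assms(1,2) _ assms(4)]) (use assms(3) in \<open>simp add: tuples_replicate\<close>)

lemma words_pullback:
  assumes g: "multilinear k (replicate m A) N g"
    and T: "\<And>l. l \<in> words n \<Longrightarrow> T l \<in> words m"
    and slot: "\<And>l j. \<lbrakk>l \<in> words n; j < n\<rbrakk> \<Longrightarrow>
       \<exists>i<m. \<exists>f. linear_map k A A f \<and> (\<forall>x\<in>carrier A. T (l[j := x]) = (T l)[i := f x])"
  shows "multilinear k (replicate n A) N (\<lambda>l. g (T l))"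
  by (rule multilinear_pullback [OF g])
    (use T slot A_module in \<open>fastforce simp: tuples_replicate\<close>)+

lemma contract_words: "\<lbrakk>l \<in> words (Suc n); i < n\<rbrakk> \<Longrightarrow> contract A i l \<in> words n"
  by (auto simp: contract_def subset_iff dest!: in_set_takeD in_set_dropD)

lemma contract_multilinear:
  assumes g: "multilinear k (replicate n A) N g" and i: "i < n"
  shows "multilinear k (replicate (Suc n) A) N (\<lambda>l. g (contract A i l))"
proof (rule words_pullback [OF g contract_words])
  fix l j assume l: "l \<in> words (Suc n)" and j: "j < Suc n"
  have li: "l ! i \<in> carrier A" "l ! Suc i \<in> carrier A" using l i by (auto simp: subset_iff)
  consider "j < i" | "j = i" | "j = Suc i" | "Suc i < j" by linarith
  then show "\<exists>i'<n. \<exists>f. linear_map k A A f \<and>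
      (\<forall>x\<in>carrier A. contract A i (l[j := x]) = (contract A i l)[i' := f x])"
  proof cases
    case 1
    show ?thesis
      by (rule exI [where x = j], rule conjI, use 1 i in simp, rule exI, rule conjI, rule linear_map_id)
        (use 1 i l j in \<open>simp add: contract_update\<close>)
  next
    case 2
    show ?thesis
      by (rule exI [where x = i], rule conjI, use 2 i in simp, rule exI, rule conjI,
          rule mult_right_linear [OF li(2)])
        (use 2 i l j in \<open>simp add: contract_update\<close>)
  next
    case 3
    show ?thesis
      by (rule exI [where x = i], rule conjI, use 3 i in simp, rule exI, rule conjI,
          rule mult_left_linear [OF li(1)])
        (use 3 i l j in \<open>simp add: contract_update\<close>)
  next
    case 4
    show ?thesis
      by (rule exI [where x = "j - 1"], rule conjI, use 4 i j in simp, rule exI, rule conjI, rule linear_map_id)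
        (use 4 i l j in \<open>simp add: contract_update\<close>)
  qed
qed (use i in auto)

subsection \<open>Bar modules\<close>

abbreviation "bar \<equiv> bar_module k A"
abbreviation "bd \<equiv> bar_diff k A"
abbreviation "aug \<equiv> bar_augmentation k A"

lemma bar_simps [simp]:
  "carrier (bar n) = carrier (BT n)"
  "add (bar n) = add (BT n)"
  "zero (bar n) = zero (BT n)"
  by (simp_all add: bar_module_def Let_def)

text \<open>The action of \<open>t a b\<close> on a bar word. Bar words have at least two letters,
  so the two updates do not collide.\<close>

definition ends :: "'a \<Rightarrow> 'a \<Rightarrow> 'a list \<Rightarrow> 'a list" where
  "ends a b l = l[0 := a \<otimes> l ! 0, length l - 1 := l ! (length l - 1) \<otimes> b]"

lemma ends_Cons_snoc: "ends a b (x # m @ [y]) = (a \<otimes> x) # m @ [y \<otimes> b]"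
  by (simp add: ends_def list_update_append)

lemma ends_words: "\<lbrakk>l \<in> words (Suc (Suc n)); a \<in> carrier A; b \<in> carrier A\<rbrakk> \<Longrightarrow>
    ends a b l \<in> words (Suc (Suc n))"
  by (auto simp: ends_Cons_snoc elim!: Cons_snoc_cases)

lemma ends_length [simp]: "length (ends a b l) = length l"
  by (simp add: ends_def)

abbreviation "bar_act n m l \<equiv>
  bp n (l[0 := m ! 0 \<otimes> l ! 0, Suc n := l ! Suc n \<otimes> m ! 1])"

lemma bar_act_bilinear:
  "tensor_bilinear k AA (replicate (Suc (Suc n)) A) (BT n) (bar_act n)"
proof (intro tensor_bilinear.intro tensor_bilinear_axioms.intro T2.tensor_factors_axioms Tn_factors Tn_module)
  let ?n = "Suc (Suc n)"
  fix l assume "l \<in> tuples (replicate ?n A)"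
  then have l: "l \<in> words ?n" by (simp add: tuples_replicate)
  note pm = multilinear_linear [OF Tn.pure_multilinear [of ?n]]
  show "multilinear k AA (Tn ?n) (\<lambda>m. bar_act n m l)"
  proof (rule multilinear_pairI)
    have l0: "l ! 0 \<in> carrier A" "l ! Suc n \<in> carrier A" using l by (auto simp: subset_iff)
    have u: "l[0 := x \<otimes> l ! 0] \<in> tuples (replicate ?n A)" "l[Suc n := l ! Suc n \<otimes> x] \<in> tuples (replicate ?n A)"
      if x: "x \<in> carrier A" for x
      using l x l0 by (intro tuples_update; simp add: tuples_replicate)+
    show "linear_map k (opposite_algebra A) (Tn ?n) (\<lambda>y. bar_act n [x, y] l)" if "x \<in> carrier A" for x
      using linear_map_comp [OF mult_left_linear [OF l0(2)]] pm [OF u(1), of x "Suc n"] that by simp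
    \<comment> \<open>Swapping the updates brings the varying letter to the outermost update, the
      form that \<open>pm\<close> requires.\<close>
    have sw: "l[0 := y, Suc n := z] = l[Suc n := z, 0 := y]" for y z by (rule list_update_swap) simp
    show "linear_map k A (Tn ?n) (\<lambda>y. bar_act n [y, x] l)" if "x \<in> carrier (opposite_algebra A)" for x
      unfolding sw using linear_map_comp [OF mult_right_linear [OF l0(1)]] pm [OF u(2), of x 0] that by simp
  qed
next
  let ?n = "Suc (Suc n)"
  fix m assume "m \<in> tuples AA"
  then obtain a b where m: "a \<in> carrier A" "b \<in> carrier A" "m = [a, b]" by (auto simp: tuples_pair)
  show "multilinear k (replicate ?n A) (Tn ?n) (bar_act n m)"
  proof (rule words_pullback [OF Tn.pure_multilinear])
    fix l assume l: "l \<in> words ?n"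
    then show "l[0 := m ! 0 \<otimes> l ! 0, Suc n := l ! Suc n \<otimes> m ! 1] \<in> words ?n"
      using ends_words [of l n a b] m by (simp add: ends_def)
    fix j assume j: "j < ?n"
    consider "j = 0" | "j = Suc n" | "j \<noteq> 0" "j \<noteq> Suc n" by blast
    then show "\<exists>i<?n. \<exists>f. linear_map k A A f \<and> (\<forall>x\<in>carrier A.
       (l[j := x])[0 := m ! 0 \<otimes> l[j := x] ! 0, Suc n := l[j := x] ! Suc n \<otimes> m ! 1] =
        l[0 := m ! 0 \<otimes> l ! 0, Suc n := l ! Suc n \<otimes> m ! 1, i := f x])"
    proof cases
      case 1
      show ?thesis
        by (rule exI [where x = j], rule conjI, use 1 in simp, rule exI, rule conjI,
            rule mult_left_linear [OF m(1)])
          (use l m 1 in \<open>auto intro!: nth_equalityI simp: nth_list_update\<close>)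
    next
      case 2
      show ?thesis
        by (rule exI [where x = j], rule conjI, use 2 in simp, rule exI, rule conjI,
            rule mult_right_linear [OF m(2)])
          (use l m 2 in \<open>auto intro!: nth_equalityI simp: nth_list_update\<close>)
    next
      case 3
      show ?thesis
        by (rule exI [where x = j], rule conjI, use j in simp, rule exI, rule conjI, rule linear_map_id)
          (use l m 3 j in \<open>auto intro!: nth_equalityI simp: nth_list_update\<close>)
    qed
  qed
qed

lemma bar_smult: "u \<odot>\<^bsub>bar n\<^esub> X = tensor_lift k (BT n)
    (\<lambda>m. tensor_lift k (BT n) (bar_act n m) X) u"
  by (simp add: bar_module_def Let_def)

lemma bar_act_linear_left: "X \<in> carrier (BT n) \<Longrightarrow>
    linear_map k E (BT n) (\<lambda>u. u \<odot>\<^bsub>bar n\<^esub> X)"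
  using tensor_bilinear.linear_left [OF bar_act_bilinear] by (simp add: bar_smult E_linear_dom)

lemma bar_act_linear_right: "u \<in> carrier E \<Longrightarrow>
    linear_map k (BT n) (BT n) (\<lambda>X. u \<odot>\<^bsub>bar n\<^esub> X)"
  using tensor_bilinear.linear_right [OF bar_act_bilinear] by (simp add: bar_smult E_simps)

lemma bar_act_pure:
  assumes "a \<in> carrier A" "b \<in> carrier A" "l \<in> words (Suc (Suc n))"
  shows "t a b \<odot>\<^bsub>bar n\<^esub> bp n l = bp n (ends a b l)"
  using tensor_bilinear.pure_pure [OF bar_act_bilinear, of "[a, b]" l] assms
  by (simp add: bar_smult tuples_pair tuples_replicate ends_def)

lemma ends_ends:
  assumes "l \<in> words (Suc (Suc n))" "a \<in> carrier A" "b \<in> carrier A" "c \<in> carrier A" "e \<in> carrier A"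
  shows "ends a b (ends c e l) = ends (a \<otimes> c) (e \<otimes> b) l"
  using assms by (auto simp: ends_Cons_snoc A.A.m_assoc elim!: Cons_snoc_cases)

lemma bar_left_module: "left_module E (bar n)"
  and bar_scalar [simp]: "\<lbrakk>r \<in> carrier k; X \<in> carrier (BT n)\<rbrakk> \<Longrightarrow>
    (r \<odot>\<^bsub>E\<^esub> \<one>\<^bsub>E\<^esub>) \<odot>\<^bsub>bar n\<^esub> X = r \<odot>\<^bsub>BT n\<^esub> X"
proof -
  let ?n = "Suc (Suc n)"
  note R = bar_act_linear_right
  have act: "t a b \<odot>\<^bsub>bar n\<^esub> (t c e \<odot>\<^bsub>bar n\<^esub> X) = t (a \<otimes> c) (e \<otimes> b) \<odot>\<^bsub>bar n\<^esub> X"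
    if "a \<in> carrier A" "b \<in> carrier A" "c \<in> carrier A" "e \<in> carrier A" "X \<in> carrier (Tn ?n)"
    for a b c e X
    by (rule Tn_maps_eq [OF linear_map_comp [OF R R] R _ that(5)])
      (use that ends_words in \<open>simp_all add: bar_act_pure ends_ends\<close>)
  have one: "t \<one> \<one> \<odot>\<^bsub>bar n\<^esub> X = X" if "X \<in> carrier (Tn ?n)" for X
    by (rule Tn_maps_eq [OF R linear_map_id _ that])
      (auto simp: bar_act_pure ends_Cons_snoc elim!: Cons_snoc_cases)
  note I = env_left_moduleI [OF Tn_module [of ?n], of "bar n"]
  show "left_module E (bar n)"
    by (rule I(1)) (simp_all add: bar_act_linear_left bar_act_linear_right act one)
  show "\<lbrakk>r \<in> carrier k; X \<in> carrier (Tn ?n)\<rbrakk> \<Longrightarrow> (r \<odot>\<^bsub>E\<^esub> \<one>\<^bsub>E\<^esub>) \<odot>\<^bsub>bar n\<^esub> X = r \<odot>\<^bsub>Tn ?n\<^esub> X"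
    by (rule I(2)) (simp_all add: bar_act_linear_left bar_act_linear_right act one)
qed

sublocale bar: algebra_module k E "bar n" for n by (rule algebra_moduleI [OF E_algebra bar_left_module])

lemma restrict_bar_dom: "linear_map k (restrict_scalars E (bar n)) N f \<longleftrightarrow> linear_map k (BT n) N f"
  by (simp add: linear_map_def)

lemma restrict_bar_cod: "linear_map k N (restrict_scalars E (bar n)) f \<longleftrightarrow> linear_map k N (BT n) f"
  by (auto simp: linear_map_def Pi_iff)

lemma restrict_M_cod: "linear_map k N (restrict_scalars E M) f \<longleftrightarrow> linear_map k N A f"
  by (auto simp: linear_map_def Pi_iff)

lemma restrict_M_multilinear: "multilinear k Ms (restrict_scalars E M) f \<longleftrightarrow> multilinear k Ms A f"
  by (simp add: multilinear_def restrict_M_cod)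

subsection \<open>Differential, augmentation and contracting homotopy\<close>

lemma bd_multilinear:
  "multilinear k (replicate (Suc (Suc (Suc n))) A) (BT n) (\<lambda>l.
     \<Oplus>\<^bsub>BT n\<^esub>i\<in>{..Suc n}. signed (BT n) i (bp n (contract A i l)))"
  by (intro multilinear_finsum Tn_module multilinear_comp [OF contract_multilinear [OF Tn.pure_multilinear]]
      linear_map_signed) (auto simp: A_module)

lemma bd_eq: "bd n = tensor_lift k (BT n) (\<lambda>l.
     \<Oplus>\<^bsub>BT n\<^esub>i\<in>{..Suc n}. signed (BT n) i (bp n (contract A i l)))"
  by (simp add: bar_diff_def Let_def)

lemma bd_linear: "linear_map k (BT (Suc n)) (BT n) (bd n)"
  unfolding bd_eq by (rule Tn.tensor_lift_linear [OF Tn_module bd_multilinear])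

lemma bd_pure: "l \<in> words (Suc (Suc (Suc n))) \<Longrightarrow> bd n (bp (Suc n) l) =
    (\<Oplus>\<^bsub>BT n\<^esub>i\<in>{..Suc n}. signed (BT n) i (bp n (contract A i l)))"
  unfolding bd_eq by (rule Tn.tensor_lift_pure [OF Tn_module bd_multilinear]) (simp add: tuples_replicate)

sublocale bd: linear_hom k "BT (Suc n)" "BT n" "bd n" for n
  by (rule linear_homI [OF Tn_module Tn_module bd_linear])

text \<open>Only the faces \<open>0\<close> and \<open>Suc n\<close> touch the outer letters; for
  them this is associativity, for the others nothing happens.\<close>

lemma contract_ends:
  assumes l: "l \<in> words (Suc (Suc (Suc n)))" and i: "i \<le> Suc n" and a: "a \<in> carrier A" "b \<in> carrier A"
  shows "contract A i (ends a b l) = ends a b (contract A i l)"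
proof -
  have c: "l ! j \<in> carrier A" if "j < Suc (Suc (Suc n))" for j using l that by (auto simp: subset_iff)
  have len: "length l = Suc (Suc (Suc n))" using l by simp
  show ?thesis
    by (rule nth_equalityI)
      (use len i a c in \<open>auto simp: contract_length contract_nth ends_def nth_list_update A.A.m_assoc\<close>)
qed

lemma bd_E_linear: "linear_map E (bar (Suc n)) (bar n) (bd n)"
proof (rule env_linearI [OF bar_left_module bar_left_module])
  show "linear_map k (restrict_scalars E (bar (Suc n))) (restrict_scalars E (bar n)) (bd n)"
    by (simp add: restrict_bar_dom restrict_bar_cod bd_linear)
  fix a b X assume ab: "a \<in> carrier A" "b \<in> carrier A" and X: "X \<in> carrier (bar (Suc n))"
  interpret act: linear_hom k "BT n" "BT n" "\<lambda>X. t a b \<odot>\<^bsub>bar n\<^esub> X"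
    by (rule linear_homI [OF Tn_module Tn_module bar_act_linear_right]) (simp add: ab)
  show "bd n (t a b \<odot>\<^bsub>bar (Suc n)\<^esub> X) = t a b \<odot>\<^bsub>bar n\<^esub> bd n X"
  proof (rule Tn_maps_eq [OF linear_map_comp [OF bar_act_linear_right bd_linear]
        linear_map_comp [OF bd_linear bar_act_linear_right]])
    fix l assume l: "l \<in> words (Suc (Suc (Suc n)))"
    have c: "contract A i l \<in> words (Suc (Suc n))" if "i \<le> Suc n" for i
      using contract_words [OF l] that by auto
    show "bd n (t a b \<odot>\<^bsub>bar (Suc n)\<^esub> bp (Suc n) l) =
       t a b \<odot>\<^bsub>bar n\<^esub> bd n (bp (Suc n) l)"
      unfolding bar_act_pure [OF ab l] bd_pure [OF l] bd_pure [OF ends_words [OF l ab]]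
    proof (subst act.f_finsum)
      show "(\<Oplus>\<^bsub>BT n\<^esub>i\<in>{..Suc n}. signed (BT n) i (bp n (contract A i (ends a b l)))) =
        (\<Oplus>\<^bsub>BT n\<^esub>i\<in>{..Suc n}. t a b \<odot>\<^bsub>bar n\<^esub> signed (BT n) i (bp n (contract A i l)))"
        by (rule Tn.T.M.finsum_cong')
          (use c ab contract_ends [OF l _ ab] ends_words [OF c ab] in \<open>simp_all add: Pi_def act.f_signed bar_act_pure\<close>)
    qed (use c in auto)
  qed (use X ab in auto)
qed

lemma aug_multilinear: "multilinear k (replicate (Suc (Suc 0)) A) A (\<lambda>l. l ! 0 \<otimes> l ! 1)"
  unfolding replicate_Suc replicate_0
  by (rule multilinear_pairI) (simp_all add: mult_left_linear mult_right_linear)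

lemma aug_linear: "linear_map k (BT 0) A aug"
  unfolding bar_augmentation_def by (rule Tn.tensor_lift_linear [OF A_module aug_multilinear])

lemma aug_pure: "\<lbrakk>x \<in> carrier A; y \<in> carrier A\<rbrakk> \<Longrightarrow> aug (bp 0 [x, y]) = x \<otimes> y"
  unfolding bar_augmentation_def
  by (subst Tn.tensor_lift_pure [OF A_module aug_multilinear]) (simp_all add: tuples_replicate)

sublocale aug: linear_hom k "BT 0" A aug
  by (rule linear_homI [OF Tn_module A_module aug_linear])

lemma words_2: "l \<in> words (Suc (Suc 0)) \<longleftrightarrow> (\<exists>x\<in>carrier A. \<exists>y\<in>carrier A. l = [x, y])"
  by (auto simp: length_Suc_conv)

lemma aug_E_linear: "linear_map E (bar 0) M aug"
proof (rule env_linearI [OF bar_left_module M_left_module])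
  show "linear_map k (restrict_scalars E (bar 0)) (restrict_scalars E M) aug"
    by (simp add: restrict_bar_dom restrict_M_cod aug_linear)
  fix a b X assume ab: "a \<in> carrier A" "b \<in> carrier A" and X: "X \<in> carrier (bar 0)"
  have "linear_map k A A (\<lambda>x. a \<otimes> x \<otimes> b)"
    using linear_map_comp [OF mult_left_linear mult_right_linear] ab by blast
  note L = linear_map_comp [OF aug_linear this]
  have "aug (t a b \<odot>\<^bsub>bar 0\<^esub> X) = a \<otimes> aug X \<otimes> b"
  proof (rule Tn_maps_eq [OF linear_map_comp [OF bar_act_linear_right aug_linear] L])
    fix l assume l: "l \<in> words (Suc (Suc 0))"
    then obtain x y where "x \<in> carrier A" "y \<in> carrier A" "l = [x, y]" unfolding words_2 by blast
    then show "aug (t a b \<odot>\<^bsub>bar 0\<^esub> bp 0 l) = a \<otimes> aug (bp 0 l) \<otimes> b"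
      unfolding bar_act_pure [OF ab l] using ends_Cons_snoc [of a b x "[]" y] ab
      by (simp add: aug_pure A.A.m_assoc)
  qed (use X ab in auto)
  then show "aug (t a b \<odot>\<^bsub>bar 0\<^esub> X) = t a b \<odot>\<^bsub>M\<^esub> aug X" using X ab by simp
qed

text \<open>Indexed by the number of tensor factors, not by the bar degree: on \<open>bar n\<close>
  it is \<open>cone (Suc (Suc n))\<close>. Prepending a unit does not commute with left
  multiplication, so the map is only \<open>k\<close>-linear.\<close>

definition cone :: "nat \<Rightarrow> ('a list \<Rightarrow> 'k) set \<Rightarrow> ('a list \<Rightarrow> 'k) set" where
  "cone n = tensor_lift k (Tn (Suc n)) (\<lambda>l. pe (Suc n) (\<one> # l))"

lemma pe_Cons:
  shows pe_Cons_multilinear: "x \<in> carrier A \<Longrightarrow> multilinear k (replicate n A) (Tn (Suc n)) (\<lambda>l. pe (Suc n) (x # l))"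
    and pe_Cons_linear: "l \<in> words n \<Longrightarrow> linear_map k A (Tn (Suc n)) (\<lambda>x. pe (Suc n) (x # l))"
proof -
  have "multilinear k (A # replicate n A) (Tn (Suc n)) (pe (Suc n))"
    using Tn.pure_multilinear [of "Suc n"] by (simp add: replicate_Suc)
  then show "x \<in> carrier A \<Longrightarrow> multilinear k (replicate n A) (Tn (Suc n)) (\<lambda>l. pe (Suc n) (x # l))"
    and "l \<in> words n \<Longrightarrow> linear_map k A (Tn (Suc n)) (\<lambda>x. pe (Suc n) (x # l))"
    using multilinear_Cons_iff [OF A_module Tn_module, of "replicate n A" "Suc n" "pe (Suc n)"] A_module
    by (simp_all add: tuples_replicate)
qed

lemma cone_linear: "linear_map k (Tn n) (Tn (Suc n)) (cone n)"
  unfolding cone_def by (rule Tn.tensor_lift_linear [OF Tn_module pe_Cons_multilinear]) simp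

lemma cone_pure: "l \<in> words n \<Longrightarrow> cone n (pe n l) = pe (Suc n) (\<one> # l)"
  unfolding cone_def by (rule Tn.tensor_lift_pure [OF Tn_module pe_Cons_multilinear]) (simp_all add: tuples_replicate)

sublocale cone: linear_hom k "Tn n" "Tn (Suc n)" "cone n" for n
  by (rule linear_homI [OF Tn_module Tn_module cone_linear])

text \<open>The contracting homotopy at the augmentation. It starts from \<open>A\<close> itself,
  which is not literally the first tensor power.\<close>

abbreviation "cone0 a \<equiv> bp 0 [\<one>, a]"

lemma cone0_linear: "linear_map k A (BT 0) cone0"
  using multilinear_linear [OF Tn.pure_multilinear, of "[\<one>, \<zero>]" "Suc (Suc 0)" "Suc 0"]
  by (simp add: tuples_replicate)

sublocale cone0: linear_hom k A "BT 0" cone0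
  by (rule linear_homI [OF A_module Tn_module cone0_linear])

text \<open>Face \<open>0\<close> of a word with a prepended unit removes the unit again; the other
  faces are the faces of the old word shifted by one, hence with the opposite sign.\<close>

lemma bd_cone:
  assumes X: "X \<in> carrier (BT (Suc n))"
  shows "bd (Suc n) (cone (Suc (Suc (Suc n))) X) = X \<ominus>\<^bsub>BT (Suc n)\<^esub> cone (Suc (Suc n)) (bd n X)"
proof (rule Tn_maps_eq [OF linear_map_comp [OF cone_linear bd_linear]
      linear_map_minus_map [OF Tn_module linear_map_id linear_map_comp [OF bd_linear cone_linear]] _ X])
  let ?T = "BT (Suc n)" and ?T' = "BT n"
  fix l assume l: "l \<in> words (Suc (Suc (Suc n)))"
  then obtain x l' where xl: "l = x # l'" by (auto simp: length_Suc_conv)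
  have c: "contract A i l \<in> words (Suc (Suc n))" if "i \<le> Suc n" for i
    using contract_words [OF l] that by auto
  then have c1: "\<one> # contract A i l \<in> words (Suc (Suc (Suc n)))" if "i \<le> Suc n" for i
    using that by auto
  have l1: "\<one> # l \<in> words (Suc (Suc (Suc (Suc n))))" using l by auto
  have c2: "contract A i (\<one> # l) \<in> words (Suc (Suc (Suc n)))" if "i \<le> Suc (Suc n)" for i
    using contract_words [OF l1] that by auto
  have sg: "signed ?T (Suc i) Y = \<ominus>\<^bsub>?T\<^esub> signed ?T i Y" if "Y \<in> carrier ?T" for i Y
    using that by (simp add: signed_def)
  interpret neg: linear_hom k ?T ?T "a_inv ?T"
    by (rule linear_homI [OF Tn_module Tn_module linear_map_neg [OF Tn_module]])
  have "bd (Suc n) (cone (Suc (Suc (Suc n))) (bp (Suc n) l)) =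
     (\<Oplus>\<^bsub>?T\<^esub>i\<in>{..Suc (Suc n)}. signed ?T i (bp (Suc n) (contract A i (\<one> # l))))"
    by (simp only: cone_pure [OF l] bd_pure [OF l1])
  also have "\<dots> = (\<Oplus>\<^bsub>?T\<^esub>i\<in>{..Suc n}. signed ?T (Suc i) (bp (Suc n) (contract A (Suc i) (\<one> # l))))
      \<oplus>\<^bsub>?T\<^esub> signed ?T 0 (bp (Suc n) (contract A 0 (\<one> # l)))"
    by (rule Tn.T.M.finsum_Suc2) (use c2 in auto)
  also have "signed ?T 0 (bp (Suc n) (contract A 0 (\<one> # l))) = bp (Suc n) l"
    using l by (simp add: signed_def xl contract_Cons_0)
  also have "(\<Oplus>\<^bsub>?T\<^esub>i\<in>{..Suc n}. signed ?T (Suc i) (bp (Suc n) (contract A (Suc i) (\<one> # l)))) =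
      (\<Oplus>\<^bsub>?T\<^esub>i\<in>{..Suc n}. \<ominus>\<^bsub>?T\<^esub> (signed ?T i (bp (Suc n) (\<one> # contract A i l))))"
    by (rule Tn.T.M.finsum_cong') (use c1 in \<open>auto simp: contract_Cons sg\<close>)
  also have "\<dots> = \<ominus>\<^bsub>?T\<^esub> (\<Oplus>\<^bsub>?T\<^esub>i\<in>{..Suc n}. signed ?T i (bp (Suc n) (\<one> # contract A i l)))"
    by (rule neg.f_finsum [symmetric]) (use c1 in auto)
  also have "(\<Oplus>\<^bsub>?T\<^esub>i\<in>{..Suc n}. signed ?T i (bp (Suc n) (\<one> # contract A i l))) =
      cone (Suc (Suc n)) (bd n (bp (Suc n) l))"
    unfolding bd_pure [OF l]
  proof (subst cone.f_finsum)
    show "(\<Oplus>\<^bsub>?T\<^esub>i\<in>{..Suc n}. signed ?T i (bp (Suc n) (\<one> # contract A i l))) =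
      (\<Oplus>\<^bsub>?T\<^esub>i\<in>{..Suc n}. cone (Suc (Suc n)) (signed ?T' i (bp n (contract A i l))))"
      by (rule Tn.T.M.finsum_cong') (use c c1 in \<open>simp_all add: Pi_def cone.f_signed cone_pure\<close>)
  qed (use c in auto)
  finally show "bd (Suc n) (cone (Suc (Suc (Suc n))) (bp (Suc n) l)) =
     bp (Suc n) l \<ominus>\<^bsub>?T\<^esub> cone (Suc (Suc n)) (bd n (bp (Suc n) l))"
    using l by (simp add: a_minus_def Tn.T.M.a_comm)
qed

lemma bd_cone0:
  assumes X: "X \<in> carrier (BT 0)"
  shows "bd 0 (cone (Suc (Suc 0)) X) = X \<ominus>\<^bsub>BT 0\<^esub> cone0 (aug X)"
proof (rule Tn_maps_eq [OF linear_map_comp [OF cone_linear bd_linear]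
      linear_map_minus_map [OF Tn_module linear_map_id linear_map_comp [OF aug_linear cone0_linear]] _ X])
  fix l assume l: "l \<in> words (Suc (Suc 0))"
  then obtain x y where xy: "x \<in> carrier A" "y \<in> carrier A" "l = [x, y]" unfolding words_2 by blast
  have l1: "\<one> # l \<in> words (Suc (Suc (Suc 0)))" using l by auto
  show "bd 0 (cone (Suc (Suc 0)) (bp 0 l)) =
     bp 0 l \<ominus>\<^bsub>BT 0\<^esub> cone0 (aug (bp 0 l))"
    unfolding cone_pure [OF l] bd_pure [OF l1] using xy contract_words [OF l1]
    by (subst Tn.T.M.finsum_Suc2)
      (auto simp: contract_def signed_def aug_pure Tn.T.M.minus_eq Tn.T.M.a_comm le_Suc_eq)
qed

text \<open>A word with first letter \<open>x\<close> is \<open>t x \<one>\<close> acting on the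
  cone over its tail. This reduces identities of bimodule maps to elements where
  \<open>bd_cone\<close> applies.\<close>

lemma bar_maps_eq:
  assumes N: "left_module E N" and f: "linear_map E (bar n) N f" and g: "linear_map E (bar n) N g"
    and eq: "\<And>X. X \<in> carrier (Tn (Suc n)) \<Longrightarrow> f (cone (Suc n) X) = g (cone (Suc n) X)"
    and X: "X \<in> carrier (bar n)"
  shows "f X = g X"
proof (rule Tn_maps_eq)
  interpret N: algebra_module k E N by (rule algebra_moduleI [OF E_algebra N])
  show "linear_map k (BT n) (restrict_scalars E N) f"
    "linear_map k (BT n) (restrict_scalars E N) g"
    using bar.linear_imp_restrict_linear [OF f] bar.linear_imp_restrict_linear [OF g]
    by (simp_all add: restrict_bar_dom)
  fix l assume l: "l \<in> words (Suc (Suc n))"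
  then obtain x m y where xm: "l = x # m @ [y]" "length m = n" by (auto elim!: Cons_snoc_cases)
  have w: "m @ [y] \<in> words (Suc n)" "\<one> # m @ [y] \<in> words (Suc (Suc n))" and x: "x \<in> carrier A"
    and y: "y \<in> carrier A"
    using l xm by auto
  have "bp n l = t x \<one> \<odot>\<^bsub>bar n\<^esub> bp n (\<one> # m @ [y])"
    using bar_act_pure [OF x A.A.one_closed w(2)] xm x y by (simp add: ends_Cons_snoc)
  also have "\<dots> = t x \<one> \<odot>\<^bsub>bar n\<^esub> cone (Suc n) (pe (Suc n) (m @ [y]))"
    using cone_pure [OF w(1)] by simp
  finally have "bp n l = t x \<one> \<odot>\<^bsub>bar n\<^esub> cone (Suc n) (pe (Suc n) (m @ [y]))" .
  then show "f (bp n l) = g (bp n l)"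
    using x w by (simp add: linear_map_smult [OF f] linear_map_smult [OF g] eq)
qed (use X in simp)

lemma aug_cone0: "a \<in> carrier A \<Longrightarrow> aug (cone0 a) = a"
  by (simp add: aug_pure)

text \<open>On a cone, \<open>bd_cone0\<close> turns the left side into \<open>aug X\<close> minus
  \<open>aug (cone0 (aug X))\<close>, and \<open>aug\<close> undoes \<open>cone0\<close>.\<close>

lemma aug_bd:
  assumes "X \<in> carrier (BT (Suc 0))" shows "aug (bd 0 X) = \<zero>"
proof -
  have "aug (bd 0 X) = \<zero>\<^bsub>M\<^esub>"
    by (rule bar_maps_eq [OF M_left_module linear_map_comp [OF bd_E_linear aug_E_linear]
          linear_map_zero_map [OF M_left_module]])
      (use assms in \<open>simp_all add: bd_cone0 aug_cone0 A.M.minus_eq A.M.r_neg\<close>)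
  then show ?thesis by simp
qed

text \<open>On cones, \<open>d d s = d - d s d = d - (d - s d d) = s d d\<close>, which vanishes by
  induction. At the bottom the last term is \<open>cone0\<close> of \<open>aug_bd\<close>.\<close>

lemma bd_bd: "X \<in> carrier (BT (Suc (Suc n))) \<Longrightarrow> bd n (bd (Suc n) X) = \<zero>\<^bsub>BT n\<^esub>"
proof (induct n arbitrary: X)
  case 0
  have "bd 0 (bd (Suc 0) X) = \<zero>\<^bsub>bar 0\<^esub>"
  proof (rule bar_maps_eq [OF bar_left_module linear_map_comp [OF bd_E_linear bd_E_linear]
          linear_map_zero_map [OF bar_left_module]])
    fix X assume "X \<in> carrier (BT (Suc 0))"
    then show "bd 0 (bd (Suc 0) (cone (Suc (Suc (Suc 0))) X)) = \<zero>\<^bsub>bar 0\<^esub>"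
      by (simp add: bd_cone bd_cone0 aug_bd cone0.f_zero Tn.T.M.minus_zero_eq Tn.T.M.minus_eq Tn.T.M.r_neg)
  qed (use 0 in simp)
  then show ?case by simp
next
  case (Suc n)
  have "bd (Suc n) (bd (Suc (Suc n)) X) = \<zero>\<^bsub>bar (Suc n)\<^esub>"
  proof (rule bar_maps_eq [OF bar_left_module linear_map_comp [OF bd_E_linear bd_E_linear]
          linear_map_zero_map [OF bar_left_module]])
    fix X assume "X \<in> carrier (BT (Suc (Suc n)))"
    then show "bd (Suc n) (bd (Suc (Suc n)) (cone (Suc (Suc (Suc (Suc n)))) X)) = \<zero>\<^bsub>bar (Suc n)\<^esub>"
      by (simp add: bd_cone Suc(1) Tn.T.M.minus_zero_eq Tn.T.M.minus_eq Tn.T.M.r_neg)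
  qed (use Suc(2) in simp)
  then show ?case by simp
qed

end

context algebra_module
begin

lemma smult_linear_left: "x \<in> carrier M \<Longrightarrow> linear_map k B (restrict_scalars B M) (\<lambda>u. u \<odot>\<^bsub>M\<^esub> x)"
  by (rule linear_mapI) (simp_all add: M.lsmult_l_distr scalar_smult)

lemma smult_linear_right: "u \<in> carrier B \<Longrightarrow>
    linear_map k (restrict_scalars B M) (restrict_scalars B M) (\<lambda>x. u \<odot>\<^bsub>M\<^esub> x)"
  by (rule linear_mapI) (simp_all add: M.lsmult_r_distr scalar_comm)

end

context hoch
begin

subsection \<open>Bimodule maps out of the bar resolution\<close>

text \<open>A formula that agrees on words with a linear map inherits multilinearity from it. The
  Hochschild differential, the bracket and \<open>cochain_to_bar\<close> are all accessed in this
  way, by exhibiting the linear map.\<close>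

lemma tensor_lift_eq:
  assumes N: "left_module k N" and h: "linear_map k (Tn n) N h"
    and eq: "\<And>l. l \<in> words n \<Longrightarrow> g l = h (pe n l)" and X: "X \<in> carrier (Tn n)"
  shows "tensor_lift k N g X = h X"
proof -
  have g: "multilinear k (replicate n A) N g"
    by (rule multilinear_cong [OF _ _ multilinear_comp [OF Tn.pure_multilinear h]])
      (use eq A_module in \<open>auto simp: tuples_replicate\<close>)
  show ?thesis
    by (rule Tn_maps_eq [OF Tn.tensor_lift_linear [OF N g] h _ X])
      (simp add: Tn.tensor_lift_pure [OF N g] tuples_replicate eq)
qed

lemma words_Cons_snoc_cases:
  assumes "l \<in> words (Suc (Suc n))"
  obtains x m y where "l = x # m @ [y]" "m \<in> words n" "x \<in> carrier A" "y \<in> carrier A"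
proof -
  from assms obtain x m y where "l = x # m @ [y]" "length m = n" by (auto elim!: Cons_snoc_cases)
  then show thesis using assms by (intro that [of x m y]) auto
qed

text \<open>\<open>bar n\<close> is the bimodule induced from the \<open>k\<close>-module of inner
  letters; this is the extension of a map on inner letters to a bimodule map. With target
  \<open>M\<close> it yields \<open>cochain_to_bar\<close>, with a free target the section that
  proves projectivity.\<close>

definition bar_extend ::
  "(('a list \<Rightarrow> 'k) set, 'n) module \<Rightarrow> ('a list \<Rightarrow> 'n) \<Rightarrow> ('a list \<Rightarrow> 'k) set \<Rightarrow> 'n" where
  "bar_extend N g = tensor_lift k (restrict_scalars E N)
     (\<lambda>l. t (hd l) (last l) \<odot>\<^bsub>N\<^esub> g (butlast (tl l)))"

context
  fixes N :: "(('a list \<Rightarrow> 'k) set, 'n) module" and g n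
  assumes N: "left_module E N" and g: "multilinear k (replicate n A) (restrict_scalars E N) g"
begin

interpretation N: algebra_module k E N by (rule algebra_moduleI [OF E_algebra N])

lemma bar_extend_arg_closed: "m \<in> words n \<Longrightarrow> g m \<in> carrier N"
  using multilinear_closed [OF g] by (simp add: tuples_replicate)

lemma bar_extend_multilinear: "multilinear k (replicate (Suc (Suc n)) A) (restrict_scalars E N)
     (\<lambda>l. t (hd l) (last l) \<odot>\<^bsub>N\<^esub> g (butlast (tl l)))"
proof -
  let ?K = "restrict_scalars E N"
  note K = N.restrict_scalars_module
  have "multilinear k (A # replicate n A @ [A]) ?K (\<lambda>l. t (hd l) (last l) \<odot>\<^bsub>N\<^esub> g (butlast (tl l)))"
  proof (rule multilinear_Cons_iff [THEN iffD2, OF A_module K _ conjI], goal_cases)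
    \<comment> \<open>Case 2 varies the inner and the last letters under a fixed first one, case 3
      varies the first; case 1, that the factors are modules, is left to the end.\<close>
    case 2
    show ?case
    proof (intro ballI multilinear_snoc)
      fix x y assume "x \<in> carrier A" "y \<in> carrier A"
      then show "multilinear k (replicate n A) ?K
          (\<lambda>l. t (hd (x # l @ [y])) (last (x # l @ [y])) \<odot>\<^bsub>N\<^esub> g (butlast (tl (x # l @ [y]))))"
        using multilinear_comp [OF g N.smult_linear_right] by simp
    next
      fix x l assume "x \<in> carrier A" "l \<in> tuples (replicate n A)"
      then show "linear_map k A ?K
          (\<lambda>y. t (hd (x # l @ [y])) (last (x # l @ [y])) \<odot>\<^bsub>N\<^esub> g (butlast (tl (x # l @ [y]))))"
        using linear_map_comp [OF t_linear_right N.smult_linear_left [OF bar_extend_arg_closed]]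
        by (simp add: tuples_replicate)
    qed
  next
    case 3
    show ?case
    proof
      fix l assume "l \<in> tuples (replicate n A @ [A])"
      then have l: "l \<in> words (Suc n)"
        by (simp add: replicate_append_same replicate_Suc [symmetric] tuples_replicate)
      then obtain m y where m: "l = m @ [y]" by (cases l rule: rev_cases) auto
      then show "linear_map k A ?K (\<lambda>x. t (hd (x # l)) (last (x # l)) \<odot>\<^bsub>N\<^esub> g (butlast (tl (x # l))))"
        using linear_map_comp [OF t_linear_left N.smult_linear_left [OF bar_extend_arg_closed]] l by simp
    qed
  qed (auto simp: A_module)
  then show ?thesis by (simp add: replicate_append_same replicate_Suc)
qed

lemma bar_extend_pure: "\<lbrakk>x \<in> carrier A; y \<in> carrier A; m \<in> words n\<rbrakk> \<Longrightarrow>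
    bar_extend N g (bp n (x # m @ [y])) = t x y \<odot>\<^bsub>N\<^esub> g m"
  unfolding bar_extend_def
  by (subst Tn.tensor_lift_pure [OF N.restrict_scalars_module bar_extend_multilinear])
    (simp_all add: tuples_replicate)

lemma bar_extend_k_linear: "linear_map k (BT n) (restrict_scalars E N) (bar_extend N g)"
  unfolding bar_extend_def
  by (rule Tn.tensor_lift_linear [OF N.restrict_scalars_module bar_extend_multilinear])

lemma bar_extend_linear: "linear_map E (bar n) N (bar_extend N g)"
proof (rule env_linearI [OF bar_left_module N])
  show "linear_map k (restrict_scalars E (bar n)) (restrict_scalars E N) (bar_extend N g)"
    by (simp add: restrict_bar_dom bar_extend_k_linear)
  fix a b X assume ab: "a \<in> carrier A" "b \<in> carrier A" and X: "X \<in> carrier (bar n)"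
  show "bar_extend N g (t a b \<odot>\<^bsub>bar n\<^esub> X) = t a b \<odot>\<^bsub>N\<^esub> bar_extend N g X"
  proof (rule Tn_maps_eq [OF linear_map_comp [OF bar_act_linear_right bar_extend_k_linear]
        linear_map_comp [OF bar_extend_k_linear N.smult_linear_right]])
    fix l assume l: "l \<in> words (Suc (Suc n))"
    then obtain x m y where "l = x # m @ [y]" "m \<in> words n" "x \<in> carrier A" "y \<in> carrier A"
      by (rule words_Cons_snoc_cases)
    then show "bar_extend N g (t a b \<odot>\<^bsub>bar n\<^esub> bp n l) =
        t a b \<odot>\<^bsub>N\<^esub> bar_extend N g (bp n l)"
      unfolding bar_act_pure [OF ab l] using ab bar_extend_arg_closed [of m]
      by (simp add: ends_Cons_snoc bar_extend_pure N.M.lsmult_assoc [symmetric] t_mult)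
  qed (use X ab in auto)
qed

end

subsection \<open>Projectivity\<close>

text \<open>This takes the place of projectivity of the tensor powers of \<open>A\<close>. The first
  letter is expanded as \<pi> of a combination of basis elements; for each of these the remaining
  letters are treated by induction, and the lifts are combined with the coordinates as
  coefficients.\<close>

lemma multilinear_lifting:
  assumes proj: "projective_module k A" and N: "left_module k N" and N': "left_module k N'"
    and \<sigma>: "linear_map k N N' \<sigma>" and surj: "\<sigma> ` carrier N = carrier N'"
    and g: "multilinear k (replicate n A) N' g"
  shows "\<exists>h. multilinear k (replicate n A) N h \<and> (\<forall>l\<in>words n. \<sigma> (h l) = g l)"
  using g
proof (induct n arbitrary: g)
  case 0
  have "g [] \<in> \<sigma> ` carrier N" using multilinear_closed [OF 0, of "[]"] by (simp add: surj)
  then obtain y where y: "y \<in> carrier N" "\<sigma> y = g []" by (elim imageE) simp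
  \<comment> \<open>For an empty list of factors multilinearity is only closure, so any preimage of
    the single value will do.\<close>
  have "multilinear k (replicate 0 A) N (\<lambda>_. y)" by (rule multilinearI) (simp_all add: y)
  moreover have "\<sigma> y = g l" if "l \<in> words 0" for l using that y by simp
  ultimately show ?case by (intro exI [where x = "\<lambda>_. y"] conjI ballI)
next
  case (Suc n)
  interpret N: left_module k N by fact
  interpret N': left_module k N' by fact
  from proj obtain I :: "'a set" and \<iota> \<pi> where
    \<iota>: "linear_map k A (free_module k I) \<iota>" and \<pi>: "linear_map k (free_module k I) A \<pi>"
    and \<pi>\<iota>: "\<And>x. x \<in> carrier A \<Longrightarrow> \<pi> (\<iota> x) = x"
    unfolding projective_module_def by blast
  have g: "multilinear k (A # replicate n A) N' g" using Suc(2) by (simp add: replicate_Suc)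
  have gm: "multilinear k (replicate n A) N' (\<lambda>l. g (x # l))" if "x \<in> carrier A" for x
    using g multilinear_Cons_iff [OF A_module N', of "replicate n A" g] that A_module by auto
  have gl: "linear_map k A N' (\<lambda>x. g (x # l))" if "l \<in> words n" for l
    using g multilinear_Cons_iff [OF A_module N', of "replicate n A" g] that A_module
    by (auto simp: tuples_replicate)
  let ?x = "\<lambda>i. \<pi> (basis_elem k i)"
  have "\<exists>h. multilinear k (replicate n A) N h \<and> (\<forall>l\<in>words n. \<sigma> (h l) = g (?x i # l))" if "i \<in> I" for i
    by (rule Suc(1) [OF gm]) (intro linear_map_closed [OF \<pi>] A.R.basis_elem_closed that)
  then obtain h where h: "\<And>i. i \<in> I \<Longrightarrow> multilinear k (replicate n A) N (h i)"
    and \<sigma>h: "\<And>i l. \<lbrakk>i \<in> I; l \<in> words n\<rbrakk> \<Longrightarrow> \<sigma> (h i l) = g (?x i # l)"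
    by metis
  have hc: "(\<lambda>i. h i l) \<in> I \<rightarrow> carrier N" if "l \<in> words n" for l
    using multilinear_closed [OF h] that by (auto simp: tuples_replicate)
  \<comment> \<open>The coordinates of the first letter weight the lifts chosen for the basis
    elements.\<close>
  define H where "H l = lincomb k N (\<lambda>i. h i (tl l)) (\<iota> (hd l))" for l
  have "multilinear k (A # replicate n A) N H"
  proof (rule multilinear_Cons_iff [THEN iffD2, OF A_module N _ conjI], goal_cases)
    case 2
    show ?case
    proof
      fix x assume "x \<in> carrier A"
      then have x: "\<iota> x \<in> carrier (free_module k I)" by (rule linear_map_closed [OF \<iota>])
      show "multilinear k (replicate n A) N (\<lambda>l. H (x # l))"
        unfolding H_def lincomb_def list.sel
      proof (rule multilinear_finsum [OF N])
        fix i assume "i \<in> {i. \<iota> x i \<noteq> \<zero>\<^bsub>k\<^esub>}"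
        then have i: "i \<in> I" "\<iota> x i \<in> carrier k" using x by (auto simp: free_module_carrier)
        have "linear_map k N N (\<lambda>z. \<iota> x i \<odot>\<^bsub>N\<^esub> z)"
          by (rule linear_mapI)
            (simp_all add: i N.lsmult_r_distr N.lsmult_assoc [symmetric] A.R.m_comm)
        then show "multilinear k (replicate n A) N (\<lambda>l. \<iota> x i \<odot>\<^bsub>N\<^esub> h i l)"
          by (rule multilinear_comp [OF h [OF i(1)]])
      qed (use x A_module in \<open>auto simp: free_module_carrier\<close>)
    qed
  next
    case 3
    show ?case
      unfolding H_def list.sel
      using linear_map_comp [OF \<iota> lincomb_linear [OF N hc]] by (simp add: tuples_replicate)
  qed (auto simp: A_module)
  moreover have "\<sigma> (H l) = g l" if l: "l \<in> words (Suc n)" for l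
  proof -
    obtain x m where xm: "l = x # m" "x \<in> carrier A" "m \<in> words n" using l by (cases l) auto
    \<comment> \<open>Proved for every \<open>c\<close> in the free module, where testing on the
      basis is possible, and then specialised to the coordinates of \<open>x\<close>.\<close>
    have "\<sigma> (lincomb k N (\<lambda>i. h i m) c) = g (\<pi> c # m)" if "c \<in> carrier (free_module k I)" for c
      by (rule linear_maps_eq_free [OF N' linear_map_comp [OF lincomb_linear [OF N hc] \<sigma>]
            linear_map_comp [OF \<pi> gl] _ that])
        (use xm hc in \<open>simp_all add: lincomb_basis [OF N] \<sigma>h\<close>)
    from this [OF linear_map_closed [OF \<iota> xm(2)]] show ?thesis by (simp add: H_def xm \<pi>\<iota>)
  qed
  ultimately show ?case by (auto simp: replicate_Suc)
qed

text \<open>The inclusion of the inner letters between two units. Composing a bimodule map with it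
  recovers the cochain, so it inverts \<open>cochain_to_bar\<close>.\<close>

definition wrap :: "nat \<Rightarrow> ('a list \<Rightarrow> 'k) set \<Rightarrow> ('a list \<Rightarrow> 'k) set" where
  "wrap n = tensor_lift k (BT n) (\<lambda>l. bp n (\<one> # l @ [\<one>]))"

lemma wrap_multilinear:
  "multilinear k (replicate n A) (BT n) (\<lambda>l. bp n (\<one> # l @ [\<one>]))"
proof (rule words_pullback [OF Tn.pure_multilinear])
  fix l j assume "l \<in> words n" "j < n"
  then show "\<exists>i<Suc (Suc n). \<exists>f. linear_map k A A f \<and>
      (\<forall>x\<in>carrier A. \<one> # l[j := x] @ [\<one>] = (\<one> # l @ [\<one>])[i := f x])"
    by (intro exI [where x = "Suc j"] conjI exI [where x = "\<lambda>x. x"] linear_map_id)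
      (auto simp: list_update_append)
qed auto

lemma wrap_linear: "linear_map k (Tn n) (BT n) (wrap n)"
  unfolding wrap_def by (rule Tn.tensor_lift_linear [OF Tn_module wrap_multilinear])

lemma wrap_pure: "l \<in> words n \<Longrightarrow> wrap n (pe n l) = bp n (\<one> # l @ [\<one>])"
  unfolding wrap_def by (rule Tn.tensor_lift_pure [OF Tn_module wrap_multilinear]) (simp add: tuples_replicate)

text \<open>The multilinear map sending \<open>l\<close> to \<open>\<one> # l @ [\<one>]\<close> is
  lifted through the canonical free cover \<sigma> and extended to a bimodule map. This is a section
  of \<sigma>, since both sides agree on the generators with unit outer letters.\<close>

lemma bar_projective:
  assumes "projective_module k A"
  shows "projective_module E (bar n)"
proof -
  let ?F = "free_module E (carrier (bar n))"
  define \<sigma> where "\<sigma> = lincomb E (bar n) (\<lambda>q. q)"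
  have F: "left_module E ?F" by (rule E.A.free_left_module)
  have \<sigma>: "linear_map E ?F (bar n) \<sigma>"
    unfolding \<sigma>_def by (rule lincomb_linear [OF bar_left_module]) auto
  interpret F: algebra_module k E ?F by (rule algebra_moduleI [OF E_algebra F])
  have \<sigma>k: "linear_map k (restrict_scalars E ?F) (BT n) \<sigma>"
    using F.linear_imp_restrict_linear [OF \<sigma>] by (simp add: restrict_bar_cod)
  have surj: "\<sigma> ` carrier (restrict_scalars E ?F) = carrier (BT n)"
  proof
    show "\<sigma> ` carrier (restrict_scalars E ?F) \<subseteq> carrier (BT n)"
      using linear_map_closed [OF \<sigma>k] by blast
    show "carrier (BT n) \<subseteq> \<sigma> ` carrier (restrict_scalars E ?F)"
    proof
      fix X assume X: "X \<in> carrier (BT n)"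
      have "\<sigma> (basis_elem E X) = X"
        unfolding \<sigma>_def by (rule lincomb_basis [OF bar_left_module, where I = "carrier (bar n)"]) (use X in auto)
      moreover have "basis_elem E X \<in> carrier ?F" by (rule E.A.basis_elem_closed) (use X in simp)
      ultimately show "X \<in> \<sigma> ` carrier (restrict_scalars E ?F)" by (metis image_eqI restrict_scalars_simps(1))
    qed
  qed
  have o: "\<one> # l @ [\<one>] \<in> words (Suc (Suc n))" if "l \<in> words n" for l using that by auto
  obtain h where h: "multilinear k (replicate n A) (restrict_scalars E ?F) h"
    and \<sigma>h: "\<And>l. l \<in> words n \<Longrightarrow> \<sigma> (h l) = bp n (\<one> # l @ [\<one>])"
    using multilinear_lifting [OF assms F.restrict_scalars_module Tn_module \<sigma>k surj wrap_multilinear] by blast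
  have hc: "h m \<in> carrier ?F" if "m \<in> words n" for m
    using multilinear_closed [OF h] that by (simp add: tuples_replicate)
  show ?thesis
  proof (rule projective_moduleI [OF bar_left_module])
    show s: "linear_map E (bar n) ?F (bar_extend ?F h)" by (rule bar_extend_linear [OF F h])
    fix X assume "X \<in> carrier (bar n)"
    then have X: "X \<in> carrier (BT n)" by simp
    have "\<sigma> (bar_extend ?F h X) = X"
    proof (rule Tn_maps_eq [OF linear_map_comp [OF bar_extend_k_linear [OF F h] \<sigma>k] linear_map_id _ X])
      fix l assume l: "l \<in> words (Suc (Suc n))"
      then obtain x m y where xm: "l = x # m @ [y]" "m \<in> words n" "x \<in> carrier A" "y \<in> carrier A"
        by (rule words_Cons_snoc_cases)
      have "\<sigma> (bar_extend ?F h (bp n l)) = t x y \<odot>\<^bsub>bar n\<^esub> \<sigma> (h m)"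
        unfolding xm(1) bar_extend_pure [OF F h xm(3,4,2)]
        by (rule linear_map_smult [OF \<sigma> _ hc]) (use xm in auto)
      also have "\<dots> = bp n l"
        using xm bar_act_pure [OF xm(3,4) o [OF xm(2)]] by (simp add: \<sigma>h ends_Cons_snoc)
      finally show "\<sigma> (bar_extend ?F h (bp n l)) = bp n l" .
    qed
    then show "lincomb E (bar n) (\<lambda>q. q) (bar_extend ?F h X) = X" by (simp add: \<sigma>_def)
  qed
qed

text \<open>By \<open>bd_cone\<close> and \<open>bd_cone0\<close> a cycle is the boundary of its own
  cone, and \<open>cone0\<close> shows the augmentation to be onto.\<close>

lemma bar_resolution:
  assumes "projective_module k A"
  shows "projective_resolution E M bar bd aug"
  unfolding projective_resolution_def
proof (intro conjI allI M_left_module bar_projective [OF assms] bd_E_linear aug_E_linear)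
  show "aug ` carrier (bar 0) = carrier M"
  proof
    show "carrier M \<subseteq> aug ` carrier (bar 0)"
      by (rule subsetI, rule image_eqI [where x = "cone0 a" for a]) (auto simp: aug_cone0)
  qed auto
  show "bd 0 ` carrier (bar 1) = {p \<in> carrier (bar 0). aug p = \<zero>\<^bsub>M\<^esub>}"
  proof (intro equalityI subsetI)
    fix X assume "X \<in> bd 0 ` carrier (bar 1)"
    then show "X \<in> {p \<in> carrier (bar 0). aug p = \<zero>\<^bsub>M\<^esub>}" by (auto simp: aug_bd)
  next
    fix X assume "X \<in> {p \<in> carrier (bar 0). aug p = \<zero>\<^bsub>M\<^esub>}"
    then have "X \<in> carrier (BT 0)" "bd 0 (cone (Suc (Suc 0)) X) = X"
      by (auto simp: bd_cone0 cone0.f_zero Tn.T.M.minus_eq Tn.T.M.minus_zero_eq)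
    then show "X \<in> bd 0 ` carrier (bar 1)"
      by (intro image_eqI [where x = "cone (Suc (Suc 0)) X"]) (simp_all add: cone.f_closed)
  qed
  fix n
  show "bd (Suc n) ` carrier (bar (Suc (Suc n))) = {p \<in> carrier (bar (Suc n)). bd n p = \<zero>\<^bsub>bar n\<^esub>}"
  proof (intro equalityI subsetI)
    fix X assume "X \<in> bd (Suc n) ` carrier (bar (Suc (Suc n)))"
    then show "X \<in> {p \<in> carrier (bar (Suc n)). bd n p = \<zero>\<^bsub>bar n\<^esub>}" by (auto simp: bd_bd)
  next
    fix X assume "X \<in> {p \<in> carrier (bar (Suc n)). bd n p = \<zero>\<^bsub>bar n\<^esub>}"
    then have "X \<in> carrier (BT (Suc n))" "bd (Suc n) (cone (Suc (Suc (Suc n))) X) = X"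
      by (auto simp: bd_cone Tn.T.M.minus_eq Tn.T.M.minus_zero_eq)
    then show "X \<in> bd (Suc n) ` carrier (bar (Suc (Suc n)))"
      by (intro image_eqI [where x = "cone (Suc (Suc (Suc n))) X"]) simp_all
  qed
qed

subsection \<open>Hochschild cochains as bimodule maps\<close>

abbreviation "HC \<equiv> hochschild_cochains k A"
abbreviation "HD \<equiv> hochschild_diff k A"
abbreviation "ctb \<equiv> cochain_to_bar k A"
abbreviation "HB \<equiv> hom_complex E bar M"

lemma HC_carrier: "\<phi> \<in> carrier (HC n) \<longleftrightarrow> \<phi> \<in> extensional (carrier (Tn n)) \<and> linear_map k (Tn n) A \<phi>"
  by (simp add: hochschild_cochains_def hom_module_simps)

lemma HC_simps:
  "\<zero>\<^bsub>HC n\<^esub> = (\<lambda>p\<in>carrier (Tn n). \<zero>)"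
  "\<phi> \<oplus>\<^bsub>HC n\<^esub> \<psi> = (\<lambda>p\<in>carrier (Tn n). \<phi> p \<oplus> \<psi> p)"
  "r \<odot>\<^bsub>HC n\<^esub> \<phi> = (\<lambda>p\<in>carrier (Tn n). r \<odot> \<phi> p)"
  by (simp_all add: hochschild_cochains_def hom_module_simps)

lemma HC_module: "left_module k (HC n)"
  unfolding hochschild_cochains_def
  by (rule hom_module_left_module [OF Tn_module A_module A_module])
    (simp_all add: AM.lsmult_assoc [symmetric] A.R.m_comm)

lemma HB_carrier: "\<psi> \<in> carrier (HB n) \<longleftrightarrow>
    \<psi> \<in> extensional (carrier (BT n)) \<and> linear_map E (bar n) M \<psi>"
  by (simp add: hom_complex_carrier)

lemma HB_k_linear: "\<psi> \<in> carrier (HB n) \<Longrightarrow> linear_map k (BT n) A \<psi>"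
  using bar.linear_imp_restrict_linear [of n M \<psi>]
  by (simp add: HB_carrier restrict_bar_dom restrict_M_cod)

text \<open>\<open>cochain_to_bar\<close> is \<open>bar_extend\<close> into the regular bimodule,
  restricted to the carrier.\<close>

lemma ctb_closed: "\<phi> \<in> carrier (HC n) \<Longrightarrow> ctb n \<phi> \<in> carrier (HB n)"
  and ctb_pure: "\<lbrakk>\<phi> \<in> carrier (HC n); x \<in> carrier A; y \<in> carrier A; m \<in> words n\<rbrakk> \<Longrightarrow>
     ctb n \<phi> (bp n (x # m @ [y])) = x \<otimes> \<phi> (pe n m) \<otimes> y"
proof -
  assume "\<phi> \<in> carrier (HC n)"
  then have \<phi>: "linear_map k (Tn n) A \<phi>" by (simp add: HC_carrier)
  have g: "multilinear k (replicate n A) (restrict_scalars E M) (\<lambda>l. \<phi> (pe n l))"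
    by (simp add: restrict_M_multilinear multilinear_comp [OF Tn.pure_multilinear \<phi>])
  let ?h = "bar_extend M (\<lambda>l. \<phi> (pe n l))"
  have hk: "linear_map k (BT n) A ?h"
    using bar_extend_k_linear [OF M_left_module g] by (simp add: restrict_M_cod)
  have eq: "ctb n \<phi> = restrict ?h (carrier (bar n))"
    unfolding cochain_to_bar_def
  proof (rule restrict_ext)
    fix X assume "X \<in> carrier (bar n)"
    then have X: "X \<in> carrier (BT n)" by simp
    show "tensor_lift k A (\<lambda>l. hd l \<otimes> \<phi> (pe n (butlast (tl l))) \<otimes> last l) X = ?h X"
    proof (rule tensor_lift_eq [OF A_module hk _ X])
      fix l assume "l \<in> words (Suc (Suc n))"
      then obtain x m y where "l = x # m @ [y]" "m \<in> words n" "x \<in> carrier A" "y \<in> carrier A"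
        by (rule words_Cons_snoc_cases)
      then show "hd l \<otimes> \<phi> (pe n (butlast (tl l))) \<otimes> last l = ?h (bp n l)"
        using linear_map_closed [OF \<phi> pe_closed, of m] by (simp add: bar_extend_pure [OF M_left_module g])
    qed
  qed
  show "ctb n \<phi> \<in> carrier (HB n)"
    using bar_extend_linear [OF M_left_module g]
    unfolding eq hom_complex_carrier by (simp only: linear_map_restrict [OF bar_left_module]) simp
  show "ctb n \<phi> (bp n (x # m @ [y])) = x \<otimes> \<phi> (pe n m) \<otimes> y"
    if "x \<in> carrier A" "y \<in> carrier A" "m \<in> words n"
    using that linear_map_closed [OF \<phi> pe_closed, of m]
    by (simp add: eq bar_extend_pure [OF M_left_module g])
qed

lemma HB_eqI:
  assumes "\<psi> \<in> carrier (HB n)" "\<psi>' \<in> carrier (HB n)"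
    and "\<And>x m y. \<lbrakk>x \<in> carrier A; m \<in> words n; y \<in> carrier A\<rbrakk> \<Longrightarrow>
      \<psi> (bp n (x # m @ [y])) = \<psi>' (bp n (x # m @ [y]))"
  shows "\<psi> = \<psi>'"
proof (rule extensionalityI)
  show "\<psi> \<in> extensional (carrier (BT n))" "\<psi>' \<in> extensional (carrier (BT n))"
    using assms by (auto simp: HB_carrier)
  fix X assume X: "X \<in> carrier (BT n)"
  show "\<psi> X = \<psi>' X"
    by (rule Tn_maps_eq [OF HB_k_linear [OF assms(1)] HB_k_linear [OF assms(2)] _ X])
      (elim words_Cons_snoc_cases, simp add: assms(3))
qed

lemma HC_eqI:
  assumes "\<phi> \<in> carrier (HC n)" "\<phi>' \<in> carrier (HC n)"
    and "\<And>l. l \<in> words n \<Longrightarrow> \<phi> (pe n l) = \<phi>' (pe n l)"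
  shows "\<phi> = \<phi>'"
proof (rule extensionalityI)
  show "\<phi> \<in> extensional (carrier (Tn n))" "\<phi>' \<in> extensional (carrier (Tn n))"
    using assms by (auto simp: HC_carrier)
  fix X assume X: "X \<in> carrier (Tn n)"
  show "\<phi> X = \<phi>' X"
    by (rule Tn_maps_eq [OF _ _ _ X]) (use assms in \<open>auto simp: HC_carrier\<close>)
qed

text \<open>With unit outer letters the image of \<phi> returns the values of \<phi>.\<close>

lemma ctb_inj: "\<lbrakk>\<phi> \<in> carrier (HC n); \<phi>' \<in> carrier (HC n); ctb n \<phi> = ctb n \<phi>'\<rbrakk> \<Longrightarrow> \<phi> = \<phi>'"
proof (rule HC_eqI)
  fix l assume c: "\<phi> \<in> carrier (HC n)" "\<phi>' \<in> carrier (HC n)" "ctb n \<phi> = ctb n \<phi>'" and l: "l \<in> words n"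
  have "\<phi> (pe n l) \<in> carrier A" "\<phi>' (pe n l) \<in> carrier A"
    using c l by (auto simp: HC_carrier intro: linear_map_closed)
  then show "\<phi> (pe n l) = \<phi>' (pe n l)"
    using ctb_pure [OF c(1) A.A.one_closed A.A.one_closed l] ctb_pure [OF c(2) A.A.one_closed A.A.one_closed l] c(3)
    by simp
qed

text \<open>A bimodule map is determined on words with unit outer letters; restricting \<psi> along
  \<open>wrap\<close> gives the cochain.\<close>

lemma ctb_surj:
  assumes \<psi>: "\<psi> \<in> carrier (HB n)"
  obtains \<phi> where "\<phi> \<in> carrier (HC n)" "ctb n \<phi> = \<psi>"
proof
  let ?\<phi> = "\<lambda>X\<in>carrier (Tn n). \<psi> (wrap n X)"
  show c: "?\<phi> \<in> carrier (HC n)"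
    using linear_map_comp [OF wrap_linear HB_k_linear [OF \<psi>]]
    by (simp add: HC_carrier linear_map_restrict [OF Tn_module])
  have \<psi>E: "linear_map E (bar n) M \<psi>" using \<psi> by (simp add: HB_carrier)
  show "ctb n ?\<phi> = \<psi>"
  proof (rule HB_eqI [OF ctb_closed [OF c] \<psi>])
    fix x m y assume x: "x \<in> carrier A" and m: "m \<in> words n" and y: "y \<in> carrier A"
    have o: "\<one> # m @ [\<one>] \<in> words (Suc (Suc n))" using m by auto
    have "\<psi> (bp n (x # m @ [y])) =
        \<psi> (t x y \<odot>\<^bsub>bar n\<^esub> bp n (\<one> # m @ [\<one>]))"
      using x y by (simp add: bar_act_pure [OF x y o] ends_Cons_snoc)
    also have "\<dots> = x \<otimes> \<psi> (bp n (\<one> # m @ [\<one>])) \<otimes> y"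
      using linear_map_smult [OF \<psi>E, of "t x y"] x y o linear_map_closed [OF HB_k_linear [OF \<psi>] pe_closed]
      by simp
    finally show "ctb n ?\<phi> (bp n (x # m @ [y])) = \<psi> (bp n (x # m @ [y]))"
      using m by (simp add: ctb_pure [OF c x y m] wrap_pure)
  qed
qed

lemma ctb_linear: "linear_map k (HC n) (HB n) (ctb n)"
proof (rule linear_mapI)
  interpret HC: left_module k "HC n" by (rule HC_module)
  interpret HB: left_module k "HB n"
    by (rule hom_complex_module [where P = bar, OF M.algebra_module_axioms bar_left_module])
  note cl = linear_map_closed [of k "Tn n" A]
  fix \<phi> assume \<phi>: "\<phi> \<in> carrier (HC n)"
  show "ctb n \<phi> \<in> carrier (HB n)" by (rule ctb_closed [OF \<phi>])
  { fix \<psi> assume \<psi>: "\<psi> \<in> carrier (HC n)"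
    show "ctb n (\<phi> \<oplus>\<^bsub>HC n\<^esub> \<psi>) = ctb n \<phi> \<oplus>\<^bsub>HB n\<^esub> ctb n \<psi>"
    proof (rule HB_eqI)
      fix x m y assume x: "x \<in> carrier A" and m: "m \<in> words n" and y: "y \<in> carrier A"
      have "\<phi> (pe n m) \<in> carrier A" "\<psi> (pe n m) \<in> carrier A"
        using \<phi> \<psi> m by (auto simp: HC_carrier intro: linear_map_closed)
      then show "ctb n (\<phi> \<oplus>\<^bsub>HC n\<^esub> \<psi>) (bp n (x # m @ [y])) =
          (ctb n \<phi> \<oplus>\<^bsub>HB n\<^esub> ctb n \<psi>) (bp n (x # m @ [y]))"
        using x y m ctb_pure [OF HC.M.a_closed [OF \<phi> \<psi>] x y m] ctb_pure [OF \<phi> x y m] ctb_pure [OF \<psi> x y m]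
        by (simp add: HC_simps hom_complex_simps A.A.l_distr A.A.r_distr)
    qed (simp_all add: ctb_closed \<phi> \<psi>) }
  { fix r assume r: "r \<in> carrier k"
    show "ctb n (r \<odot>\<^bsub>HC n\<^esub> \<phi>) = r \<odot>\<^bsub>HB n\<^esub> ctb n \<phi>"
    proof (rule HB_eqI)
      fix x m y assume x: "x \<in> carrier A" and m: "m \<in> words n" and y: "y \<in> carrier A"
      have "\<phi> (pe n m) \<in> carrier A" using \<phi> m by (auto simp: HC_carrier intro: linear_map_closed)
      then show "ctb n (r \<odot>\<^bsub>HC n\<^esub> \<phi>) (bp n (x # m @ [y])) =
          (r \<odot>\<^bsub>HB n\<^esub> ctb n \<phi>) (bp n (x # m @ [y]))"
        using x y m r ctb_pure [OF HC.lsmult_closed [OF r \<phi>] x y m] ctb_pure [OF \<phi> x y m]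
        by (simp add: HC_simps hom_complex_simps A.smult_mult_left A.smult_mult_right)
    qed (simp_all add: ctb_closed \<phi> r) }
qed

abbreviation "hochschild_formula n \<phi> l \<equiv>
    hd l \<otimes> \<phi> (pe n (tl l))
      \<oplus> (\<Oplus>i\<in>{..<n}. signed A (Suc i) (\<phi> (pe n (contract A i l))))
      \<oplus> signed A (Suc n) (\<phi> (pe n (butlast l)) \<otimes> last l)"

text \<open>Face \<open>0\<close> merges \<open>a\<close> with the first letter and gives the first
  Hochschild term, face \<open>Suc n\<close> merges the last letter with \<open>b\<close> and gives
  the last one. An inner face \<open>Suc i\<close> is the merge at \<open>i\<close> of
  \<open>l\<close>, which explains the sign index \<open>Suc i\<close>.\<close>

lemma ctb_bd:
  assumes \<phi>: "\<phi> \<in> carrier (HC n)" and l: "l \<in> words (Suc n)" and a: "a \<in> carrier A" and b: "b \<in> carrier A"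
  shows "ctb n \<phi> (bd n (bp (Suc n) (a # l @ [b]))) = a \<otimes> hochschild_formula n \<phi> l \<otimes> b"
proof -
  let ?T = "BT n" and ?pe = "bp n"
  have \<phi>c: "\<phi> (pe n m) \<in> carrier A" if "m \<in> words n" for m
    using \<phi> that by (auto simp: HC_carrier intro: linear_map_closed)
  interpret c: linear_hom k ?T A "ctb n \<phi>"
    by (rule linear_homI [OF Tn_module A_module HB_k_linear [OF ctb_closed [OF \<phi>]]])
  interpret ab: linear_hom k A A "\<lambda>x. a \<otimes> x \<otimes> b"
    by (rule linear_homI [OF A_module A_module linear_map_comp [OF mult_left_linear [OF a] mult_right_linear [OF b]]])
  obtain x l1 where x: "l = x # l1" "x \<in> carrier A" "l1 \<in> words n" using l by (cases l) auto
  obtain l2 y where y: "l = l2 @ [y]" "y \<in> carrier A" "l2 \<in> words n" using l by (cases l rule: rev_cases) auto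
  have w: "a # l @ [b] \<in> words (Suc (Suc (Suc n)))" using l a b by auto
  have cw: "contract A i (a # l @ [b]) \<in> words (Suc (Suc n))" if "i \<le> Suc n" for i
    using contract_words [OF w] that by auto
  have cl: "contract A i l \<in> words n" if "i < n" for i
    using contract_words [OF l that] .
  define F where "F i = signed A i (ctb n \<phi> (?pe (contract A i (a # l @ [b]))))" for i
  have Fc: "F \<in> {..<Suc (Suc n)} \<rightarrow> carrier A" using cw by (auto simp: F_def)
  have "ctb n \<phi> (bd n (bp (Suc n) (a # l @ [b]))) =
      (\<Oplus>i\<in>{..Suc n}. ctb n \<phi> (signed ?T i (?pe (contract A i (a # l @ [b])))))"
    unfolding bd_pure [OF w] by (rule c.f_finsum) (use cw in auto)
  also have "\<dots> = (\<Oplus>i\<in>{..<Suc (Suc n)}. F i)"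
    unfolding lessThan_Suc_atMost
    by (rule A.M.finsum_cong') (use cw in \<open>simp_all add: F_def c.f_signed Pi_def\<close>)
  also have "\<dots> = F 0 \<oplus> (F (Suc n) \<oplus> (\<Oplus>i\<in>{..<n}. F (Suc i)))"
    by (rule A.M.finsum_ends [OF Fc])
  also have "F 0 = a \<otimes> (x \<otimes> \<phi> (pe n l1)) \<otimes> b"
    using x a b \<phi>c [OF x(3)] ctb_pure [OF \<phi> _ b x(3), of "a \<otimes> x"]
    by (simp add: F_def signed_def contract_Cons_0 A.A.m_assoc)
  also have "F (Suc n) = a \<otimes> signed A (Suc n) (\<phi> (pe n l2) \<otimes> y) \<otimes> b"
  proof -
    have "contract A (Suc n) (a # l @ [b]) = a # l2 @ [y \<otimes> b]"
      using contract_last [of A l2 y b] y by (simp add: contract_Cons)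
    then have "F (Suc n) = signed A (Suc n) (a \<otimes> (\<phi> (pe n l2) \<otimes> y) \<otimes> b)"
      using y a b \<phi>c [OF y(3)] ctb_pure [OF \<phi> a _ y(3), of "y \<otimes> b"]
      by (simp add: F_def A.A.m_assoc)
    then show ?thesis using y \<phi>c [OF y(3)] by (simp add: ab.f_signed)
  qed
  also have "(\<Oplus>i\<in>{..<n}. F (Suc i)) =
      (\<Oplus>i\<in>{..<n}. a \<otimes> signed A (Suc i) (\<phi> (pe n (contract A i l))) \<otimes> b)"
  proof (rule A.M.finsum_cong')
    fix i assume "i \<in> {..<n}"
    then have i: "i < n" by simp
    have "contract A (Suc i) (a # l @ [b]) = a # contract A i l @ [b]"
      using i l by (simp add: contract_Cons contract_snoc)
    then show "F (Suc i) = a \<otimes> signed A (Suc i) (\<phi> (pe n (contract A i l))) \<otimes> b"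
      using \<phi>c [OF cl [OF i]] by (simp add: F_def ctb_pure [OF \<phi> a b cl [OF i]] ab.f_signed)
  qed (use cl \<phi>c a b in \<open>auto simp: Pi_def\<close>)
  also have "\<dots> = a \<otimes> (\<Oplus>i\<in>{..<n}. signed A (Suc i) (\<phi> (pe n (contract A i l)))) \<otimes> b"
    by (rule ab.f_finsum [symmetric]) (use cl \<phi>c in \<open>auto simp: Pi_def\<close>)
  finally have *: "ctb n \<phi> (bd n (bp (Suc n) (a # l @ [b]))) =
    a \<otimes> (x \<otimes> \<phi> (pe n l1)) \<otimes> b \<oplus>
    (a \<otimes> signed A (Suc n) (\<phi> (pe n l2) \<otimes> y) \<otimes> b \<oplus>
     a \<otimes> (\<Oplus>i\<in>{..<n}. signed A (Suc i) (\<phi> (pe n (contract A i l)))) \<otimes> b)" .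
  have S: "(\<Oplus>i\<in>{..<n}. signed A (Suc i) (\<phi> (pe n (contract A i l)))) \<in> carrier A"
    by (rule A.M.finsum_closed) (use cl \<phi>c in \<open>auto simp: Pi_def\<close>)
  have hl: "hd l = x" "tl l = l1" using x(1) by simp_all
  have ll: "butlast l = l2" "last l = y" using y(1) by simp_all
  have X1: "x \<otimes> \<phi> (pe n l1) \<in> carrier A" using x \<phi>c by simp
  have Y1: "signed A (Suc n) (\<phi> (pe n l2) \<otimes> y) \<in> carrier A" using y \<phi>c by simp
  show ?thesis
    unfolding * hl ll using S X1 Y1 a b by (simp add: A.M.a_ac)
qed

text \<open>Taking unit outer letters in \<open>ctb_bd\<close> writes the Hochschild formula as a
  composite of linear maps, through \<open>wrap\<close> and the bar differential; that the formula
  is linear follows without expanding it.\<close>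

lemma HD_pure:
  assumes \<phi>: "\<phi> \<in> carrier (HC n)"
  shows HD_closed: "HD n \<phi> \<in> carrier (HC (Suc n))"
    and "l \<in> words (Suc n) \<Longrightarrow> HD n \<phi> (pe (Suc n) l) = hochschild_formula n \<phi> l"
proof -
  let ?h = "\<lambda>X. ctb n \<phi> (bd n (wrap (Suc n) X))"
  have \<phi>c: "\<phi> (pe n m) \<in> carrier A" if "m \<in> words n" for m
    using \<phi> that by (auto simp: HC_carrier intro: linear_map_closed)
  have h: "linear_map k (Tn (Suc n)) A ?h"
    by (rule linear_map_comp [OF linear_map_comp [OF wrap_linear bd_linear] HB_k_linear [OF ctb_closed [OF \<phi>]]])
  have fc: "hochschild_formula n \<phi> l \<in> carrier A" if l: "l \<in> words (Suc n)" for l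
  proof -
    have "tl l \<in> words n" "butlast l \<in> words n" "hd l \<in> carrier A" "last l \<in> carrier A"
      using l by (cases l; auto dest: in_set_butlastD simp: subset_iff split: if_splits)+
    then show ?thesis
      using contract_words [OF l] \<phi>c
      by (intro A.M.a_closed A.M.finsum_closed AM.signed_closed A.A.m_closed) auto
  qed
  have eq: "hochschild_formula n \<phi> l = ?h (pe (Suc n) l)" if l: "l \<in> words (Suc n)" for l
    using ctb_bd [OF \<phi> l A.A.one_closed A.A.one_closed] fc [OF l] by (simp add: wrap_pure [OF l])
  have HD: "HD n \<phi> = restrict ?h (carrier (Tn (Suc n)))"
    unfolding hochschild_diff_def
    by (rule restrict_ext, rule tensor_lift_eq [OF A_module h eq])
  show "HD n \<phi> \<in> carrier (HC (Suc n))"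
    using h by (simp add: HD HC_carrier linear_map_restrict [OF Tn_module])
  show "l \<in> words (Suc n) \<Longrightarrow> HD n \<phi> (pe (Suc n) l) = hochschild_formula n \<phi> l"
    by (simp add: HD eq)
qed

lemma ctb_HD:
  assumes \<phi>: "\<phi> \<in> carrier (HC n)"
  shows "ctb (Suc n) (HD n \<phi>) = hom_diff bar bd n (ctb n \<phi>)"
proof (rule HB_eqI [OF ctb_closed [OF HD_closed [OF \<phi>]]])
  have "linear_map E (bar n) M (ctb n \<phi>)" using ctb_closed [OF \<phi>] by (simp add: HB_carrier)
  from linear_map_comp [OF bd_E_linear this] show "hom_diff bar bd n (ctb n \<phi>) \<in> carrier (HB (Suc n))"
    unfolding hom_complex_carrier hom_diff_def by (simp only: linear_map_restrict [OF bar_left_module]) simp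
  fix x m y assume "x \<in> carrier A" "m \<in> words (Suc n)" "y \<in> carrier A"
  then show "ctb (Suc n) (HD n \<phi>) (bp (Suc n) (x # m @ [y])) =
      hom_diff bar bd n (ctb n \<phi>) (bp (Suc n) (x # m @ [y]))"
    by (simp add: ctb_pure [OF HD_closed [OF \<phi>]] HD_pure(2) [OF \<phi>] hom_diff_def ctb_bd [OF \<phi>])
qed

end

lemma (in abelian_group) minus_imp_eq:
  assumes "x \<ominus> y = \<zero>" "x \<in> carrier G" "y \<in> carrier G" shows "x = y"
proof -
  have "x = (x \<ominus> y) \<oplus> y" using assms(2,3) by (simp add: minus_eq a_assoc l_neg)
  then show ?thesis using assms by simp
qed

section \<open>The derivation on the bar resolution\<close>

context hoch_der
begin

definition der :: "nat \<Rightarrow> ('a list \<Rightarrow> 'k) set \<Rightarrow> ('a list \<Rightarrow> 'k) set" where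
  "der n = tensor_lift k (Tn n) (\<lambda>l. \<Oplus>\<^bsub>Tn n\<^esub>j\<in>{..<n}. pe n (l[j := \<delta> (l ! j)]))"

lemma der_word: "\<lbrakk>l \<in> words n; j < n\<rbrakk> \<Longrightarrow> l[j := \<delta> (l ! j)] \<in> words n"
  using set_update_subset_insert [of l j "\<delta> (l ! j)"] by (auto simp: subset_iff)

lemma der_multilinear:
  "multilinear k (replicate n A) (Tn n) (\<lambda>l. \<Oplus>\<^bsub>Tn n\<^esub>j\<in>{..<n}. pe n (l[j := \<delta> (l ! j)]))"
proof (rule multilinear_finsum [OF Tn_module])
  fix j assume "j \<in> {..<n}"
  then have j: "j < n" by simp
  show "multilinear k (replicate n A) (Tn n) (\<lambda>l. pe n (l[j := \<delta> (l ! j)]))"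
  proof (rule words_pullback [OF Tn.pure_multilinear])
    fix l i assume l: "l \<in> words n" and i: "i < n"
    show "\<exists>i'<n. \<exists>f. linear_map k A A f \<and>
        (\<forall>x\<in>carrier A. (l[i := x])[j := \<delta> (l[i := x] ! j)] = (l[j := \<delta> (l ! j)])[i' := f x])"
    proof (cases "i = j")
      case True
      then show ?thesis using l i
        by (intro exI [where x = j] conjI exI [where x = \<delta>] \<delta>.d.lin) auto
    next
      case False
      then show ?thesis using l i
        by (intro exI [where x = i] conjI exI [where x = "\<lambda>x. x"] linear_map_id) (auto simp: list_update_swap)
    qed
  qed (use der_word j in auto)
qed (use A_module in auto)

lemma der_linear: "linear_map k (Tn n) (Tn n) (der n)"
  unfolding der_def by (rule Tn.tensor_lift_linear [OF Tn_module der_multilinear])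

lemma der_pure: "l \<in> words n \<Longrightarrow> der n (pe n l) = (\<Oplus>\<^bsub>Tn n\<^esub>j\<in>{..<n}. pe n (l[j := \<delta> (l ! j)]))"
  unfolding der_def by (rule Tn.tensor_lift_pure [OF Tn_module der_multilinear]) (simp add: tuples_replicate)

sublocale der: linear_hom k "Tn n" "Tn n" "der n" for n
  by (rule linear_homI [OF Tn_module Tn_module der_linear])

lemma der_Cons_snoc:
  assumes x: "x \<in> carrier A" and y: "y \<in> carrier A" and m: "m \<in> words n"
  shows "der (Suc (Suc n)) (bp n (x # m @ [y])) =
    bp n (\<delta> x # m @ [y]) \<oplus>\<^bsub>BT n\<^esub>
    (bp n (x # m @ [\<delta> y]) \<oplus>\<^bsub>BT n\<^esub>
     (\<Oplus>\<^bsub>BT n\<^esub>j\<in>{..<n}. bp n (x # m[j := \<delta> (m ! j)] @ [y])))"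
proof -
  let ?l = "x # m @ [y]"
  have w: "?l \<in> words (Suc (Suc n))" using x y m by auto
  have "der (Suc (Suc n)) (bp n ?l) =
     bp n (?l[0 := \<delta> (?l ! 0)]) \<oplus>\<^bsub>BT n\<^esub>
     (bp n (?l[Suc n := \<delta> (?l ! Suc n)]) \<oplus>\<^bsub>BT n\<^esub>
      (\<Oplus>\<^bsub>BT n\<^esub>j\<in>{..<n}. bp n (?l[Suc j := \<delta> (?l ! Suc j)])))"
    unfolding der_pure [OF w]
    by (rule Tn.T.M.finsum_ends) (use der_word [OF w] in auto)
  also have "(\<Oplus>\<^bsub>BT n\<^esub>j\<in>{..<n}. bp n (?l[Suc j := \<delta> (?l ! Suc j)])) =
     (\<Oplus>\<^bsub>BT n\<^esub>j\<in>{..<n}. bp n (x # m[j := \<delta> (m ! j)] @ [y]))"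
    by (rule Tn.T.M.finsum_cong')
      (use m x y der_word [OF m] in \<open>simp_all add: nth_append list_update_append Pi_def\<close>)
  finally show ?thesis using m by (simp add: nth_append list_update_append)
qed

lemma pe_zero_Cons: "l \<in> words n \<Longrightarrow> pe (Suc n) (\<zero> # l) = \<zero>\<^bsub>Tn (Suc n)\<^esub>"
  by (rule linear_map_0 [OF A_module Tn_module pe_Cons_linear])

text \<open>The summand that differentiates the prepended unit vanishes by
  \<open>\<delta>.d_one\<close>.\<close>

lemma der_cone:
  assumes X: "X \<in> carrier (Tn n)" shows "der (Suc n) (cone n X) = cone n (der n X)"
proof (rule Tn_maps_eq [OF linear_map_comp [OF cone_linear der_linear] linear_map_comp [OF der_linear cone_linear] _ X])
  fix l assume l: "l \<in> words n"
  have w: "\<one> # l \<in> words (Suc n)" using l by auto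
  have "der (Suc n) (cone n (pe n l)) =
      (\<Oplus>\<^bsub>Tn (Suc n)\<^esub>j\<in>{..<Suc n}. pe (Suc n) ((\<one> # l)[j := \<delta> ((\<one> # l) ! j)]))"
    by (simp only: cone_pure [OF l] der_pure [OF w])
  also have "\<dots> = pe (Suc n) ((\<one> # l)[0 := \<delta> ((\<one> # l) ! 0)]) \<oplus>\<^bsub>Tn (Suc n)\<^esub>
      (\<Oplus>\<^bsub>Tn (Suc n)\<^esub>j\<in>{..<n}. pe (Suc n) ((\<one> # l)[Suc j := \<delta> ((\<one> # l) ! Suc j)]))"
    by (rule Tn.T.M.finsum_lessThan_Suc_shift) (use der_word [OF w] in auto)
  also have "pe (Suc n) ((\<one> # l)[0 := \<delta> ((\<one> # l) ! 0)]) = \<zero>\<^bsub>Tn (Suc n)\<^esub>"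
    using pe_zero_Cons [OF l] by (simp add: \<delta>.d_one)
  also have "(\<Oplus>\<^bsub>Tn (Suc n)\<^esub>j\<in>{..<n}. pe (Suc n) ((\<one> # l)[Suc j := \<delta> ((\<one> # l) ! Suc j)])) =
      (\<Oplus>\<^bsub>Tn (Suc n)\<^esub>j\<in>{..<n}. cone n (pe n (l[j := \<delta> (l ! j)])))"
    by (rule Tn.T.M.finsum_cong') (use der_word [OF l] in \<open>simp_all add: cone_pure Pi_def\<close>)
  also have "\<dots> = cone n (der n (pe n l))"
    unfolding der_pure [OF l] by (rule cone.f_finsum [symmetric]) (use der_word [OF l] in auto)
  finally show "der (Suc n) (cone n (pe n l)) = cone n (der n (pe n l))" using l by simp
qed

lemma der_cone0: "a \<in> carrier A \<Longrightarrow> der (Suc (Suc 0)) (cone0 a) = cone0 (\<delta> a)"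
  using der_Cons_snoc [of "\<one>" a "[]" 0] pe_zero_Cons [of "[a]" "Suc 0"]
  by (simp add: \<delta>.d_one)

lemma aug_der:
  assumes X: "X \<in> carrier (BT 0)" shows "aug (der (Suc (Suc 0)) X) = \<delta> (aug X)"
proof (rule Tn_maps_eq [OF linear_map_comp [OF der_linear aug_linear] linear_map_comp [OF aug_linear \<delta>.d.lin] _ X])
  fix l assume "l \<in> words (Suc (Suc 0))"
  then obtain x y where "x \<in> carrier A" "y \<in> carrier A" "l = [x, y]" unfolding words_2 by blast
  then show "aug (der (Suc (Suc 0)) (bp 0 l)) = \<delta> (aug (bp 0 l))"
    using der_Cons_snoc [of x y "[]" 0] by (simp add: aug_pure \<delta>.d_mult)
qed

lemma pe_snoc_linear:
  assumes x: "x \<in> carrier A" and m: "m \<in> words n"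
  shows "linear_map k A (BT n) (\<lambda>y. bp n (x # m @ [y]))"
  using multilinear_linear [OF Tn.pure_multilinear, of "x # m @ [\<zero>]" "Suc (Suc n)" "Suc n"] assms
  by (auto simp: tuples_replicate list_update_append)

text \<open>The Leibniz rule splits the derivative of each outer letter \<open>a \<otimes> x\<close>
  and \<open>y \<otimes> b\<close> in two. The parts with \<delta> on \<open>a\<close> or
  \<open>b\<close> make up the action of \<open>\<delta>e (t a b)\<close>, the remaining parts and
  the inner sum are \<open>t a b\<close> acting on the derivative of the word.\<close>

lemma der_d_operator: "d_operator k E \<delta>e (bar n) (der (Suc (Suc n)))"
proof (rule env_d_operatorI [OF bar_left_module])
  let ?n = "Suc (Suc n)"
  show "linear_map k (restrict_scalars E (bar n)) (restrict_scalars E (bar n)) (der ?n)"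
    by (simp add: restrict_bar_dom restrict_bar_cod der_linear)
  fix a b X assume ab: "a \<in> carrier A" "b \<in> carrier A" and "X \<in> carrier (bar n)"
  then have X: "X \<in> carrier (Tn ?n)" by simp
  have tab: "t a b \<in> carrier E" using ab by simp
  have dt: "\<delta>e (t a b) \<in> carrier E" by (rule linear_map_closed [OF de_linear tab])
  interpret act: linear_hom k "Tn ?n" "Tn ?n" "\<lambda>X. t a b \<odot>\<^bsub>bar n\<^esub> X"
    by (rule linear_homI [OF Tn_module Tn_module bar_act_linear_right [OF tab]])
  have "der ?n (t a b \<odot>\<^bsub>bar n\<^esub> X) = \<delta>e (t a b) \<odot>\<^bsub>bar n\<^esub> X \<oplus>\<^bsub>Tn ?n\<^esub> t a b \<odot>\<^bsub>bar n\<^esub> der ?n X"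
  proof (rule Tn_maps_eq [OF linear_map_comp [OF bar_act_linear_right [OF tab] der_linear]
        linear_map_plus_map [OF Tn_module bar_act_linear_right [OF dt]
          linear_map_comp [OF der_linear bar_act_linear_right [OF tab]]] _ X])
    fix l assume "l \<in> words ?n"
    then obtain x m y where l: "l = x # m @ [y]" and m: "m \<in> words n" and x: "x \<in> carrier A" and y: "y \<in> carrier A"
      by (rule words_Cons_snoc_cases)
    have act: "t a' b' \<odot>\<^bsub>bar n\<^esub> pe ?n (x' # m' @ [y']) = pe ?n ((a' \<otimes> x') # m' @ [y' \<otimes> b'])"
      if "a' \<in> carrier A" "b' \<in> carrier A" "x' \<in> carrier A" "m' \<in> words n" "y' \<in> carrier A" for a' b' x' m' y'
      using that bar_act_pure [of a' b' "x' # m' @ [y']" n] by (simp add: ends_Cons_snoc)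
    have cl: "pe ?n (x' # m' @ [y']) \<in> carrier (Tn ?n)"
      if "x' \<in> carrier A" "m' \<in> words n" "y' \<in> carrier A" for x' m' y'
      using that by simp
    \<comment> \<open>The summands with \<delta> on an inner letter, the same on both sides.\<close>
    define S where "S = (\<Oplus>\<^bsub>Tn ?n\<^esub>j\<in>{..<n}. pe ?n ((a \<otimes> x) # m[j := \<delta> (m ! j)] @ [y \<otimes> b]))"
    have mj: "m[j := \<delta> (m ! j)] \<in> words n" if "j < n" for j by (rule der_word [OF m that])
    have Sc: "S \<in> carrier (Tn ?n)"
      unfolding S_def by (rule Tn.T.M.finsum_closed) (use mj cl ab x y in auto)
    have S: "t a b \<odot>\<^bsub>bar n\<^esub> (\<Oplus>\<^bsub>Tn ?n\<^esub>j\<in>{..<n}. pe ?n (x # m[j := \<delta> (m ! j)] @ [y])) = S"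
      unfolding S_def
      by (subst act.f_finsum, simp, use mj cl x y in force, rule Tn.T.M.finsum_cong')
        (use mj cl act ab x y in \<open>simp_all add: Pi_def\<close>)
    have Sc': "(\<Oplus>\<^bsub>Tn ?n\<^esub>j\<in>{..<n}. pe ?n (x # m[j := \<delta> (m ! j)] @ [y])) \<in> carrier (Tn ?n)"
      by (rule Tn.T.M.finsum_closed) (use mj cl x y in auto)
    let ?p = "\<lambda>x y. pe ?n (x # m @ [y])"
    have Lx: "?p (u \<oplus> v) z = ?p u z \<oplus>\<^bsub>Tn ?n\<^esub> ?p v z" if "u \<in> carrier A" "v \<in> carrier A" "z \<in> carrier A" for u v z
      using linear_map_add [OF pe_Cons_linear [of "m @ [z]" "Suc n"] that(1,2)] m that(3) by simp
    have Ly: "?p z (u \<oplus> v) = ?p z u \<oplus>\<^bsub>Tn ?n\<^esub> ?p z v" if "u \<in> carrier A" "v \<in> carrier A" "z \<in> carrier A" for u v z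
      using linear_map_add [OF pe_snoc_linear [OF that(3) m] that(1,2)] .
    have lhs: "der ?n (t a b \<odot>\<^bsub>bar n\<^esub> pe ?n l) =
       ?p (\<delta> (a \<otimes> x)) (y \<otimes> b) \<oplus>\<^bsub>Tn ?n\<^esub> (?p (a \<otimes> x) (\<delta> (y \<otimes> b)) \<oplus>\<^bsub>Tn ?n\<^esub> S)"
      unfolding l act [OF ab x m y] S_def by (rule der_Cons_snoc) (use ab x y m in auto)
    have r1: "\<delta>e (t a b) \<odot>\<^bsub>bar n\<^esub> pe ?n l = ?p (\<delta> a \<otimes> x) (y \<otimes> b) \<oplus>\<^bsub>Tn ?n\<^esub> ?p (a \<otimes> x) (y \<otimes> \<delta> b)"
      unfolding l de_pure [OF ab]
      using linear_map_add [OF bar_act_linear_left [OF cl [OF x m y]], of "t (\<delta> a) b" "t a (\<delta> b)"] ab x y m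
      by (simp add: act)
    have r2: "t a b \<odot>\<^bsub>bar n\<^esub> der ?n (pe ?n l) = ?p (a \<otimes> \<delta> x) (y \<otimes> b) \<oplus>\<^bsub>Tn ?n\<^esub>
        (?p (a \<otimes> x) (\<delta> y \<otimes> b) \<oplus>\<^bsub>Tn ?n\<^esub> S)"
      unfolding l der_Cons_snoc [OF x y m] using x y m ab Sc' by (simp add: act S)
    show "der ?n (t a b \<odot>\<^bsub>bar n\<^esub> pe ?n l) =
        \<delta>e (t a b) \<odot>\<^bsub>bar n\<^esub> pe ?n l \<oplus>\<^bsub>Tn ?n\<^esub> t a b \<odot>\<^bsub>bar n\<^esub> der ?n (pe ?n l)"
      unfolding lhs r1 r2 using x y m ab Sc by (simp add: \<delta>.d_mult Lx Ly Tn.T.M.a_ac)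
  qed
  then show "der ?n (t a b \<odot>\<^bsub>bar n\<^esub> X) = \<delta>e (t a b) \<odot>\<^bsub>bar n\<^esub> X \<oplus>\<^bsub>bar n\<^esub> t a b \<odot>\<^bsub>bar n\<^esub> der ?n X"
    by simp
qed

lemma bar_minus: "x \<ominus>\<^bsub>bar n\<^esub> y = x \<ominus>\<^bsub>BT n\<^esub> y"
  by (simp add: a_minus_def a_inv_def m_inv_def)

lemma M_minus: "x \<ominus>\<^bsub>M\<^esub> y = x \<ominus> y"
  by (simp add: a_minus_def a_inv_def m_inv_def)

text \<open>Neither side is a bimodule map, but the difference is, by
  \<open>de.d_operator_defect_linear\<close>; hence it may be tested on cones. There
  \<open>der_cone\<close> moves the derivation past the cone, and what remains is the claim one
  degree lower, or \<open>aug_der\<close> at the bottom.\<close>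

lemma der_bd:
  "X \<in> carrier (BT (Suc n)) \<Longrightarrow>
    der (Suc (Suc n)) (bd n X) = bd n (der (Suc (Suc (Suc n))) X)"
proof -
  have gen: "der (Suc (Suc n)) (bd n X) = bd n (der (Suc (Suc (Suc n))) X)"
    if eq: "\<And>X. X \<in> carrier (BT n) \<Longrightarrow>
      der (Suc (Suc n)) (bd n (cone (Suc (Suc n)) X)) = bd n (der (Suc (Suc (Suc n))) (cone (Suc (Suc n)) X))"
    and X: "X \<in> carrier (BT (Suc n))" for n X
  proof -
    have "der (Suc (Suc n)) (bd n X) \<ominus>\<^bsub>bar n\<^esub> bd n (der (Suc (Suc (Suc n))) X) = \<zero>\<^bsub>bar n\<^esub>"
      by (rule bar_maps_eq [OF bar_left_module de.d_operator_defect_linear [OF bar_left_module bar_left_module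
              der_d_operator der_d_operator bd_E_linear] linear_map_zero_map [OF bar_left_module]])
        (use X in \<open>simp_all add: bar_minus eq Tn.T.M.minus_eq Tn.T.M.r_neg\<close>)
    then have "der (Suc (Suc n)) (bd n X) \<ominus>\<^bsub>BT n\<^esub> bd n (der (Suc (Suc (Suc n))) X) =
        \<zero>\<^bsub>BT n\<^esub>" by (simp add: bar_minus)
    then show ?thesis by (rule Tn.T.M.minus_imp_eq) (use X in simp_all)
  qed
  show "X \<in> carrier (BT (Suc n)) \<Longrightarrow> ?thesis"
  proof (induct n arbitrary: X)
    case 0
    show ?case
      by (rule gen [OF _ 0]) (simp add: bd_cone0 der_cone der_cone0 aug_der)
  next
    case (Suc n)
    show ?case
      by (rule gen [OF _ Suc(2)]) (simp add: bd_cone der_cone Suc(1))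
  qed
qed

lemma der_lifting: "d_lifting k E \<delta>e bar bd aug \<delta> (\<lambda>n. der (Suc (Suc n)))"
  unfolding d_lifting_def by (simp add: der_d_operator der_bd aug_der)

abbreviation "G \<equiv> gerstenhaber_cochain k A \<delta>"

text \<open>The sum over \<delta> on single letters is \<phi> after \<open>der\<close>, so the
  bracket is a difference of linear maps.\<close>

lemma G_eq:
  assumes \<phi>: "\<phi> \<in> carrier (HC n)"
  shows "G n \<phi> = (\<lambda>X\<in>carrier (Tn n). \<delta> (\<phi> X) \<ominus> \<phi> (der n X))"
    and G_closed: "G n \<phi> \<in> carrier (HC n)"
proof -
  have l: "linear_map k (Tn n) A \<phi>" using \<phi> by (simp add: HC_carrier)
  interpret \<phi>: linear_hom k "Tn n" A \<phi> by (rule linear_homI [OF Tn_module A_module l])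
  have h: "linear_map k (Tn n) A (\<lambda>X. \<delta> (\<phi> X) \<ominus> \<phi> (der n X))"
    by (rule linear_map_minus_map [OF A_module linear_map_comp [OF l \<delta>.d.lin] linear_map_comp [OF der_linear l]])
  show eq: "G n \<phi> = (\<lambda>X\<in>carrier (Tn n). \<delta> (\<phi> X) \<ominus> \<phi> (der n X))"
    unfolding gerstenhaber_cochain_def
  proof (rule restrict_ext, rule tensor_lift_eq [OF A_module h])
    fix l assume l: "l \<in> words n"
    have "\<phi> (der n (pe n l)) = (\<Oplus>j\<in>{..<n}. \<phi> (pe n (l[j := \<delta> (l ! j)])))"
      unfolding der_pure [OF l] by (rule \<phi>.f_finsum) (use der_word [OF l] in auto)
    then show "\<delta> (\<phi> (pe n l)) \<ominus> (\<Oplus>j\<in>{..<n}. \<phi> (pe n (l[j := \<delta> (l ! j)]))) =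
      \<delta> (\<phi> (pe n l)) \<ominus> \<phi> (der n (pe n l))" by simp
  qed
  show "G n \<phi> \<in> carrier (HC n)"
    using h by (simp add: eq HC_carrier linear_map_restrict [OF Tn_module])
qed

text \<open>On \<open>x # m @ [y]\<close>, \<delta> of the product \<open>x \<phi>(m) y\<close> has
  three terms, and so has the image of the derived word. The terms with \<delta> on \<open>x\<close>
  or \<open>y\<close> occur in both and cancel, leaving the bracket between \<open>x\<close> and
  \<open>y\<close>. The condition \<open>sharp\<close> is later supplied by
  \<open>sharp_cochain_map\<close>, once the bar complex is known to be a projective
  resolution.\<close>

lemma ctb_G:
  assumes \<phi>: "\<phi> \<in> carrier (HC n)"
    and sharp: "sharp bar M \<delta> (\<lambda>n. der (Suc (Suc n))) n (ctb n \<phi>) \<in> carrier (HB n)"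
  shows "ctb n (G n \<phi>) = sharp bar M \<delta> (\<lambda>n. der (Suc (Suc n))) n (ctb n \<phi>)"
proof (rule HB_eqI [OF ctb_closed [OF G_closed [OF \<phi>]] sharp])
  fix x m y assume x: "x \<in> carrier A" and m: "m \<in> words n" and y: "y \<in> carrier A"
  let ?n = "Suc (Suc n)"
  have l: "linear_map k (Tn n) A \<phi>" using \<phi> by (simp add: HC_carrier)
  interpret \<phi>: linear_hom k "Tn n" A \<phi> by (rule linear_homI [OF Tn_module A_module l])
  interpret c: linear_hom k "Tn ?n" A "ctb n \<phi>"
    by (rule linear_homI [OF Tn_module A_module HB_k_linear [OF ctb_closed [OF \<phi>]]])
  interpret xy: linear_hom k A A "\<lambda>z. x \<otimes> z \<otimes> y"
    by (rule linear_homI [OF A_module A_module linear_map_comp [OF mult_left_linear [OF x] mult_right_linear [OF y]]])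
  note cp = ctb_pure [OF \<phi>]
  have mj: "m[j := \<delta> (m ! j)] \<in> words n" if "j < n" for j by (rule der_word [OF m that])
  have S: "ctb n \<phi> (\<Oplus>\<^bsub>Tn ?n\<^esub>j\<in>{..<n}. pe ?n (x # m[j := \<delta> (m ! j)] @ [y])) = x \<otimes> \<phi> (der n (pe n m)) \<otimes> y"
  proof -
    have "ctb n \<phi> (\<Oplus>\<^bsub>Tn ?n\<^esub>j\<in>{..<n}. pe ?n (x # m[j := \<delta> (m ! j)] @ [y])) =
       (\<Oplus>j\<in>{..<n}. ctb n \<phi> (pe ?n (x # m[j := \<delta> (m ! j)] @ [y])))"
      by (rule c.f_finsum) (use mj x y in auto)
    also have "\<dots> = (\<Oplus>j\<in>{..<n}. x \<otimes> \<phi> (pe n (m[j := \<delta> (m ! j)])) \<otimes> y)"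
      by (rule A.M.finsum_cong') (use mj x y in \<open>simp_all add: cp Pi_def\<close>)
    also have "\<dots> = x \<otimes> (\<Oplus>j\<in>{..<n}. \<phi> (pe n (m[j := \<delta> (m ! j)]))) \<otimes> y"
      by (rule xy.f_finsum [symmetric]) (use mj in auto)
    also have "(\<Oplus>j\<in>{..<n}. \<phi> (pe n (m[j := \<delta> (m ! j)]))) = \<phi> (der n (pe n m))"
      unfolding der_pure [OF m] by (rule \<phi>.f_finsum [symmetric]) (use mj in auto)
    finally show ?thesis .
  qed
  have Sc: "(\<Oplus>\<^bsub>Tn ?n\<^esub>j\<in>{..<n}. pe ?n (x # m[j := \<delta> (m ! j)] @ [y])) \<in> carrier (Tn ?n)"
    by (rule Tn.T.M.finsum_closed) (use mj x y in auto)
  have Dc: "ctb n \<phi> (der ?n (pe ?n (x # m @ [y]))) = \<delta> x \<otimes> \<phi> (pe n m) \<otimes> y \<oplus>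
      (x \<otimes> \<phi> (pe n m) \<otimes> \<delta> y \<oplus> x \<otimes> \<phi> (der n (pe n m)) \<otimes> y)"
    unfolding der_Cons_snoc [OF x y m] using x y m Sc S by (simp add: cp)
  define u v w z where "u = \<delta> x \<otimes> \<phi> (pe n m) \<otimes> y" and "v = x \<otimes> \<phi> (pe n m) \<otimes> \<delta> y"
    and "w = x \<otimes> \<phi> (der n (pe n m)) \<otimes> y" and "z = x \<otimes> \<delta> (\<phi> (pe n m)) \<otimes> y"
  have cl: "u \<in> carrier A" "v \<in> carrier A" "w \<in> carrier A" "z \<in> carrier A"
    using x y m by (auto simp: u_def v_def w_def z_def)
  have "z \<ominus> w = (u \<oplus> z) \<oplus> v \<ominus> (u \<oplus> (v \<oplus> w))"
  proof -
    have "(u \<oplus> z) \<oplus> v \<ominus> (u \<oplus> (v \<oplus> w)) =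
        z \<oplus> (u \<oplus> (\<ominus> u \<oplus> (v \<oplus> (\<ominus> v \<oplus> \<ominus> w))))"
      using cl by (simp add: A.M.minus_eq A.M.minus_add A.M.a_ac)
    also have "\<dots> = z \<ominus> w" using cl by (simp add: A.M.r_neg2 A.M.minus_eq)
    finally show ?thesis by simp
  qed
  moreover have "ctb n (G n \<phi>) (pe ?n (x # m @ [y])) = z \<ominus> w"
  proof -
    have "G n \<phi> (pe n m) = \<delta> (\<phi> (pe n m)) \<ominus> \<phi> (der n (pe n m))"
      using m by (simp add: G_eq [OF \<phi>])
    then show ?thesis using m by (simp add: ctb_pure [OF G_closed [OF \<phi>] x y m] z_def w_def)
  qed
  moreover have "sharp bar M \<delta> (\<lambda>n. der (Suc (Suc n))) n (ctb n \<phi>) (pe ?n (x # m @ [y])) =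
      (u \<oplus> z) \<oplus> v \<ominus> (u \<oplus> (v \<oplus> w))"
    using x y m Dc by (simp add: sharp_def M_minus cp \<delta>.d_mult A.A.l_distr u_def v_def w_def z_def)
  ultimately show "ctb n (G n \<phi>) (pe ?n (x # m @ [y])) =
      sharp bar M \<delta> (\<lambda>n. der (Suc (Suc n))) n (ctb n \<phi>) (pe ?n (x # m @ [y]))"
    by simp
qed

end

lemma cochain_map_linear: "cochain_map k C D C' D' F \<Longrightarrow> linear_map k (C n) (C' n) (F n)"
  and cochain_map_commute: "\<lbrakk>cochain_map k C D C' D' F; x \<in> carrier (C n)\<rbrakk> \<Longrightarrow> F (Suc n) (D n x) = D' n (F n x)"
  by (simp_all add: cochain_map_def)

lemma cochain_map_comp:
  assumes F: "cochain_map k C D C' D' F" and F': "cochain_map k C' D' C'' D'' F'"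
  shows "cochain_map k C D C'' D'' (\<lambda>n x. F' n (F n x))"
  unfolding cochain_map_def
  by (intro allI conjI ballI linear_map_comp [OF cochain_map_linear [OF F] cochain_map_linear [OF F']])
    (simp add: cochain_map_commute [OF F] cochain_map_commute [OF F'] linear_map_closed [OF cochain_map_linear [OF F]])

section \<open>Hochschild cohomology from a projective resolution\<close>

locale hoch_projective = hoch_der k A \<delta>
  for k :: "('k, 'x) ring_scheme" and A :: "('k, 'a) module" (structure) and \<delta> +
  assumes proj: "projective_module k A"
begin

lemma bar_res: "projective_resolution E M bar bd aug"
  by (rule bar_resolution [OF proj])

sublocale bres: resolution E M bar bd aug by (rule resolution.intro [OF bar_res])
sublocale bres: algebra_resolution k E M bar bd aug ..

abbreviation "derbar n \<equiv> der (Suc (Suc n))"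

lemma sharp_bar_cochain_map: "cochain_map k HB (hom_diff bar bd) HB (hom_diff bar bd) (sharp bar M \<delta> derbar)"
  by (rule de.sharp_cochain_map [OF _ M_d_operator der_lifting]) unfold_locales

lemma ctb_bracket: "\<phi> \<in> carrier (HC n) \<Longrightarrow> ctb n (G n \<phi>) = sharp bar M \<delta> derbar n (ctb n \<phi>)"
  by (rule ctb_G) (simp_all add: linear_map_closed [OF cochain_map_linear [OF sharp_bar_cochain_map]] ctb_closed)

text \<open>Linearity is tested after the injective linear map \<open>ctb\<close>, where the
  Hochschild formulas have become composition with bar maps.\<close>

lemma linear_via_bar:
  assumes cl: "\<And>\<phi>. \<phi> \<in> carrier (HC n) \<Longrightarrow> f \<phi> \<in> carrier (HC m)"
    and eq: "\<And>\<phi>. \<phi> \<in> carrier (HC n) \<Longrightarrow> ctb m (f \<phi>) = f' (ctb n \<phi>)"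
    and f': "linear_map k (HB n) (HB m) f'"
  shows "linear_map k (HC n) (HC m) f"
proof (rule linear_mapI)
  interpret HC: left_module k "HC i" for i by (rule HC_module)
  note c = linear_map_add [OF ctb_linear] linear_map_smult [OF ctb_linear]
    linear_map_add [OF f'] linear_map_smult [OF f'] ctb_closed cl eq
  fix \<phi> assume \<phi>: "\<phi> \<in> carrier (HC n)"
  { fix \<psi> assume \<psi>: "\<psi> \<in> carrier (HC n)"
    show "f (\<phi> \<oplus>\<^bsub>HC n\<^esub> \<psi>) = f \<phi> \<oplus>\<^bsub>HC m\<^esub> f \<psi>"
      by (rule ctb_inj [where n = m]) (use \<phi> \<psi> in \<open>simp_all add: c\<close>) }
  { fix r assume r: "r \<in> carrier k"
    show "f (r \<odot>\<^bsub>HC n\<^esub> \<phi>) = r \<odot>\<^bsub>HC m\<^esub> f \<phi>"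
      by (rule ctb_inj [where n = m]) (use \<phi> r in \<open>simp_all add: c\<close>) }
qed (rule cl)

lemma ctb_zero: "ctb n \<zero>\<^bsub>HC n\<^esub> = \<zero>\<^bsub>HB n\<^esub>"
  by (rule linear_map_0 [OF HC_module bres.H.C_module ctb_linear])

text \<open>That the Hochschild differential squares to zero is pulled back along \<open>ctb\<close>
  from the hom complex of the bar resolution.\<close>

sublocale HC: cochain_complex k HC HD
proof (rule cochain_complex.intro)
  interpret HC: left_module k "HC i" for i by (rule HC_module)
  fix n
  show "left_module k (HC n)" by (rule HC_module)
  show "linear_map k (HC n) (HC (Suc n)) (HD n)"
    by (rule linear_via_bar [OF HD_closed ctb_HD bres.H.D_linear])
  fix \<phi> assume \<phi>: "\<phi> \<in> carrier (HC n)"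
  show "HD (Suc n) (HD n \<phi>) = \<zero>\<^bsub>HC (Suc (Suc n))\<^esub>"
    by (rule ctb_inj [where n = "Suc (Suc n)"]) (use \<phi> in \<open>simp_all add: HD_closed ctb_HD ctb_zero ctb_closed bres.H.D_D\<close>)
qed

lemma ctb_cochain_map: "cochain_map k HC HD HB (hom_diff bar bd) ctb"
  unfolding cochain_map_def by (simp add: ctb_linear ctb_HD)

sublocale ctb: cochain_morphism k HC HD HB "hom_diff bar bd" ctb
  by unfold_locales (rule ctb_cochain_map)

text \<open>Pulled back along the injective \<open>ctb\<close> from the \<open>sharp\<close> map of
  the bar resolution.\<close>

lemma G_cochain_map: "cochain_map k HC HD HC HD G"
  unfolding cochain_map_def
proof (intro allI conjI ballI)
  fix n
  show "linear_map k (HC n) (HC n) (G n)"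
    by (rule linear_via_bar [where f = "G n" and n = n and m = n, OF G_closed ctb_bracket
          cochain_map_linear [OF sharp_bar_cochain_map]])
  fix \<phi> assume \<phi>: "\<phi> \<in> carrier (HC n)"
  show "G (Suc n) (HD n \<phi>) = HD n (G n \<phi>)"
    by (rule ctb_inj [where n = "Suc n"])
      (use \<phi> in \<open>simp_all add: G_closed HD_closed ctb_bracket ctb_HD ctb_closed
        cochain_map_commute [OF sharp_bar_cochain_map]\<close>)
qed

sublocale G: cochain_morphism k HC HD HC HD G
  by unfold_locales (rule G_cochain_map)

lemma ctb_Z_iff:
  assumes \<phi>: "\<phi> \<in> carrier (HC n)"
  shows "ctb n \<phi> \<in> bres.H.Z n \<longleftrightarrow> \<phi> \<in> HC.Z n"
proof -
  have "ctb (Suc n) (HD n \<phi>) = ctb (Suc n) \<zero>\<^bsub>HC (Suc n)\<^esub> \<longleftrightarrow> HD n \<phi> = \<zero>\<^bsub>HC (Suc n)\<^esub>"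
    by (rule iffI, erule ctb_inj [OF HD_closed [OF \<phi>] HC.C.M.zero_closed], simp)
  then show ?thesis
    by (simp add: bres.H.Z_iff HC.Z_iff ctb_closed \<phi> ctb_HD ctb_zero)
qed

text \<open>Surjectivity of \<open>ctb\<close> one degree lower supplies a Hochschild cochain
  bounding \<phi>.\<close>

lemma ctb_Bd_imp:
  assumes \<phi>: "\<phi> \<in> carrier (HC n)" and B: "ctb n \<phi> \<in> bres.H.Bd n"
  shows "\<phi> \<in> HC.Bd n"
  using B
proof (cases rule: bres.H.Bd_cases)
  case 1
  then have "\<phi> = \<zero>\<^bsub>HC n\<^esub>" by (intro ctb_inj [OF \<phi>]) (simp_all add: ctb_zero)
  then show ?thesis by (simp add: HC.Bd_zero)
next
  case (2 m \<psi>)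
  obtain \<beta> where \<beta>: "\<beta> \<in> carrier (HC m)" "ctb m \<beta> = \<psi>" using ctb_surj [OF 2(2)] .
  have "\<phi> = HD m \<beta>"
    by (rule ctb_inj [where n = n]) (use 2 \<beta> \<phi> in \<open>simp_all add: HD_closed ctb_HD\<close>)
  then show ?thesis using 2 \<beta> by (simp add: coboundaries_def)
qed

lemma HH_eq: "HH k A = cohomology HC HD"
  by (simp add: HH_def)

lemma bracket_eq: "gerstenhaber_bracket k A \<delta> = cohomology_map HC HD G"
  by (simp add: gerstenhaber_bracket_def)

end

section \<open>Comparison of the bar resolution with an arbitrary projective resolution\<close>

locale hoch_resolution = hoch_projective k A \<delta>
  for k :: "('k, 'x) ring_scheme" and A :: "('k, 'a) module" (structure) and \<delta> +
  fixes P :: "nat \<Rightarrow> (('a list \<Rightarrow> 'k) set, 'p) module" and dP \<epsilon>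
  assumes P_res: "projective_resolution E M P dP \<epsilon>"
begin

lemma two_resolutionsI:
  assumes "projective_resolution E M X dX eX" "projective_resolution E M Y dY eY"
  shows "algebra_two_resolutions k E M X dX eX Y dY eY"
  using assms M.algebra_module_axioms
  by (simp add: algebra_two_resolutions_def two_resolutions_def resolution_def)

sublocale PB: algebra_two_resolutions k E M P dP \<epsilon> bar bd aug
  by (rule two_resolutionsI [OF P_res bar_res])

interpretation BP: algebra_two_resolutions k E M bar bd aug P dP \<epsilon>
  by (rule two_resolutionsI [OF bar_res P_res])
text \<open>Pairing a resolution with itself gives access to null-homotopies of its endomorphisms,
  as needed for comparing a round trip with the identity.\<close>

interpretation BB: algebra_two_resolutions k E M bar bd aug bar bd aug
  by (rule two_resolutionsI [OF bar_res bar_res])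
interpretation PP: algebra_two_resolutions k E M P dP \<epsilon> P dP \<epsilon>
  by (rule two_resolutionsI [OF P_res P_res])

abbreviation "HP \<equiv> hom_complex E P M"
abbreviation "toP \<theta> n \<phi> \<equiv> \<lambda>p\<in>carrier (P n). ctb n \<phi> (\<theta> n p)"

lemma to_bar_exists: "\<exists>\<theta>. to_bar k A P dP \<epsilon> \<theta>"
  by (rule PB.resolution_map_exists)

lemma toP_cochain_map:
  assumes "to_bar k A P dP \<epsilon> \<theta>"
  shows "cochain_map k HC HD HP (hom_diff P dP) (toP \<theta>)"
  by (rule cochain_map_comp [OF ctb_cochain_map PB.pullback_cochain_map])
    (use assms in \<open>auto simp: resolution_map_def\<close>)

lemma toP_morphism:
  assumes "to_bar k A P dP \<epsilon> \<theta>"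
  shows "cochain_morphism k HC HD HP (hom_diff P dP) (toP \<theta>)"
  by (intro cochain_morphism.intro cochain_morphism_axioms.intro toP_cochain_map [OF assms]
      HC.cochain_complex_axioms PB.PP.H.cochain_complex_axioms)

lemma along_cls:
  assumes "to_bar k A P dP \<epsilon> \<theta>" "\<phi> \<in> HC.Z n"
  shows "HH_to_Ext_along k A P dP \<theta> n (HC.cls n \<phi>) = PB.PP.H.cls n (toP \<theta> n \<phi>)"
  unfolding HH_to_Ext_along_def
  by (rule cochain_morphism.cohomology_map_cls [OF toP_morphism [OF assms(1)] assms(2)])

lemma toP_Z: "\<lbrakk>to_bar k A P dP \<epsilon> \<theta>; \<phi> \<in> HC.Z n\<rbrakk> \<Longrightarrow> toP \<theta> n \<phi> \<in> PB.PP.H.Z n"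
  using cochain_morphism.F_Z [OF toP_morphism] .

lemma P_cls_eqI:
  assumes "\<alpha> \<in> PB.PP.H.Z n" "\<beta> \<in> PB.PP.H.Z n"
    and "(\<lambda>p\<in>carrier (P n). \<alpha> p \<ominus>\<^bsub>M\<^esub> \<beta> p) \<in> PB.PP.H.Bd n"
  shows "PB.PP.H.cls n \<alpha> = PB.PP.H.cls n \<beta>"
  using assms hom_complex_minus [where P = P and n = n, OF M.algebra_module_axioms PB.P.P_module, of \<alpha> \<beta>]
  by (subst PB.PP.H.cls_eq_iff) (simp_all add: PB.PP.H.Z_iff)

text \<open>The difference of two comparison maps lies over zero, hence is null-homotopic and
  changes a cocycle by a coboundary only. This justifies the choice made in
  \<open>HH_to_Ext\<close>.\<close>

lemma along_independent:
  assumes t: "to_bar k A P dP \<epsilon> \<theta>" and t': "to_bar k A P dP \<epsilon> \<theta>'"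
    and \<phi>: "\<phi> \<in> HC.Z n"
  shows "PB.PP.H.cls n (toP \<theta> n \<phi>) = PB.PP.H.cls n (toP \<theta>' n \<phi>)"
proof (rule P_cls_eqI [OF toP_Z [OF t \<phi>] toP_Z [OF t' \<phi>]])
  note T = t [unfolded resolution_map_def] and T' = t' [unfolded resolution_map_def]
  have lin: "linear_map E (P i) (bar i) (\<theta> i)" "linear_map E (P i) (bar i) (\<theta>' i)" for i
    using T T' by auto
  note cl = linear_map_closed [OF lin(1)] linear_map_closed [OF lin(2)]
  have \<psi>: "ctb n \<phi> \<in> bres.H.Z n" using ctb.F_Z [OF \<phi>] .
  have \<psi>l: "linear_map E (bar n) M (ctb n \<phi>)" using \<psi> by (simp add: bres.cocycle_iff)
  have "(\<lambda>p\<in>carrier (P n). ctb n \<phi> (\<theta> n p \<ominus>\<^bsub>bar n\<^esub> \<theta>' n p)) \<in> PB.PP.H.Bd n"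
  proof (rule PB.null_homotopic_coboundary [OF _ _ _ \<psi>])
    fix i p
    show "linear_map E (P i) (bar i) (\<lambda>p. \<theta> i p \<ominus>\<^bsub>bar i\<^esub> \<theta>' i p)"
      by (rule linear_map_minus_map [OF bar_left_module lin])
    { assume p: "p \<in> carrier (P (Suc i))"
      show "\<theta> i (dP i p) \<ominus>\<^bsub>bar i\<^esub> \<theta>' i (dP i p) = bd i (\<theta> (Suc i) p \<ominus>\<^bsub>bar (Suc i)\<^esub> \<theta>' (Suc i) p)"
        using T T' p linear_map_minus [OF bar_left_module bar_left_module bd_E_linear cl(1) cl(2), OF p p]
        by (simp del: bar_simps) }
    { assume p: "p \<in> carrier (P 0)"
      show "aug (\<theta> 0 p \<ominus>\<^bsub>bar 0\<^esub> \<theta>' 0 p) = \<zero>\<^bsub>M\<^esub>"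
        using T T' p linear_map_minus [OF bar_left_module M_left_module aug_E_linear cl(1) cl(2), OF p p]
          PB.P.eps.f_closed [OF p]
        by (simp add: M.M.M.minus_eq M.M.M.r_neg del: bar_simps M_simps) }
  qed
  moreover have "(\<lambda>p\<in>carrier (P n). ctb n \<phi> (\<theta> n p \<ominus>\<^bsub>bar n\<^esub> \<theta>' n p)) =
      (\<lambda>p\<in>carrier (P n). toP \<theta> n \<phi> p \<ominus>\<^bsub>M\<^esub> toP \<theta>' n \<phi> p)"
    by (rule restrict_ext)
      (simp add: linear_map_minus [OF bar_left_module M_left_module \<psi>l cl(1) cl(2)] del: bar_simps)
  ultimately show "(\<lambda>p\<in>carrier (P n). toP \<theta> n \<phi> p \<ominus>\<^bsub>M\<^esub> toP \<theta>' n \<phi> p) \<in> PB.PP.H.Bd n" by simp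
qed

definition "theta = (SOME \<theta>. to_bar k A P dP \<epsilon> \<theta>)"

lemma theta: "to_bar k A P dP \<epsilon> theta"
  unfolding theta_def using to_bar_exists by (rule someI_ex)

lemma HH_to_Ext_cls:
  "\<phi> \<in> HC.Z n \<Longrightarrow> HH_to_Ext k A P dP \<epsilon> n (HC.cls n \<phi>) = PB.PP.H.cls n (toP theta n \<phi>)"
  unfolding HH_to_Ext_def theta_def [symmetric] by (rule along_cls [OF theta])

lemma along_eq:
  assumes t: "to_bar k A P dP \<epsilon> \<theta>" and x: "x \<in> carrier (HH k A n)"
  shows "HH_to_Ext_along k A P dP \<theta> n x = HH_to_Ext k A P dP \<epsilon> n x"
proof -
  from x obtain \<phi> where \<phi>: "\<phi> \<in> HC.Z n" "x = HC.cls n \<phi>"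
    unfolding HH_eq HC.cohomology_carrier by blast
  then show ?thesis
    using along_cls [OF t \<phi>(1)] HH_to_Ext_cls [OF \<phi>(1)] along_independent [OF t theta \<phi>(1)] by simp
qed

text \<open>Here \<open>\<sigma> \<circ> \<rho>\<close> lifts the identity, so it is homotopic to the identity.\<close>

lemma id_minus_comp_coboundary:
  assumes two: "algebra_two_resolutions k E M X dX eX X dX eX"
    and \<rho>: "resolution_map E X dX eX Y dY eY \<rho>" and \<sigma>: "resolution_map E Y dY eY X dX eX \<sigma>"
    and \<psi>: "\<psi> \<in> cocycles (hom_complex E X M) (hom_diff X dX) n"
  shows "(\<lambda>p\<in>carrier (X n). \<psi> p \<ominus>\<^bsub>M\<^esub> \<psi> (\<sigma> n (\<rho> n p))) \<in> coboundaries (hom_complex E X M) (hom_diff X dX) n"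
proof -
  interpret XX: algebra_two_resolutions k E M X dX eX X dX eX by fact
  note R = \<rho> [unfolded resolution_map_def] and S = \<sigma> [unfolded resolution_map_def]
  have lr: "linear_map E (X i) (Y i) (\<rho> i)" and ls: "linear_map E (Y i) (X i) (\<sigma> i)" for i using R S by auto
  have lc: "linear_map E (X i) (X i) (\<lambda>p. \<sigma> i (\<rho> i p))" for i by (rule linear_map_comp [OF lr ls])
  note cr = linear_map_closed [OF lr] and cc = linear_map_closed [OF lc]
  have \<psi>l: "linear_map E (X n) M \<psi>" using \<psi> by (simp add: XX.PP.cocycle_iff)
  have "(\<lambda>p\<in>carrier (X n). \<psi> (p \<ominus>\<^bsub>X n\<^esub> \<sigma> n (\<rho> n p))) \<in> XX.PP.H.Bd n"
  proof (rule XX.null_homotopic_coboundary [OF _ _ _ \<psi>])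
    fix i p
    show "linear_map E (X i) (X i) (\<lambda>p. p \<ominus>\<^bsub>X i\<^esub> \<sigma> i (\<rho> i p))"
      by (rule linear_map_minus_map [OF XX.P.P_module linear_map_id lc])
    { assume p: "p \<in> carrier (X (Suc i))"
      have "\<sigma> i (\<rho> i (dX i p)) = dX i (\<sigma> (Suc i) (\<rho> (Suc i) p))"
        using R S p cr [OF p] by simp
      then show "dX i p \<ominus>\<^bsub>X i\<^esub> \<sigma> i (\<rho> i (dX i p)) = dX i (p \<ominus>\<^bsub>X (Suc i)\<^esub> \<sigma> (Suc i) (\<rho> (Suc i) p))"
        using p cc [OF p] by simp }
    { assume p: "p \<in> carrier (X 0)"
      have "eX (\<sigma> 0 (\<rho> 0 p)) = eX p" using R S p cr [OF p] by simp
      then show "eX (p \<ominus>\<^bsub>X 0\<^esub> \<sigma> 0 (\<rho> 0 p)) = \<zero>\<^bsub>M\<^esub>"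
        using p cc [OF p] XX.P.eps.f_closed [OF p]
        by (simp add: M.M.M.minus_eq M.M.M.r_neg del: M_simps) }
  qed
  moreover have "(\<lambda>p\<in>carrier (X n). \<psi> (p \<ominus>\<^bsub>X n\<^esub> \<sigma> n (\<rho> n p))) = (\<lambda>p\<in>carrier (X n). \<psi> p \<ominus>\<^bsub>M\<^esub> \<psi> (\<sigma> n (\<rho> n p)))"
    by (rule restrict_ext) (simp add: linear_map_minus [OF XX.P.P_module M_left_module \<psi>l] cc)
  ultimately show ?thesis by simp
qed

text \<open>Injectivity on cohomology. Write \<open>ctb n \<phi>\<close> as the sum of
  \<open>?a\<close>, its difference from the round trip through \<open>P\<close>, and
  \<open>?b\<close>, the round trip itself. The first is a coboundary by homotopy, the second as the
  pullback along \<rho> of the given coboundary.\<close>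

lemma toP_Bd_imp:
  assumes \<phi>: "\<phi> \<in> HC.Z n" and B: "toP theta n \<phi> \<in> PB.PP.H.Bd n"
  shows "\<phi> \<in> HC.Bd n"
proof (rule ctb_Bd_imp)
  show c: "\<phi> \<in> carrier (HC n)" using \<phi> by (simp add: HC.Z_iff)
  obtain \<rho> where \<rho>: "resolution_map E bar bd aug P dP \<epsilon> \<rho>" using BP.resolution_map_exists by blast
  have \<psi>: "ctb n \<phi> \<in> bres.H.Z n" using ctb.F_Z [OF \<phi>] .
  have lr: "linear_map E (bar i) (P i) (\<rho> i)" for i using \<rho> by (simp add: resolution_map_def)
  have lt: "linear_map E (P i) (bar i) (theta i)" for i using theta by (simp add: resolution_map_def)
  interpret pb: cochain_morphism k HP "hom_diff P dP" HB "hom_diff bar bd"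
    "\<lambda>n \<psi>. \<lambda>p\<in>carrier (bar n). \<psi> (\<rho> n p)"
    by (intro cochain_morphism.intro cochain_morphism_axioms.intro PB.PP.H.cochain_complex_axioms
        bres.H.cochain_complex_axioms BP.pullback_cochain_map)
      (use \<rho> in \<open>auto simp: resolution_map_def\<close>)
  let ?b = "\<lambda>p\<in>carrier (bar n). ctb n \<phi> (theta n (\<rho> n p))"
  have b: "?b \<in> bres.H.Bd n"
    using pb.F_Bd [OF B] linear_map_closed [OF lr] by (simp cong: restrict_cong del: bar_simps)
  let ?a = "\<lambda>p\<in>carrier (bar n). ctb n \<phi> p \<ominus>\<^bsub>M\<^esub> ctb n \<phi> (theta n (\<rho> n p))"
  have a: "?a \<in> bres.H.Bd n"
    by (rule id_minus_comp_coboundary [OF BB.algebra_two_resolutions_axioms \<rho> theta \<psi>])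
  have "?a \<oplus>\<^bsub>HB n\<^esub> ?b \<in> bres.H.Bd n"
    using submoduleD(3) [OF bres.H.Bd_submodule a b] by simp
  moreover have "?a \<oplus>\<^bsub>HB n\<^esub> ?b = ctb n \<phi>"
  proof (rule extensionalityI)
    show "ctb n \<phi> \<in> extensional (carrier (bar n))" using \<psi> by (simp add: bres.cocycle_iff)
    fix X assume X: "X \<in> carrier (bar n)"
    have "ctb n \<phi> Y \<in> carrier M" if "Y \<in> carrier (bar n)" for Y
      by (rule linear_map_closed [where R = E, OF _ that]) (use \<psi> in \<open>simp add: bres.cocycle_iff\<close>)
    then show "(?a \<oplus>\<^bsub>HB n\<^esub> ?b) X = ctb n \<phi> X"
      using X linear_map_closed [OF lt linear_map_closed [OF lr X]]
      by (simp add: hom_complex_simps M.M.M.minus_eq M.M.M.a_assoc M.M.M.l_neg del: M_simps bar_simps)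
  qed (simp add: hom_complex_simps)
  ultimately show "ctb n \<phi> \<in> bres.H.Bd n" by simp
qed

text \<open>Injectivity is \<open>toP_Bd_imp\<close> applied to a difference of cocycles. For
  surjectivity a cocycle \<psi> on \<open>P\<close> is pulled back to the bar resolution along
  \<rho> and read as a Hochschild cocycle; its image differs from \<psi> by a round trip, hence by a
  coboundary.\<close>

lemma HH_to_Ext_iso: "linear_iso k (HH k A n) (Ext_via E P dP M n) (HH_to_Ext k A P dP \<epsilon> n)"
proof -
  interpret tm: cochain_morphism k HC HD HP "hom_diff P dP" "toP theta" by (rule toP_morphism [OF theta])
  have lin: "linear_map k (HH k A n) (Ext_via E P dP M n) (HH_to_Ext k A P dP \<epsilon> n)"
    unfolding HH_eq Ext_via_def HH_to_Ext_def HH_to_Ext_along_def theta_def [symmetric]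
    by (rule tm.cohomology_map_linear)
  have "inj_on (HH_to_Ext k A P dP \<epsilon> n) (carrier (HH k A n))"
  proof (rule inj_onI)
    fix x y assume "x \<in> carrier (HH k A n)" "y \<in> carrier (HH k A n)"
      and eq: "HH_to_Ext k A P dP \<epsilon> n x = HH_to_Ext k A P dP \<epsilon> n y"
    then obtain \<phi> \<chi> where \<phi>: "\<phi> \<in> HC.Z n" "x = HC.cls n \<phi>" and \<chi>: "\<chi> \<in> HC.Z n" "y = HC.cls n \<chi>"
      unfolding HH_eq HC.cohomology_carrier by blast
    have c: "\<phi> \<in> carrier (HC n)" "\<chi> \<in> carrier (HC n)" using \<phi> \<chi> by (auto simp: HC.Z_iff)
    have d: "\<phi> \<ominus>\<^bsub>HC n\<^esub> \<chi> \<in> HC.Z n" using \<phi> \<chi> by (auto simp: HC.Z_iff HC.C.M.minus_eq)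
    have "toP theta n \<phi> \<ominus>\<^bsub>HP n\<^esub> toP theta n \<chi> \<in> PB.PP.H.Bd n"
      using eq \<phi> \<chi> by (simp add: HH_to_Ext_cls PB.PP.H.cls_eq_iff toP_Z [OF theta])
    then have "toP theta n (\<phi> \<ominus>\<^bsub>HC n\<^esub> \<chi>) \<in> PB.PP.H.Bd n"
      using tm.F.f_minus [OF c] by simp
    from toP_Bd_imp [OF d this] show "x = y" using \<phi> \<chi> by (simp add: HC.cls_eq_iff)
  qed
  moreover have "HH_to_Ext k A P dP \<epsilon> n ` carrier (HH k A n) = carrier (Ext_via E P dP M n)"
  proof (intro equalityI subsetI)
    fix X assume "X \<in> HH_to_Ext k A P dP \<epsilon> n ` carrier (HH k A n)"
    then show "X \<in> carrier (Ext_via E P dP M n)" using linear_map_closed [OF lin] by blast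
  next
    fix X assume "X \<in> carrier (Ext_via E P dP M n)"
    then obtain \<psi> where \<psi>: "\<psi> \<in> PB.PP.H.Z n" "X = PB.PP.H.cls n \<psi>"
      unfolding Ext_via_def PB.PP.H.cohomology_carrier by blast
    obtain \<rho> where \<rho>: "resolution_map E bar bd aug P dP \<epsilon> \<rho>" using BP.resolution_map_exists by blast
    interpret pb: cochain_morphism k HP "hom_diff P dP" HB "hom_diff bar bd"
      "\<lambda>n \<psi>. \<lambda>p\<in>carrier (bar n). \<psi> (\<rho> n p)"
      by (intro cochain_morphism.intro cochain_morphism_axioms.intro PB.PP.H.cochain_complex_axioms
          bres.H.cochain_complex_axioms BP.pullback_cochain_map)
        (use \<rho> in \<open>auto simp: resolution_map_def\<close>)
    have z: "(\<lambda>p\<in>carrier (bar n). \<psi> (\<rho> n p)) \<in> bres.H.Z n" by (rule pb.F_Z [OF \<psi>(1)])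
    then obtain \<phi> where \<phi>: "\<phi> \<in> carrier (HC n)" "ctb n \<phi> = (\<lambda>p\<in>carrier (bar n). \<psi> (\<rho> n p))"
      using ctb_surj by (metis bres.H.Z_iff)
    then have \<phi>Z: "\<phi> \<in> HC.Z n" using ctb_Z_iff [OF \<phi>(1)] z unfolding \<phi>(2) by simp
    have lt: "linear_map E (P i) (bar i) (theta i)" for i using theta by (simp add: resolution_map_def)
    have "toP theta n \<phi> = (\<lambda>p\<in>carrier (P n). \<psi> (\<rho> n (theta n p)))"
      using linear_map_closed [OF lt] by (simp add: \<phi>(2) cong: restrict_cong del: bar_simps)
    then have "(\<lambda>p\<in>carrier (P n). \<psi> p \<ominus>\<^bsub>M\<^esub> toP theta n \<phi> p) \<in> PB.PP.H.Bd n"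
      using id_minus_comp_coboundary [OF PP.algebra_two_resolutions_axioms theta \<rho> \<psi>(1)]
      by (simp cong: restrict_cong)
    then have "X = HH_to_Ext k A P dP \<epsilon> n (HC.cls n \<phi>)"
      unfolding HH_to_Ext_cls [OF \<phi>Z] \<psi>(2) by (rule P_cls_eqI [OF \<psi>(1) toP_Z [OF theta \<phi>Z]])
    then show "X \<in> HH_to_Ext k A P dP \<epsilon> n ` carrier (HH k A n)"
      using \<phi>Z unfolding HH_eq HC.cohomology_carrier by blast
  qed
  ultimately show ?thesis using lin by (simp add: linear_iso_def bij_betw_def)
qed

text \<open>In the difference of the two representatives the terms in which \<delta> is applied to a
  value of the cochain cancel. What remains is the cocycle \<open>ctb n \<phi>\<close> evaluated on
  the defect \<open>?u\<close>, a coboundary by \<open>null_homotopic_coboundary\<close>.\<close>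

lemma sharp_compatible:
  assumes ds: "d_lifting k E \<delta>e P dP \<epsilon> \<delta> ds" and x: "x \<in> carrier (HH k A n)"
  shows "cohomology_map HP (hom_diff P dP) (sharp P M \<delta> ds) n (HH_to_Ext k A P dP \<epsilon> n x) =
    HH_to_Ext k A P dP \<epsilon> n (gerstenhaber_bracket k A \<delta> n x)"
proof -
  from x obtain \<phi> where \<phi>: "\<phi> \<in> HC.Z n" "x = HC.cls n \<phi>"
    unfolding HH_eq HC.cohomology_carrier by blast
  then have c: "\<phi> \<in> carrier (HC n)" by (simp add: HC.Z_iff)
  interpret sh: cochain_morphism k HP "hom_diff P dP" HP "hom_diff P dP" "sharp P M \<delta> ds"
    by (intro cochain_morphism.intro cochain_morphism_axioms.intro PB.PP.H.cochain_complex_axioms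
        de.sharp_cochain_map [OF PB.PP.algebra_resolution_axioms M_d_operator ds])
  have GZ: "G n \<phi> \<in> HC.Z n" by (rule G.F_Z [OF \<phi>(1)])
  note FZ = toP_Z [OF theta \<phi>(1)]
  have lt: "linear_map E (P i) (bar i) (theta i)" for i using theta by (simp add: resolution_map_def)
  note ct = linear_map_closed [OF lt]
  have dso: "d_operator k E \<delta>e (P i) (ds i)" for i using ds by (simp add: d_lifting_def)
  note dsc = de.d_operator_closed [OF dso]
  let ?u = "\<lambda>i p. derbar i (theta i p) \<ominus>\<^bsub>bar i\<^esub> theta i (ds i p)"
  have \<psi>: "ctb n \<phi> \<in> bres.H.Z n" using ctb.F_Z [OF \<phi>(1)] .
  have \<psi>l: "linear_map E (bar n) M (ctb n \<phi>)" using \<psi> by (simp add: bres.cocycle_iff)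
  have derc: "derbar i X \<in> carrier (bar i)" if "X \<in> carrier (bar i)" for i X using that by simp
  have B: "(\<lambda>p\<in>carrier (P n). ctb n \<phi> (?u n p)) \<in> PB.PP.H.Bd n"
  proof (rule PB.null_homotopic_coboundary [OF _ _ _ \<psi>])
    fix i p
    show "linear_map E (P i) (bar i) (?u i)"
      by (rule de.d_operator_defect_linear [OF PB.P.P_module bar_left_module dso der_d_operator lt])
    { assume p: "p \<in> carrier (P (Suc i))"
      have "derbar i (theta i (dP i p)) = bd i (derbar (Suc i) (theta (Suc i) p))"
        using theta p ct [OF p] by (simp add: resolution_map_def der_bd)
      moreover have "theta i (ds i (dP i p)) = bd i (theta (Suc i) (ds (Suc i) p))"
        using theta ds p dsc [OF p] by (simp add: resolution_map_def d_lifting_def)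
      ultimately show "?u i (dP i p) = bd i (?u (Suc i) p)"
        using linear_map_minus [OF bar_left_module bar_left_module bd_E_linear derc [OF ct [OF p]] ct [OF dsc [OF p]]]
        by simp }
    \<comment> \<open>Both liftings cover \<delta> and \<open>theta\<close> covers the identity, so
      the two parts of the defect have the same augmentation
      \<open>\<delta> (\<epsilon> p)\<close>.\<close>
    { assume p: "p \<in> carrier (P 0)"
      have "aug (derbar 0 (theta 0 p)) = \<delta> (\<epsilon> p)"
        using theta p ct [OF p] by (simp add: resolution_map_def aug_der)
      moreover have "aug (theta 0 (ds 0 p)) = \<delta> (\<epsilon> p)"
        using theta ds p dsc [OF p] by (simp add: resolution_map_def d_lifting_def)
      moreover have "\<delta> (\<epsilon> p) \<in> carrier M" using PB.P.eps.f_closed [OF p] by simp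
      ultimately show "aug (?u 0 p) = \<zero>\<^bsub>M\<^esub>"
        using linear_map_minus [OF bar_left_module M_left_module aug_E_linear derc [OF ct [OF p]] ct [OF dsc [OF p]]]
        by (simp add: M.M.M.minus_eq M.M.M.r_neg del: M_simps bar_simps) }
  qed
  have "(\<lambda>p\<in>carrier (P n). sharp P M \<delta> ds n (toP theta n \<phi>) p \<ominus>\<^bsub>M\<^esub> toP theta n (G n \<phi>) p) =
      (\<lambda>p\<in>carrier (P n). ctb n \<phi> (?u n p))"
  proof (rule restrict_ext)
    fix p assume p: "p \<in> carrier (P n)"
    have cc: "ctb n \<phi> X \<in> carrier A" if "X \<in> carrier (bar n)" for X
      using linear_map_closed [OF \<psi>l that] by simp
    define u v w where "u = \<delta> (ctb n \<phi> (theta n p))" and "v = ctb n \<phi> (theta n (ds n p))"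
      and "w = ctb n \<phi> (derbar n (theta n p))"
    have cl: "u \<in> carrier A" "v \<in> carrier A" "w \<in> carrier A"
      unfolding u_def v_def w_def
      using cc [OF ct [OF p]] cc [OF ct [OF dsc [OF p]]] cc [OF derc [OF ct [OF p]]] by auto
    have "u \<ominus> v \<ominus> (u \<ominus> w) = u \<oplus> (\<ominus> u \<oplus> (w \<oplus> \<ominus> v))"
      using cl by (simp add: A.M.minus_eq A.M.minus_add A.M.a_ac)
    also have "\<dots> = w \<ominus> v" using cl by (simp add: A.M.r_neg2 A.M.minus_eq)
    finally have *: "u \<ominus> v \<ominus> (u \<ominus> w) = w \<ominus> v" .
    have 1: "sharp P M \<delta> ds n (toP theta n \<phi>) p = u \<ominus> v"
      using p dsc [OF p] by (simp add: sharp_def M_minus u_def v_def)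
    have 2: "toP theta n (G n \<phi>) p = u \<ominus> w"
      using p ct [OF p] by (simp add: ctb_bracket [OF c] sharp_def M_minus u_def w_def)
    have 3: "ctb n \<phi> (?u n p) = w \<ominus> v"
      using linear_map_minus [OF bar_left_module M_left_module \<psi>l derc [OF ct [OF p]] ct [OF dsc [OF p]]]
      by (simp add: M_minus v_def w_def)
    show "sharp P M \<delta> ds n (toP theta n \<phi>) p \<ominus>\<^bsub>M\<^esub> toP theta n (G n \<phi>) p = ctb n \<phi> (?u n p)"
      unfolding 1 2 3 M_minus by (rule *)
  qed
  then have "(\<lambda>p\<in>carrier (P n). sharp P M \<delta> ds n (toP theta n \<phi>) p \<ominus>\<^bsub>M\<^esub> toP theta n (G n \<phi>) p) \<in> PB.PP.H.Bd n"
    using B by simp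
  then have "PB.PP.H.cls n (sharp P M \<delta> ds n (toP theta n \<phi>)) = PB.PP.H.cls n (toP theta n (G n \<phi>))"
    by (rule P_cls_eqI [OF sh.F_Z [OF FZ] toP_Z [OF theta GZ]])
  then show ?thesis
    using \<phi> by (simp add: HH_to_Ext_cls sh.cohomology_map_cls [OF FZ] bracket_eq G.cohomology_map_cls HH_to_Ext_cls [OF GZ])
qed

lemma bracket_closed: "x \<in> carrier (HH k A n) \<Longrightarrow> gerstenhaber_bracket k A \<delta> n x \<in> carrier (HH k A n)"
  unfolding HH_eq bracket_eq by (rule linear_map_closed [OF G.cohomology_map_linear])

text \<open>The lifting chosen in \<open>nabla\<close> is genuine by
  \<open>de.d_lifting_exists\<close>, so \<open>sharp_compatible\<close> applies to it; the inverse
  of the identification then cancels by injectivity, the bracket being again a class in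
  \<open>HH k A n\<close>.\<close>

lemma nabla_HH_eq:
  assumes x: "x \<in> carrier (HH k A n)"
  shows "nabla_HH k A \<delta> P dP \<epsilon> n x = gerstenhaber_bracket k A \<delta> n x"
proof -
  have "d_lifting k E \<delta>e P dP \<epsilon> \<delta> (SOME fs. d_lifting k E \<delta>e P dP \<epsilon> \<delta> fs)"
    by (rule someI_ex [OF de.d_lifting_exists [OF P_res M_d_operator]])
  from sharp_compatible [OF this x]
  have "nabla k E \<delta>e M P dP \<epsilon> \<delta> n (HH_to_Ext k A P dP \<epsilon> n x) =
      HH_to_Ext k A P dP \<epsilon> n (gerstenhaber_bracket k A \<delta> n x)"
    by (simp add: nabla_def)
  moreover have "inj_on (HH_to_Ext k A P dP \<epsilon> n) (carrier (HH k A n))"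
    using HH_to_Ext_iso by (auto simp: linear_iso_def bij_betw_def)
  ultimately show ?thesis
    by (simp add: nabla_HH_def inv_into_f_f bracket_closed [OF x])
qed

end

theorem mainTheorem2:
  fixes k :: "'k ring"
    and A :: "('k, 'a) module"
    and \<delta> :: "'a \<Rightarrow> 'a"
    and P :: "nat \<Rightarrow> (('a list \<Rightarrow> 'k) set, 'p) module"
    and dP :: "nat \<Rightarrow> 'p \<Rightarrow> 'p"
    and \<epsilon> :: "'p \<Rightarrow> 'a"
  defines "Ae \<equiv> enveloping_algebra k A"
    and "\<delta>e \<equiv> enveloping_derivation k A \<delta>"
    and "M \<equiv> enveloping_self_module k A"
  assumes "cring k"
    and "assoc_algebra k A"
    and "projective_module k A"
    and "derivation k A \<delta>"
  shows "assoc_algebra k Ae \<and> derivation k Ae \<delta>e \<and>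
    left_module Ae M \<and> d_operator k Ae \<delta>e M \<delta> \<and>
    projective_resolution Ae M (bar_module k A) (bar_diff k A) (bar_augmentation k A) \<and>
    (projective_resolution Ae M P dP \<epsilon> \<longrightarrow>
       (\<exists>\<theta>. to_bar k A P dP \<epsilon> \<theta>) \<and>
       (\<forall>\<theta> n. to_bar k A P dP \<epsilon> \<theta> \<longrightarrow>
          (\<forall>x\<in>carrier (HH k A n). HH_to_Ext_along k A P dP \<theta> n x = HH_to_Ext k A P dP \<epsilon> n x)) \<and>
       (\<forall>n. linear_iso k (HH k A n) (Ext_via Ae P dP M n) (HH_to_Ext k A P dP \<epsilon> n)) \<and>
       (\<exists>\<delta>s. d_lifting k Ae \<delta>e P dP \<epsilon> \<delta> \<delta>s) \<and>
       (\<forall>n. \<forall>x\<in>carrier (HH k A n).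
          nabla_HH k A \<delta> P dP \<epsilon> n x = gerstenhaber_bracket k A \<delta> n x) \<and>
       (\<forall>\<delta>s. d_lifting k Ae \<delta>e P dP \<epsilon> \<delta> \<delta>s \<longrightarrow>
          cochain_map k (hom_complex Ae P M) (hom_diff P dP) (hom_complex Ae P M) (hom_diff P dP)
            (sharp P M \<delta> \<delta>s) \<and>
          (\<forall>n. \<forall>x\<in>carrier (HH k A n).
             cohomology_map (hom_complex Ae P M) (hom_diff P dP) (sharp P M \<delta> \<delta>s) n
                 (HH_to_Ext k A P dP \<epsilon> n x)
               = HH_to_Ext k A P dP \<epsilon> n (gerstenhaber_bracket k A \<delta> n x))))"
proof -
  interpret H: hoch_projective k A \<delta>
    using assms(4-) by (simp add: hoch_projective_def hoch_projective_axioms_def hoch_der_def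
        hoch_der_axioms_def hoch_def)
  \<comment> \<open>The resolution is a premise inside the conclusion, so the locale about
    \<open>P\<close> is entered conditionally.\<close>
  have R: "hoch_resolution k A \<delta> P dP \<epsilon>" if "projective_resolution Ae M P dP \<epsilon>"
    using that H.hoch_projective_axioms
    by (simp add: hoch_resolution_def hoch_resolution_axioms_def Ae_def M_def)
  show ?thesis
  proof (intro conjI impI allI ballI)
    show "assoc_algebra k Ae" unfolding Ae_def by (rule H.E_algebra)
    show "derivation k Ae \<delta>e" unfolding Ae_def \<delta>e_def by (rule H.de_derivation)
    show "left_module Ae M" unfolding Ae_def M_def by (rule H.M_left_module)
    show "d_operator k Ae \<delta>e M \<delta>" unfolding Ae_def \<delta>e_def M_def by (rule H.M_d_operator)
    show "projective_resolution Ae M (bar_module k A) (bar_diff k A) (bar_augmentation k A)"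
      unfolding Ae_def M_def by (rule H.bar_res)
  next
    assume r: "projective_resolution Ae M P dP \<epsilon>"
    interpret hoch_resolution k A \<delta> P dP \<epsilon> by (rule R [OF r])
    show "\<exists>\<theta>. to_bar k A P dP \<epsilon> \<theta>" by (rule to_bar_exists)
    show "HH_to_Ext_along k A P dP \<theta> n x = HH_to_Ext k A P dP \<epsilon> n x"
      if "to_bar k A P dP \<epsilon> \<theta>" "x \<in> carrier (HH k A n)" for \<theta> n x using that by (rule along_eq)
    show "linear_iso k (HH k A n) (Ext_via Ae P dP M n) (HH_to_Ext k A P dP \<epsilon> n)" for n
      unfolding Ae_def M_def by (rule HH_to_Ext_iso)
    show "\<exists>\<delta>s. d_lifting k Ae \<delta>e P dP \<epsilon> \<delta> \<delta>s"
      unfolding Ae_def \<delta>e_def by (rule H.de.d_lifting_exists [OF P_res H.M_d_operator])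
    show "nabla_HH k A \<delta> P dP \<epsilon> n x = gerstenhaber_bracket k A \<delta> n x" if "x \<in> carrier (HH k A n)" for n x
      using that by (rule nabla_HH_eq)
    show "cochain_map k (hom_complex Ae P M) (hom_diff P dP) (hom_complex Ae P M) (hom_diff P dP) (sharp P M \<delta> \<delta>s)"
      if "d_lifting k Ae \<delta>e P dP \<epsilon> \<delta> \<delta>s" for \<delta>s
      using that unfolding Ae_def \<delta>e_def M_def
      by (rule H.de.sharp_cochain_map [OF PB.PP.algebra_resolution_axioms H.M_d_operator])
    show "cohomology_map (hom_complex Ae P M) (hom_diff P dP) (sharp P M \<delta> \<delta>s) n (HH_to_Ext k A P dP \<epsilon> n x) =
        HH_to_Ext k A P dP \<epsilon> n (gerstenhaber_bracket k A \<delta> n x)"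
      if "d_lifting k Ae \<delta>e P dP \<epsilon> \<delta> \<delta>s" "x \<in> carrier (HH k A n)" for \<delta>s n x
      using that unfolding Ae_def \<delta>e_def M_def by (rule sharp_compatible)
  qed
qed

end
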